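(* Let $\mu(n)=\frac{\pi\sqrt{24n-1}}{6}$ and \[G(n)=\frac{\pi^2}{12\sqrt{3}\,\mu(n)^2}\left(1-\frac{1}{\mu(n)}\right)e^{\mu(n)}.\] Then for $k=0$ or $1$ and every positive integer $n$ with $\mu(n)\geq 88$, \[G(n)\left(1-\frac{1}{\mu(n)^6}\right)\le M_k(n)\le G(n)\left(1+\frac{1}{\mu(n)^6}\right).\]
   Context: For a partition $\lambda$ of a positive integer, let $\omega(\lambda)$ be the number of parts equal to $1$ and let $\nu(\lambda)$ be the number of parts of $\lambda$ strictly larger than $\omega(\lambda)$. The crank of $\lambda$ is its largest part if $\omega(\lambda)=0$, and $\nu(\lambda)-\omega(\lambda)$ if $\omega(\lambda)>0$. For $n\geq 0$, $M_0(n)$ (resp. $M_1(n)$) denotes the number of partitions of $n$ with even (resp. odd) crank. *)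

theory Defs
  imports Complex_Main "HOL-Library.Multiset"
begin

definition partitions_of :: "nat \<Rightarrow> nat multiset set" where
  "partitions_of n = {l. (\<forall>i \<in># l. 0 < i) \<and> \<Sum>\<^sub># l = n}"

lemma size_le_sum_mset:
  fixes l :: "nat multiset"
  assumes "\<forall>i \<in># l. 0 < i"
  shows "size l \<le> \<Sum>\<^sub># l"
  using assms by (induction l) auto

lemma finite_partitions_of: "finite (partitions_of n)"
proof (rule finite_subset)
  show "partitions_of n \<subseteq> mset ` {xs. set xs \<subseteq> {..n} \<and> length xs \<le> n}"
  proof
    fix l assume l: "l \<in> partitions_of n"
    obtain xs where xs: "mset xs = l"
      using ex_mset by blast
    have "length xs \<le> n"
      using l xs size_le_sum_mset[of l] by (auto simp: partitions_of_def)
    moreover have "set xs \<subseteq> {..n}"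
      using l xs member_le_sum_list[of _ xs]
      by (auto simp: partitions_of_def sum_mset_sum_list)
    ultimately show "l \<in> mset ` {xs. set xs \<subseteq> {..n} \<and> length xs \<le> n}"
      using xs by blast
  qed
  show "finite (mset ` {xs. set xs \<subseteq> {..n} \<and> length xs \<le> n})"
    by (intro finite_imageI finite_lists_length_le) simp
qed

definition num_ones :: "nat multiset \<Rightarrow> nat" where
  "num_ones l = count l 1"

definition num_gt_ones :: "nat multiset \<Rightarrow> nat" where
  "num_gt_ones l = size {#i \<in># l. num_ones l < i#}"

text \<open>The inserted \<open>0\<close> changes nothing for a nonempty partition; it only fixes the
  crank of the empty partition to be \<open>0\<close>.\<close>

definition crank :: "nat multiset \<Rightarrow> int" where
  "crank l = (if num_ones l = 0 then int (Max (insert 0 (set_mset l)))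
              else int (num_gt_ones l) - int (num_ones l))"

text \<open>Meant for \<open>k = 0\<close> (even crank) and \<open>k = 1\<close> (odd crank); on \<open>int\<close>, \<open>mod 2\<close>
  takes values in \<open>{0, 1}\<close> also for negative arguments.\<close>

definition crank_parity_count :: "nat \<Rightarrow> nat \<Rightarrow> nat" where
  "crank_parity_count k n = card {l \<in> partitions_of n. crank l mod 2 = int k}"

definition mu :: "nat \<Rightarrow> real" where
  "mu n = pi * sqrt (24 * real n - 1) / 6"

definition G :: "nat \<Rightarrow> real" where
  "G n = pi ^ 2 / (12 * sqrt 3 * mu n ^ 2) * (1 - 1 / mu n) * exp (mu n)"

end

theory Submission
  imports Defs "HOL-Complex_Analysis.Complex_Analysis" "HOL-Probability.Distributions"
    "HOL-Real_Asymp.Real_Asymp"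
begin

text \<open>
  With \<open>p(n)\<close> the number of partitions of \<open>n\<close> and \<open>D(n) = M\<^sub>0(n) - M\<^sub>1(n)\<close>, the two counts are
  \<open>(p(n) \<plusminus> D(n)) / 2\<close>, and \<open>2 G(n)\<close> is the leading term of Rademacher's series for \<open>p(n)\<close>.

  The transformation law of the eta function is used on the whole segment \<open>Re s = t\<close>,
  \<open>\<bar>Im s\<bar> \<le> \<pi>\<close> through the saddle point \<open>t\<close>: it replaces the generating function \<open>P(exp (-s))\<close> by
  \<open>sqrt (s / 2\<pi>) exp (\<pi>\<^sup>2 / 6s - s / 24)\<close> times \<open>P(exp (-4\<pi>\<^sup>2 / s))\<close>. The elementary factor has an explicit
  primitive in terms of the imaginary error function, which yields \<open>2 G(n)\<close> up to
  \<open>O(exp (\<mu> / 2))\<close>. The rest is estimated with \<open>P(exp (-4\<pi>\<^sup>2 / s)) - 1\<close>, to which the transformation law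
  is applied once more on the real axis when \<open>Re (4\<pi>\<^sup>2 / s)\<close> is small; the worst contribution,
  from the ends of the segment, is about \<open>exp (5\<mu> / 8)\<close>.

  The generating function of \<open>D\<close> is, by the q-binomial theorem, \<open>(q; q)\<^sub>\<infinity> / (-q; q)\<^sub>\<infinity>\<^sup>2\<close> up to the coefficient
  of \<open>q\<close>. Gauss's theta identity bounds \<open>(q; q)\<^sub>\<infinity> / (-q; q)\<^sub>\<infinity>\<close> by \<open>(1 + \<bar>q\<bar>) / (1 - \<bar>q\<bar>)\<close>, and
  \<open>1 / (-q; q)\<^sub>\<infinity> = (q; q\<^sup>2)\<^sub>\<infinity>\<close> is largest at \<open>q = -\<bar>q\<bar>\<close>, so \<open>D(n) = O(\<mu> exp (\<mu> / 2))\<close>.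
\<close>

section \<open>Generating functions of multisets\<close>

text \<open>The tolerated relative error \<mu>^-6 is far coarser than what the full series of
  Rademacher gives, so no Farey dissection is needed: after removal of the elementary factor, all of
  the segment, including the neighbourhoods of the other cusps, is bounded by absolute values. The
  price is exp (5\<mu>/8) instead of exp (\<mu>/2).

  What remains is a comparison of \<mu>^8 with exp (3\<mu>/8): two powers come from the factor
  \<mu>^-2 in \<open>G\<close>, six from the tolerance. At \<mu> = 88 the quotient of the two is
  just below 17, so the total constant in front of exp (5\<mu>/8) has to stay below about 0.055. A
  crude bound along the whole segment would exceed this; hence the factor sqrt (t/|s|) is kept and
  the segment is cut at |Im s| = 3\<pi>/4.

  The transformation law is proved first for the logarithm of P on the positive real axis, where
  only real series with positive terms occur, and reaches complex s by analytic
  continuation.\<close>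

text \<open>A finite set that forces all larger finite sums close to S lies in some
  \<open>B N\<close>; finite subsets of \<open>B n\<close> containing it approximate S and
  \<open>s n\<close> at the same time. This identifies an unconditional sum over all multisets with
  a limit of finite products.\<close>

lemma has_sum_incseq_Union:
  fixes f :: "'a \<Rightarrow> 'b::{comm_monoid_add, metric_space}"
  assumes "incseq B" "(\<Union>N. B N) = A" "(f has_sum S) A" "\<And>N. (f has_sum s N) (B N)"
  shows "s \<longlonglongrightarrow> S"
proof (rule metric_LIMSEQ_I)
  fix e :: real assume e: "e > 0"
  have "eventually (\<lambda>F. dist (sum f F) S < e / 2) (finite_subsets_at_top A)"
    using assms(3) e unfolding has_sum_def by (intro tendstoD) auto
  then obtain X where X: "finite X" "X \<subseteq> A"
    "\<forall>Y. finite Y \<and> X \<subseteq> Y \<and> Y \<subseteq> A \<longrightarrow> dist (sum f Y) S < e / 2"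
    unfolding eventually_finite_subsets_at_top by (elim exE conjE)
  have "\<exists>N. X \<subseteq> B N"
    using X(1,2) 
  proof (induction X rule: finite_induct)
    case (insert x F)
    then obtain N where N: "F \<subseteq> B N" by blast
    obtain N' where N': "x \<in> B N'" using insert assms(2) by blast
    have "B N \<subseteq> B (max N N')" "B N' \<subseteq> B (max N N')"
      using assms(1) by (auto simp: incseq_def)
    then show ?case using N N' by (intro exI[of _ "max N N'"]) auto
  qed auto
  then obtain N where N: "X \<subseteq> B N" by blast
  show "\<exists>no. \<forall>n\<ge>no. dist (s n) S < e"
  proof (intro exI allI impI)
    fix n assume n: "n \<ge> N"
    have Xn: "X \<subseteq> B n" using N assms(1) n by (auto simp: incseq_def)
    have "eventually (\<lambda>F. dist (sum f F) (s n) < e / 2) (finite_subsets_at_top (B n))"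
      using assms(4)[of n] e unfolding has_sum_def by (intro tendstoD) auto
    then obtain Z where Z: "finite Z" "Z \<subseteq> B n"
      "\<forall>Y. finite Y \<and> Z \<subseteq> Y \<and> Y \<subseteq> B n \<longrightarrow> dist (sum f Y) (s n) < e / 2"
      unfolding eventually_finite_subsets_at_top by (elim exE conjE)
    have "dist (sum f (Z \<union> X)) (s n) < e / 2" using Z Xn X by auto
    moreover have "dist (sum f (Z \<union> X)) S < e / 2"
      using Z X(1,2) assms(2) by (intro X(3)[rule_format]) auto
    ultimately show "dist (s n) S < e"
      using dist_triangle_half_r[of "sum f (Z \<union> X)" "s n" e S] by auto
  qed
qed

lemma norm_prod_mset:
  fixes w :: "'a \<Rightarrow> 'b::real_normed_field"
  shows "norm (\<Prod>x\<in>#l. w x) = (\<Prod>x\<in>#l. norm (w x))"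
  by (induction l) (auto simp: norm_mult)

text \<open>Splits off the multiplicity of one part. It is applied to the largest admissible part
  for Euler's product, and to the part 1 for sorting partitions by their number of ones.\<close>

lemma bij_betw_replicate_mset_plus:
  assumes "a \<notin> A"
  shows "bij_betw (\<lambda>(k, l). replicate_mset k a + l) (UNIV \<times> {l. set_mset l \<subseteq> A}) {l. set_mset l \<subseteq> insert a A}"
proof (rule bij_betwI[where g = "\<lambda>l. (count l a, filter_mset (\<lambda>x. x \<noteq> a) l)"], goal_cases)
  case 1
  then show ?case by (auto split: if_splits)
next
  case 2
  then show ?case by auto
next
  case (3 x)
  then obtain k l where x: "x = (k, l)" "set_mset l \<subseteq> A" by auto
  have "filter_mset (\<lambda>x. x \<noteq> a) l = l"
    using x assms by (intro filter_mset_eq_conv[THEN iffD2]) auto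
  moreover have "count l a = 0" using x assms by (auto simp: not_in_iff[symmetric])
  moreover have "filter_mset (\<lambda>x. x \<noteq> a) (replicate_mset k a) = {#}"
    by (simp add: filter_mset_eq_conv)
  ultimately show ?case using x by simp
next
  case (4 y)
  then show ?case by (auto simp: multiset_eq_iff)
qed

text \<open>In the induction step the multiplicity of the new part N contributes a geometric series.
  Absolute summability is carried along because it justifies summation over pairs (multiplicity,
  rest).\<close>

lemma has_sum_multisets_lessThan:
  fixes w :: "nat \<Rightarrow> 'a::{real_normed_field, banach}"
  assumes "\<And>i. norm (w i) < 1"
  shows "(\<lambda>l. norm (\<Prod>x\<in>#l. w x)) summable_on {l. set_mset l \<subseteq> {..<N}}"
    and "((\<lambda>l. \<Prod>x\<in>#l. w x) has_sum (\<Prod>i<N. inverse (1 - w i))) {l. set_mset l \<subseteq> {..<N}}"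
proof (induction N)
  case 0
  case 1
  have *: "{l. set_mset l \<subseteq> {..<0::nat}} = {{#}}" by auto
  show ?case by (subst *) simp
  case 2
  show ?case by (subst *) (simp add: has_sum_finite_iff)
next
  case (Suc N)
  let ?f = "\<lambda>l. \<Prod>x\<in>#l. w x"
  let ?B = "{l. set_mset l \<subseteq> {..<N}}"
  have bij: "bij_betw (\<lambda>(k, l). replicate_mset k N + l) (UNIV \<times> ?B) {l. set_mset l \<subseteq> {..<Suc N}}"
    using bij_betw_replicate_mset_plus[of N "{..<N}"] by (simp add: lessThan_Suc)
  have geo: "(\<lambda>k. norm (w N ^ k)) summable_on UNIV"
    using assms[of N] by (intro norm_summable_imp_summable_on) (auto simp: norm_power summable_geometric)
  have geo': "((\<lambda>k. w N ^ k) has_sum inverse (1 - w N)) UNIV"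
    using norm_summable_imp_has_sum[OF _ geometric_sums[OF assms[of N]]] assms[of N]
    by (auto simp: norm_power summable_geometric inverse_eq_divide)
  have eq: "?f (case z of (k, l) \<Rightarrow> replicate_mset k N + l) = (case z of (k, l) \<Rightarrow> w N ^ k * ?f l)" for z
    by (cases z) (simp add: image_replicate_mset prod_mset_replicate_mset)
  have abs: "(\<lambda>z. norm (case z of (k, l) \<Rightarrow> w N ^ k * ?f l)) summable_on UNIV \<times> ?B"
  proof (rule summable_on_SigmaI)
    show "((\<lambda>y. norm (case (k, y) of (k, l) \<Rightarrow> w N ^ k * ?f l)) has_sum
            (norm (w N ^ k) * infsum (\<lambda>l. norm (?f l)) ?B)) ?B" for k
      using has_sum_cmult_right[OF has_sum_infsum[OF Suc.IH(1)]] by (simp add: norm_mult)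
    show "(\<lambda>k. norm (w N ^ k) * infsum (\<lambda>l. norm (?f l)) ?B) summable_on UNIV"
      using geo by (rule summable_on_cmult_left)
  qed auto
  case 1
  show ?case
    using abs summable_on_reindex_bij_betw[OF bij, of "\<lambda>l. norm (?f l)"] unfolding eq by simp
  case 2
  have "((\<lambda>z. case z of (k, l) \<Rightarrow> w N ^ k * ?f l) has_sum (inverse (1 - w N) * (\<Prod>i<N. inverse (1 - w i)))) (UNIV \<times> ?B)"
  proof (rule has_sum_SigmaI)
    show "((\<lambda>y. case (k, y) of (k, l) \<Rightarrow> w N ^ k * ?f l) has_sum (w N ^ k * (\<Prod>i<N. inverse (1 - w i)))) ?B" for k
      using has_sum_cmult_right[OF Suc.IH(2)] by simp
    show "((\<lambda>k. w N ^ k * (\<Prod>i<N. inverse (1 - w i))) has_sum inverse (1 - w N) * (\<Prod>i<N. inverse (1 - w i))) UNIV"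
      using has_sum_cmult_left[OF geo'] by simp
    show "(\<lambda>z. case z of (k, l) \<Rightarrow> w N ^ k * ?f l) summable_on UNIV \<times> ?B"
      using abs abs_summable_summable by blast
  qed
  then show ?case
    using has_sum_reindex_bij_betw[OF bij, of ?f] unfolding eq by (simp add: mult.commute)
qed

lemma convergent_prod_one_minus:
  fixes w :: "nat \<Rightarrow> 'a::{real_normed_field, banach}"
  assumes "\<And>i. norm (w i) < 1" "summable (\<lambda>i. norm (w i))"
  shows "convergent_prod (\<lambda>i. 1 - w i)" "(\<Prod>i. 1 - w i) \<noteq> 0"
    and "(\<lambda>N. \<Prod>i<N. 1 - w i) \<longlonglongrightarrow> (\<Prod>i. 1 - w i)"
proof -
  show *: "convergent_prod (\<lambda>i. 1 - w i)"
    using assms summable_imp_abs_convergent_prod[of "\<lambda>i. 1 - w i"]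
    by (simp add: abs_convergent_prod_imp_convergent_prod)
  show "(\<Prod>i. 1 - w i) \<noteq> 0"
    using assms(1) by (intro prodinf_nonzero[OF *]) (metis eq_iff_diff_eq_0 less_irrefl norm_one)
  show "(\<lambda>N. \<Prod>i<N. 1 - w i) \<longlonglongrightarrow> (\<Prod>i. 1 - w i)"
    using convergent_prod_LIMSEQ[OF *] LIMSEQ_lessThan_iff_atMost[of "\<lambda>A. \<Prod>i\<in>A. 1 - w i"] by blast
qed

lemma incseq_multisets: "incseq (\<lambda>N. {l. set_mset l \<subseteq> {..<N::nat}})"
  by (auto simp: incseq_def)

lemma Union_multisets: "(\<Union>N. {l. set_mset l \<subseteq> {..<N::nat}}) = UNIV"
proof -
  have "\<exists>N. set_mset l \<subseteq> {..<N}" for l :: "nat multiset"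
    using finite_nat_bounded by auto
  then show ?thesis by auto
qed

text \<open>Weights belong to the individual parts rather than being powers of q, so the same
  product formula covers forbidden parts (weight 0) and parts that carry a sign.\<close>

theorem has_sum_multisets:
  fixes w :: "nat \<Rightarrow> 'a::{real_normed_field, banach}"
  assumes "\<And>i. norm (w i) < 1" "summable (\<lambda>i. norm (w i))"
  shows "(\<lambda>l. norm (\<Prod>x\<in>#l. w x)) summable_on UNIV"
    and "((\<lambda>l. \<Prod>x\<in>#l. w x) has_sum inverse (\<Prod>i. 1 - w i)) UNIV"
proof -
  \<comment> \<open>Absolute convergence: the same formula for the norms of the weights bounds every
    finite sum by a partial product, and these are bounded since the infinite product converges to a
    nonzero value.\<close>
  define v where "v i = norm (w i)" for i
  have v: "norm (v i) < 1" "v i \<ge> 0" for i using assms(1) by (auto simp: v_def)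
  have vs: "summable (\<lambda>i. norm (v i))" using assms by (simp add: v_def)
  have "(\<lambda>N. inverse (\<Prod>i<N. 1 - v i)) \<longlonglongrightarrow> inverse (\<Prod>i. 1 - v i)"
    by (intro tendsto_inverse convergent_prod_one_minus v vs)
  then have "Bseq (\<lambda>N. inverse (\<Prod>i<N. 1 - v i))" 
    using convergentI convergent_imp_Bseq by blast
  then obtain C where C: "\<And>N. norm (inverse (\<Prod>i<N. 1 - v i)) \<le> C"
    unfolding Bseq_def by auto
  show abs: "(\<lambda>l. norm (\<Prod>x\<in>#l. w x)) summable_on UNIV"
  proof (rule nonneg_bdd_above_summable_on)
    show "bdd_above (sum (\<lambda>l. norm (\<Prod>x\<in>#l. w x)) ` {F. F \<subseteq> UNIV \<and> finite F})"
    proof (rule bdd_aboveI2)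
      fix F :: "nat multiset set" assume F: "F \<in> {F. F \<subseteq> UNIV \<and> finite F}"
      have "finite (\<Union>l\<in>F. set_mset l)" using F by auto
      then obtain N where N: "(\<Union>l\<in>F. set_mset l) \<subseteq> {..<N}" 
        using finite_nat_bounded by auto
      have "(\<Sum>l\<in>F. norm (\<Prod>x\<in>#l. w x)) = (\<Sum>l\<in>F. \<Prod>x\<in>#l. v x)"
        by (simp add: norm_prod_mset v_def)
      also have "\<dots> \<le> (\<Prod>i<N. inverse (1 - v i))"
      proof (rule finite_sum_le_has_sum[OF has_sum_multisets_lessThan(2)[of v N]])
        fix l assume "l \<in> {l. set_mset l \<subseteq> {..<N}} - F"
        show "(\<Prod>x\<in>#l. v x) \<ge> 0" using v(2) by (induction l) auto
      qed (use N F v in auto)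
      also have "\<dots> = inverse (\<Prod>i<N. 1 - v i)" by (simp add: prod_inversef[unfolded o_def])
      also have "\<dots> \<le> C" using C[of N] by (simp only: real_norm_def abs_le_iff)
      finally show "(\<Sum>l\<in>F. norm (\<Prod>x\<in>#l. w x)) \<le> C" .
    qed
  qed auto
  then obtain S where S: "((\<lambda>l. \<Prod>x\<in>#l. w x) has_sum S) UNIV"
    using abs_summable_summable has_sum_infsum by metis
  have "(\<lambda>N. \<Prod>i<N. inverse (1 - w i)) \<longlonglongrightarrow> S"
    by (rule has_sum_incseq_Union[OF incseq_multisets Union_multisets S])
       (rule has_sum_multisets_lessThan(2)[OF assms(1)])
  moreover have "(\<lambda>N. \<Prod>i<N. inverse (1 - w i)) \<longlonglongrightarrow> inverse (\<Prod>i. 1 - w i)"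
    unfolding prod_inversef[unfolded o_def]
    by (intro tendsto_inverse convergent_prod_one_minus assms)
  ultimately have "S = inverse (\<Prod>i. 1 - w i)"
    by (rule LIMSEQ_unique)
  with S show "((\<lambda>l. \<Prod>x\<in>#l. w x) has_sum inverse (\<Prod>i. 1 - w i)) UNIV" by simp
qed

lemma partitions_of_alt: "partitions_of n = {l. 0 \<notin># l \<and> \<Sum>\<^sub># l = n}"
  unfolding partitions_of_def by (metis gr0I less_not_refl)

lemma sums_partitions_of:
  fixes c :: "nat multiset \<Rightarrow> 'a::{real_normed_field, banach}"
  assumes "((\<lambda>l. c l * q ^ \<Sum>\<^sub># l) has_sum S) {l. 0 \<notin># l}"
  shows "(\<lambda>n. (\<Sum>l\<in>partitions_of n. c l) * q ^ n) sums S"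
proof -
  have bij: "bij_betw snd (SIGMA n:UNIV. partitions_of n) {l. 0 \<notin># l}"
    by (rule bij_betwI[where g = "\<lambda>l. (\<Sum>\<^sub># l, l)"]) (auto simp: partitions_of_alt)
  have "((\<lambda>z. c (snd z) * q ^ \<Sum>\<^sub># (snd z)) has_sum S) (SIGMA n:UNIV. partitions_of n)"
    using has_sum_reindex_bij_betw[OF bij, of "\<lambda>l. c l * q ^ \<Sum>\<^sub># l"] assms by simp
  then have "((\<lambda>n. \<Sum>l\<in>partitions_of n. c l * q ^ \<Sum>\<^sub># l) has_sum S) UNIV"
    by (rule has_sum_SigmaD) (auto simp: finite_partitions_of has_sum_finite_iff)
  moreover have "(\<Sum>l\<in>partitions_of n. c l * q ^ \<Sum>\<^sub># l) = (\<Sum>l\<in>partitions_of n. c l) * q ^ n" for n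
    unfolding sum_distrib_right by (intro sum.cong) (auto simp: partitions_of_def)
  ultimately show ?thesis by (simp add: has_sum_imp_sums)
qed

section \<open>q-series\<close>

definition qpoch :: "'a \<Rightarrow> 'a \<Rightarrow> 'a::{real_normed_field, banach}" where
  "qpoch a q = (\<Prod>n. 1 - a * q ^ n)"

lemma norm_mult_power_less_1:
  fixes a q :: "'a::real_normed_field"
  assumes "norm a < 1" "norm q < 1"
  shows "norm (a * q ^ n) < 1"
proof -
  have "norm (a * q ^ n) \<le> norm a * 1"
    unfolding norm_mult norm_power using assms by (intro mult_left_mono power_le_one) auto
  with assms(1) show ?thesis by simp
qed

lemma
  fixes a q :: "'a::{real_normed_field, banach}"
  assumes "norm a < 1" "norm q < 1"
  shows qpoch_LIMSEQ: "(\<lambda>N. \<Prod>i<N. 1 - a * q ^ i) \<longlonglongrightarrow> qpoch a q"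
    and qpoch_nonzero: "qpoch a q \<noteq> 0"
proof -
  have "summable (\<lambda>i. norm (a * q ^ i))"
    using assms(2) by (simp add: norm_mult norm_power summable_mult summable_geometric)
  then show "(\<lambda>N. \<Prod>i<N. 1 - a * q ^ i) \<longlonglongrightarrow> qpoch a q" "qpoch a q \<noteq> 0"
    unfolding qpoch_def using assms
    by (intro convergent_prod_one_minus norm_mult_power_less_1; simp)+
qed

lemma one_minus_mult_power_nonzero:
  fixes a q :: "'a::real_normed_field"
  assumes "norm a < 1" "norm q < 1"
  shows "1 - a * q ^ n \<noteq> 0"
  using norm_mult_power_less_1[OF assms, of n] by auto

text \<open>Both sides satisfy \<open>(1 - x) F x = (1 - a x) F (q x)\<close>.\<close>

theorem q_binomial:
  fixes a q x :: "'a::{real_normed_field, banach}"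
  assumes "norm a < 1" "norm q < 1" "norm x < 1"
  shows "(\<lambda>j. (\<Prod>i<j. (1 - a * q ^ i) / (1 - q ^ Suc i)) * x ^ j) sums (qpoch (a * x) q / qpoch x q)"
proof -
  define c where "c j = (\<Prod>i<j. (1 - a * q ^ i) / (1 - q ^ Suc i))" for j
  define F where "F x = (\<Sum>j. c j * x ^ j)" for x
  have c_eq: "c j = (\<Prod>i<j. 1 - a * q ^ i) / (\<Prod>i<j. 1 - q * q ^ i)" for j
    by (simp add: c_def prod_dividef)
  \<comment> \<open>Convergent coefficients are bounded, so the series converges on the whole unit
    disc.\<close>
  have "c \<longlonglongrightarrow> qpoch a q / qpoch q q"
    unfolding c_eq using assms by (intro tendsto_divide qpoch_LIMSEQ qpoch_nonzero)
  then have "Bseq c" using convergentI convergent_imp_Bseq by metis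
  then obtain C where C: "\<And>j. norm (c j) \<le> C" unfolding Bseq_def by auto
  have smb: "summable (\<lambda>j. c j * y ^ j)" if "norm y < 1" for y
  proof (rule summable_comparison_test'[where g = "\<lambda>j. C * norm y ^ j"])
    show "summable (\<lambda>j. C * norm y ^ j)" using that by (intro summable_mult summable_geometric) auto
    show "norm (c j * y ^ j) \<le> C * norm y ^ j" for j
      unfolding norm_mult norm_power using C by (intro mult_right_mono) auto
  qed
  have c_Suc: "c (Suc j) * (1 - q ^ Suc j) = c j * (1 - a * q ^ j)" for j
    using one_minus_mult_power_nonzero[of q q j] assms by (simp add: c_def)
  have qy: "norm (q * y) < 1" if "norm y < 1" for y
    using norm_mult_power_less_1[of y q 1] assms that by (simp add: mult.commute)
  have feq: "F y * (1 - y) = F (q * y) * (1 - a * y)" if y: "norm y < 1" for y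
  proof -
    let ?f = "\<lambda>j. c j * y ^ j - c j * (q * y) ^ j"
    have 1: "?f sums (F y - F (q * y))"
      unfolding F_def by (intro sums_diff summable_sums smb y qy)
    have 2: "(\<lambda>j. y * (c j * y ^ j - a * (c j * (q * y) ^ j))) sums (y * (F y - a * F (q * y)))"
      unfolding F_def by (intro sums_mult sums_diff summable_sums smb y qy)
    have "y * (c j * y ^ j - a * (c j * (q * y) ^ j)) = ?f (Suc j)" for j
    proof -
      have "y * (c j * y ^ j - a * (c j * (q * y) ^ j)) = c j * (1 - a * q ^ j) * y ^ Suc j"
        by (simp add: algebra_simps power_mult_distrib)
      also have "\<dots> = c (Suc j) * (1 - q ^ Suc j) * y ^ Suc j" by (simp only: c_Suc)
      also have "\<dots> = ?f (Suc j)" by (simp add: algebra_simps power_mult_distrib)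
      finally show ?thesis .
    qed
    then have "(\<lambda>j. ?f (Suc j)) sums (y * (F y - a * F (q * y)))" using 2 by simp
    then have "?f sums (y * (F y - a * F (q * y)))" 
      using sums_Suc_iff[of ?f] by simp
    with 1 have "F y - F (q * y) = y * (F y - a * F (q * y))" by (rule sums_unique2)
    then show ?thesis by (simp add: algebra_simps)
  qed
  \<comment> \<open>Iterating the functional equation moves the argument to x q^n, which tends to 0,
    where F is continuous with value 1.\<close>
  have it: "F x * (\<Prod>i<n. 1 - x * q ^ i) = F (x * q ^ n) * (\<Prod>i<n. 1 - (a * x) * q ^ i)" for n
  proof (induction n)
    case (Suc n)
    have "F (x * q ^ n) * (1 - x * q ^ n) = F (x * q ^ Suc n) * (1 - a * (x * q ^ n))"
      using feq[OF norm_mult_power_less_1[OF assms(3,2)], of n] by (simp add: mult_ac)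
    moreover have "F x * (\<Prod>i<Suc n. 1 - x * q ^ i) = F (x * q ^ n) * (1 - x * q ^ n) * (\<Prod>i<n. 1 - (a * x) * q ^ i)"
      using Suc.IH by simp
    ultimately show ?case by (simp add: mult_ac)
  qed auto
  have ax: "norm (a * x) < 1" using norm_mult_power_less_1[of a x 1] assms by simp
  have "isCont F 0" unfolding F_def
    by (rule isCont_powser[where K = "1/2"]) (auto intro!: smb simp: norm_divide)
  moreover have "(\<lambda>n. x * q ^ n) \<longlonglongrightarrow> 0"
    using assms(2) by (intro tendsto_mult_right_zero LIMSEQ_power_zero)
  ultimately have "(\<lambda>n. F (x * q ^ n)) \<longlonglongrightarrow> F 0" by (rule isCont_tendsto_compose)
  moreover have "F 0 = 1" unfolding F_def by (simp add: c_def)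
  ultimately have l1: "(\<lambda>n. F (x * q ^ n) * (\<Prod>i<n. 1 - (a * x) * q ^ i)) \<longlonglongrightarrow> 1 * qpoch (a * x) q"
    using ax assms by (intro tendsto_mult qpoch_LIMSEQ) auto
  have l2: "(\<lambda>n. F x * (\<Prod>i<n. 1 - x * q ^ i)) \<longlonglongrightarrow> F x * qpoch x q"
    using assms by (intro tendsto_mult qpoch_LIMSEQ tendsto_const)
  have "F x * qpoch x q = qpoch (a * x) q"
    using LIMSEQ_unique[OF l2[unfolded it] l1] by simp
  then have "F x = qpoch (a * x) q / qpoch x q"
    using qpoch_nonzero[OF assms(3,2)] by (simp add: field_simps)
  moreover have "(\<lambda>j. c j * x ^ j) sums F x" unfolding F_def by (intro summable_sums smb assms)
  ultimately show ?thesis by (simp add: c_def)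
qed

section \<open>Gauss's theta identity\<close>

lemma one_plus_power_nonzero:
  fixes q :: "'a::real_normed_field"
  assumes "norm q < 1"
  shows "1 + q ^ Suc n \<noteq> 0"
  using one_minus_mult_power_nonzero[of "-q" q n] assms by simp

lemma one_minus_power_nonzero:
  fixes q :: "'a::real_normed_field"
  assumes "norm q < 1"
  shows "1 - q ^ Suc n \<noteq> 0"
  using one_minus_mult_power_nonzero[of "q" q n] assms by simp

text \<open>A finite form of Gauss's identity
  \<open>(q; q)\<^sub>\<infinity> / (-q; q)\<^sub>\<infinity> = (\<Sum>k\<in>\<int>. (-1)^k q^(k^2))\<close>, in the style of Shanks; as \<open>n \<rightarrow> \<infinity>\<close>
  only the term \<open>s = 0\<close> of the left-hand side survives.\<close>

lemma gauss_finite: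
  fixes q :: "'a::real_normed_field"
  assumes "norm q < 1"
  defines "R \<equiv> (\<lambda>n. \<Prod>i<n. (1 - q ^ Suc i) / (1 + q ^ Suc i))"
  shows "(\<Sum>s\<le>n. (-1) ^ s * (R n / R s) * (2 / (1 + q ^ s)) * q ^ (s * Suc n))
         = 1 + 2 * (\<Sum>s<n. (-1) ^ Suc s * q ^ (Suc s ^ 2))"
proof (induction n)
  case 0
  show ?case by (simp add: R_def)
next
  case (Suc n)
  have R_nz: "R k \<noteq> 0" for k
    unfolding R_def using one_plus_power_nonzero[OF assms(1)] one_minus_power_nonzero[OF assms(1)] by auto
  have R_Suc: "R (Suc k) = R k * ((1 - q ^ Suc k) / (1 + q ^ Suc k))" for k
    by (simp add: R_def)
  define m where "m = Suc n"
  define T where "T k s = (-1) ^ s * (R k / R s) * (2 / (1 + q ^ s)) * q ^ (s * Suc k)" for k s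
  \<comment> \<open>\<open>V\<close> is a telescoping certificate for the passage from n to m = n +
    1. The value 0 at s = 0 is the correct boundary term: the recurrence of \<open>R\<close> would
    make 1/R(-1) vanish, whereas truncated subtraction would give 1/R(0).\<close>
  define V where "V s = (if s = 0 then 0 else (-1) ^ s * q ^ (s * m) / R (s - 1))" for s
  define c where "c = 2 * R n / (1 + q ^ m)"
  have nz: "1 + q ^ m \<noteq> 0" unfolding m_def by (rule one_plus_power_nonzero[OF assms(1)])
  have diff: "T m s - T n s = c * (V (Suc s) - V s)" for s
  proof (cases s)
    case 0
    have R0: "R 0 = 1" by (simp add: R_def)
    show ?thesis using nz R_Suc[of n, folded m_def]
      unfolding 0 T_def V_def c_def by (simp add: R0 field_simps)
  next
    case (Suc r)
    define x y Q where "x = q ^ s" and "y = q ^ (s * m)" and "Q = q ^ m"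
    have x: "1 + x \<noteq> 0" "1 - x \<noteq> 0" and Q: "1 + Q \<noteq> 0"
      using one_plus_power_nonzero[OF assms(1), of r] one_minus_power_nonzero[OF assms(1), of r] nz
      by (simp_all add: x_def Q_def Suc)
    have Rs: "R s = R r * ((1 - x) / (1 + x))" using R_Suc[of r] by (simp add: Suc x_def)
    have Rm: "R m = R n * ((1 - Q) / (1 + Q))" using R_Suc[of n] by (simp add: Q_def m_def)
    have 1: "T m s = (-1) ^ s * (R n * ((1 - Q) / (1 + Q)) / (R r * ((1 - x) / (1 + x)))) * (2 / (1 + x)) * (y * x)"
      unfolding T_def Rs[symmetric] Rm[symmetric] by (simp add: x_def y_def power_add[symmetric] algebra_simps)
    have 2: "T n s = (-1) ^ s * (R n / (R r * ((1 - x) / (1 + x)))) * (2 / (1 + x)) * y"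
      unfolding T_def Rs[symmetric] by (simp add: x_def y_def m_def)
    have 3: "V (Suc s) = - ((-1) ^ s * (y * Q) / (R r * ((1 - x) / (1 + x))))"
      unfolding V_def Rs[symmetric] by (simp add: y_def Q_def power_add mult_ac)
    have 4: "V s = (-1) ^ s * y / R r" using Suc by (simp add: V_def y_def)
    show ?thesis
      unfolding 1 2 3 4 c_def Q_def[symmetric] using x Q R_nz[of r]
      by (simp add: divide_simps) (simp add: algebra_simps)
  qed
  have "(\<Sum>s\<le>n. T m s) - (\<Sum>s\<le>n. T n s) = (\<Sum>s<m. c * (V (Suc s) - V s))"
    unfolding sum_subtractf[symmetric] m_def lessThan_Suc_atMost by (intro sum.cong diff[unfolded m_def] refl)
  also have "\<dots> = c * V m" unfolding sum_distrib_left[symmetric] sum_lessThan_telescope by (simp add: V_def)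
  also have "\<dots> = 2 / (1 + q ^ m) * ((-1) ^ m * q ^ (m * m))"
    using R_nz[of n] by (simp add: c_def V_def m_def)
  finally have A: "(\<Sum>s\<le>n. T m s) = (\<Sum>s\<le>n. T n s) + 2 / (1 + q ^ m) * ((-1) ^ m * q ^ (m * m))"
    by (simp add: algebra_simps)
  have B: "T m m = 2 / (1 + q ^ m) * ((-1) ^ m * q ^ (m * m)) * q ^ m"
    unfolding T_def using R_nz[of m] by (simp add: power_add mult_ac)
  have "(\<Sum>s\<le>Suc n. T m s) = (\<Sum>s\<le>n. T n s) + 2 / (1 + q ^ m) * ((-1) ^ m * q ^ (m * m)) * (1 + q ^ m)"
  proof -
    have "(\<Sum>s\<le>Suc n. T m s) = (\<Sum>s\<le>n. T m s) + T m m" by (simp add: m_def)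
    then show ?thesis unfolding A B by (simp add: distrib_left)
  qed
  also have "\<dots> = (\<Sum>s\<le>n. T n s) + 2 * ((-1) ^ m * q ^ (m ^ 2))"
    using nz by (simp add: power2_eq_square)
  finally show ?case
    using Suc.IH unfolding T_def m_def by (simp add: algebra_simps)
qed

text \<open>Since k^2 \<ge> k, the theta series is dominated by 1 + 2 (|q| + |q|^2 + ...), which is
  the stated bound. Being only of order 1/(1 - |q|) on the whole circle, it costs no exponential
  factor in the estimate of the crank difference. The terms s > 0 of the finite identity are at most
  a constant times n |q|^n in total.\<close>

lemma norm_gauss_le:
  fixes q :: "'a::{real_normed_field, banach}"
  assumes q: "norm q < 1"
  shows "norm (qpoch q q / qpoch (-q) q) \<le> (1 + norm q) / (1 - norm q)"
proof -
  define R where "R = (\<lambda>n. \<Prod>i<n. (1 - q ^ Suc i) / (1 + q ^ Suc i))"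
  have R_eq: "R n = (\<Prod>i<n. 1 - q * q ^ i) / (\<Prod>i<n. 1 - (-q) * q ^ i)" for n
    by (simp add: R_def prod_dividef)
  have lim: "R \<longlonglongrightarrow> qpoch q q / qpoch (-q) q"
    unfolding R_eq using q by (intro tendsto_divide qpoch_LIMSEQ qpoch_nonzero) auto
  have R_nz: "R k \<noteq> 0" for k
    unfolding R_def using one_plus_power_nonzero[OF q] one_minus_power_nonzero[OF q] by auto
  have "Bseq R" using lim convergentI convergent_imp_Bseq by metis
  then obtain C where C: "\<And>j. norm (R j) \<le> C" unfolding Bseq_def by auto
  have "qpoch q q / qpoch (-q) q \<noteq> 0" using q by (simp add: qpoch_nonzero)
  then have "Bseq (\<lambda>n. inverse (R n))" 
    using tendsto_inverse[OF lim] convergentI convergent_imp_Bseq by metis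
  then obtain D where D: "\<And>j. norm (inverse (R j)) \<le> D" unfolding Bseq_def by auto
  have C0: "C \<ge> 0" "D \<ge> 0" using C[of 0] D[of 0] norm_ge_zero order_trans by metis+
  define S where "S n = 1 + 2 * (\<Sum>s<n. (-1) ^ Suc s * q ^ (Suc s ^ 2))" for n
  define K where "K = C * D * (2 / (1 - norm q))"
  have K0: "K \<ge> 0" using C0 q by (auto simp: K_def)
  have diff: "norm (S n - R n) \<le> K * (of_nat n * norm q ^ n)" for n
  proof -
    define T where "T s = (-1) ^ s * (R n / R s) * (2 / (1 + q ^ s)) * q ^ (s * Suc n)" for s
    have "S n = (\<Sum>s\<le>n. T s)"
      using gauss_finite[OF q, of n] by (simp add: S_def T_def R_def)
    also have "\<dots> = T 0 + (\<Sum>s<n. T (Suc s))"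
      by (simp only: lessThan_Suc_atMost[symmetric] sum.lessThan_Suc_shift)
    also have "T 0 = R n" by (simp add: T_def R_def)
    finally have "norm (S n - R n) = norm (\<Sum>s<n. T (Suc s))" by simp
    also have "\<dots> \<le> (\<Sum>s<n. K * norm q ^ n)"
    proof (rule sum_norm_le)
      fix s
      have "norm (1 - (- (q ^ Suc s))) \<ge> 1 - norm (- (q ^ Suc s))" 
        using norm_triangle_ineq2[of 1 "- (q ^ Suc s)"] by simp
      moreover have "norm q ^ Suc s \<le> norm q ^ 1" using q by (intro power_decreasing) auto
      ultimately have "1 - norm q \<le> norm (1 + q ^ Suc s)" by (simp add: norm_power norm_mult)
      then have 1: "norm (2 / (1 + q ^ Suc s)) \<le> 2 / (1 - norm q)"
        using q by (simp add: norm_divide frac_le)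
      have 2: "norm (R n / R (Suc s)) \<le> C * D"
        using C[of n] D[of "Suc s"] C0 unfolding divide_inverse norm_mult by (intro mult_mono) auto
      have "n \<le> Suc s * Suc n" by simp
      then have 3: "norm (q ^ (Suc s * Suc n)) \<le> norm q ^ n"
        unfolding norm_power using q by (intro power_decreasing) auto
      have "norm (T (Suc s)) = norm (R n / R (Suc s)) * norm (2 / (1 + q ^ Suc s)) * norm (q ^ (Suc s * Suc n))"
        unfolding T_def by (simp only: norm_mult norm_power) simp
      also have "\<dots> \<le> (C * D) * (2 / (1 - norm q)) * norm q ^ n"
        using C0 q by (intro mult_mono 1 2 3) auto
      finally show "norm (T (Suc s)) \<le> K * norm q ^ n" unfolding K_def .
    qed
    also have "\<dots> = K * (of_nat n * norm q ^ n)" by simp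
    finally show ?thesis .
  qed
  have "(\<lambda>n. K * (of_nat n * norm q ^ n)) \<longlonglongrightarrow> K * 0"
    using q powser_times_n_limit_0[of "norm q"] by (intro tendsto_mult tendsto_const) auto
  then have "(\<lambda>n. S n - R n) \<longlonglongrightarrow> 0"
    using Lim_null_comparison[OF always_eventually[OF allI[OF diff]]] by simp
  from tendsto_add[OF this lim] have "S \<longlonglongrightarrow> qpoch q q / qpoch (-q) q"
    by (simp only: diff_add_cancel add_0)
  then have "(\<lambda>n. norm (S n)) \<longlonglongrightarrow> norm (qpoch q q / qpoch (-q) q)" by (rule tendsto_norm)
  moreover have "norm (S n) \<le> (1 + norm q) / (1 - norm q)" for n
  proof -
    have "norm (S n) \<le> 1 + 2 * norm (\<Sum>s<n. (-1) ^ Suc s * q ^ (Suc s ^ 2))"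
      unfolding S_def by (rule order.trans[OF norm_triangle_ineq]) (simp add: norm_mult)
    also have "norm (\<Sum>s<n. (-1) ^ Suc s * q ^ (Suc s ^ 2)) \<le> (\<Sum>s<n. norm q ^ Suc s)"
    proof (rule sum_norm_le)
      fix s
      have "norm q ^ (Suc s ^ 2) \<le> norm q ^ Suc s"
        using q by (intro power_decreasing) (auto simp: power2_eq_square)
      then show "norm ((-1) ^ Suc s * q ^ (Suc s ^ 2)) \<le> norm q ^ Suc s"
        by (simp add: norm_mult norm_power)
    qed
    also have "(\<Sum>s<n. norm q ^ Suc s) \<le> norm q / (1 - norm q)"
    proof -
      have "(\<Sum>s<n. norm q ^ s) \<le> 1 / (1 - norm q)"
        using q sum_le_suminf[of "\<lambda>s. norm q ^ s" "{..<n}"] by (simp add: suminf_geometric summable_geometric)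
      then have "norm q * (\<Sum>s<n. norm q ^ s) \<le> norm q * (1 / (1 - norm q))"
        by (intro mult_left_mono) auto
      then show ?thesis by (simp add: sum_distrib_left)
    qed
    finally show ?thesis using q by (simp add: field_simps)
  qed
  ultimately show ?thesis by (intro LIMSEQ_le_const2) auto
qed

lemma qpoch_even_odd:
  fixes q :: "'a::{real_normed_field, banach}"
  assumes "norm q < 1"
  shows "qpoch q q = qpoch q (q\<^sup>2) * qpoch (q\<^sup>2) (q\<^sup>2)"
proof -
  have q2: "norm (q\<^sup>2) < 1" using assms by (simp add: norm_power power_less_one_iff abs_square_less_1)
  have "(\<Prod>i<2*N. 1 - q * q ^ i) = (\<Prod>i<N. 1 - q * (q\<^sup>2) ^ i) * (\<Prod>i<N. 1 - q\<^sup>2 * (q\<^sup>2) ^ i)" for N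
  proof (induction N)
    case (Suc N)
    have "q * q ^ Suc (2 * N) = q\<^sup>2 * (q\<^sup>2) ^ N" "q * q ^ (2 * N) = q * (q\<^sup>2) ^ N"
      by (simp_all add: mult_2 mult_2_right power_add power_mult_distrib power2_eq_square mult_ac)
    moreover have "2 * Suc N = Suc (Suc (2 * N))" by simp
    ultimately show ?case using Suc.IH by (simp only: prod.lessThan_Suc mult_ac)
  qed auto
  moreover have "(\<lambda>N. \<Prod>i<2*N. 1 - q * q ^ i) \<longlonglongrightarrow> qpoch q q"
    using LIMSEQ_subseq_LIMSEQ[OF qpoch_LIMSEQ[OF assms assms], of "\<lambda>N. 2 * N"]
    by (simp add: strict_mono_def o_def)
  moreover have "(\<lambda>N. (\<Prod>i<N. 1 - q * (q\<^sup>2) ^ i) * (\<Prod>i<N. 1 - q\<^sup>2 * (q\<^sup>2) ^ i)) \<longlonglongrightarrow> qpoch q (q\<^sup>2) * qpoch (q\<^sup>2) (q\<^sup>2)"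
    using assms q2 by (intro tendsto_mult qpoch_LIMSEQ)
  ultimately show ?thesis by (simp only:) (erule (1) LIMSEQ_unique)
qed

lemma qpoch_mult_minus:
  fixes a q :: "'a::{real_normed_field, banach}"
  assumes "norm a < 1" "norm q < 1"
  shows "qpoch a q * qpoch (-a) q = qpoch (a\<^sup>2) (q\<^sup>2)"
proof -
  have q2: "norm (q\<^sup>2) < 1" "norm (a\<^sup>2) < 1" 
    using assms by (simp_all add: norm_power power_less_one_iff abs_square_less_1)
  have "(\<Prod>i<N. 1 - a * q ^ i) * (\<Prod>i<N. 1 - (-a) * q ^ i) = (\<Prod>i<N. 1 - a\<^sup>2 * (q\<^sup>2) ^ i)" for N
    unfolding prod.distrib[symmetric]
    by (intro prod.cong) (simp_all add: power2_eq_square algebra_simps power_mult_distrib)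
  moreover have "(\<lambda>N. (\<Prod>i<N. 1 - a * q ^ i) * (\<Prod>i<N. 1 - (-a) * q ^ i)) \<longlonglongrightarrow> qpoch a q * qpoch (-a) q"
    using assms by (intro tendsto_mult qpoch_LIMSEQ) auto
  moreover have "(\<lambda>N. (\<Prod>i<N. 1 - a\<^sup>2 * (q\<^sup>2) ^ i)) \<longlonglongrightarrow> qpoch (a\<^sup>2) (q\<^sup>2)"
    using q2 by (intro qpoch_LIMSEQ)
  ultimately show ?thesis by (simp only:) (erule (1) LIMSEQ_unique)
qed

text \<open>Euler's identity of distinct and odd parts: (q; q)(-q; q) = (q^2; q^2), and (q; q)
  splits into (q; q^2)(q^2; q^2).\<close>

lemma inverse_qpoch_minus:
  fixes q :: "'a::{real_normed_field, banach}"
  assumes "norm q < 1"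
  shows "inverse (qpoch (-q) q) = qpoch q (q\<^sup>2)"
proof -
  have "qpoch q (q\<^sup>2) * (qpoch (q\<^sup>2) (q\<^sup>2) * qpoch (-q) q) = qpoch (q\<^sup>2) (q\<^sup>2)"
    using qpoch_even_odd[OF assms] qpoch_mult_minus[OF assms assms] by (simp add: mult_ac)
  moreover have "qpoch (q\<^sup>2) (q\<^sup>2) \<noteq> 0" "qpoch (-q) q \<noteq> 0"
    using assms by (intro qpoch_nonzero; simp add: norm_power abs_square_less_1)+
  ultimately show ?thesis by (simp add: field_simps)
qed

text \<open>The extremal value (-r; r^2) is rewritten through (b; b) at b = r, r^2, r^4, because
  products of this shape with real b are the ones to which the transformation law applies.\<close>

lemma norm_inverse_qpoch_minus_le:
  fixes q :: "'a::{real_normed_field, banach}"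
  assumes "norm q < 1"
  defines "r \<equiv> norm q"
  shows "norm (inverse (qpoch (-q) q)) \<le> (qpoch (r\<^sup>2) (r\<^sup>2))\<^sup>2 / (qpoch r r * qpoch (r^4) (r^4))"
proof -
  have r: "norm r < 1" "norm (r\<^sup>2) < 1" "norm (-r) < 1" "norm (r^4) < 1"
    and q2: "norm (q\<^sup>2) < 1"
    using assms by (auto simp: norm_power power_less_one_iff abs_square_less_1)
  have "norm (qpoch q (q\<^sup>2)) \<le> qpoch (-r) (r\<^sup>2)"
  proof (rule LIMSEQ_le)
    show "(\<lambda>N. norm (\<Prod>i<N. 1 - q * (q\<^sup>2) ^ i)) \<longlonglongrightarrow> norm (qpoch q (q\<^sup>2))"
      using assms q2 by (intro tendsto_norm qpoch_LIMSEQ) auto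
    show "(\<lambda>N. \<Prod>i<N. 1 - (-r) * (r\<^sup>2) ^ i) \<longlonglongrightarrow> qpoch (-r) (r\<^sup>2)"
      using r by (intro qpoch_LIMSEQ)
    have "norm (\<Prod>i<N. 1 - q * (q\<^sup>2) ^ i) \<le> (\<Prod>i<N. 1 - (-r) * (r\<^sup>2) ^ i)" for N
      unfolding prod_norm[symmetric]
    proof (rule prod_mono)
      fix i
      have "norm (1 - q * (q\<^sup>2) ^ i) \<le> 1 + norm (q * (q\<^sup>2) ^ i)" 
        by (rule order.trans[OF norm_triangle_ineq4]) simp
      then show "0 \<le> norm (1 - q * (q\<^sup>2) ^ i) \<and> norm (1 - q * (q\<^sup>2) ^ i) \<le> 1 - (-r) * (r\<^sup>2) ^ i"
        by (simp add: r_def norm_mult norm_power)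
    qed
    then show "\<exists>N. \<forall>n\<ge>N. norm (\<Prod>i<n. 1 - q * (q\<^sup>2) ^ i) \<le> (\<Prod>i<n. 1 - (-r) * (r\<^sup>2) ^ i)" by blast
  qed
  also have "qpoch (-r) (r\<^sup>2) = (qpoch (r\<^sup>2) (r\<^sup>2))\<^sup>2 / (qpoch r r * qpoch (r^4) (r^4))"
  proof -
    have e1: "qpoch r (r\<^sup>2) * qpoch (-r) (r\<^sup>2) = qpoch (r\<^sup>2) (r^4)"
      using qpoch_mult_minus[of r "r\<^sup>2"] r by simp
    have e2: "qpoch r r = qpoch r (r\<^sup>2) * qpoch (r\<^sup>2) (r\<^sup>2)" using qpoch_even_odd r by blast
    have e3: "qpoch (r\<^sup>2) (r\<^sup>2) = qpoch (r\<^sup>2) (r^4) * qpoch (r^4) (r^4)" 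
      using qpoch_even_odd[of "r\<^sup>2"] r by simp
    have nz: "qpoch r (r\<^sup>2) \<noteq> 0" "qpoch (r^4) (r^4) \<noteq> 0" "qpoch (r\<^sup>2) (r\<^sup>2) \<noteq> 0"
      using r by (intro qpoch_nonzero; simp)+
    have "qpoch r r * qpoch (r^4) (r^4) * qpoch (-r) (r\<^sup>2) = 
            (qpoch r (r\<^sup>2) * qpoch (-r) (r\<^sup>2)) * qpoch (r^4) (r^4) * qpoch (r\<^sup>2) (r\<^sup>2)"
      unfolding e2 by (simp add: mult_ac)
    also have "\<dots> = (qpoch (r\<^sup>2) (r\<^sup>2))\<^sup>2" unfolding e1 using e3 by (simp add: power2_eq_square)
    finally show ?thesis using nz e2 by (simp add: field_simps)
  qed
  finally show ?thesis using inverse_qpoch_minus[OF assms(1)] by simp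
qed

section \<open>Partitions and the crank\<close>

lemma prod_mset_powers:
  fixes q :: "'a::comm_semiring_1"
  shows "(\<Prod>x\<in>#l. q ^ x) = q ^ \<Sum>\<^sub># l"
  by (induction l) (auto simp: power_add)

lemma prod_mset_zero:
  fixes w :: "'b \<Rightarrow> 'a::comm_semiring_1"
  assumes "x \<in># l" "w x = 0"
  shows "(\<Prod>x\<in>#l. w x) = 0"
  using assms by (metis image_mset_add_mset insert_DiffM mult_zero_left prod_mset.add_mset)

lemma has_sum_multisets_on:
  fixes w :: "nat \<Rightarrow> 'a::{real_normed_field, banach}"
  assumes "\<And>i. norm (w i) < 1" "summable (\<lambda>i. norm (w i))"
    and "\<And>i. i \<notin> A \<Longrightarrow> w i = 0"
  shows "((\<lambda>l. \<Prod>x\<in>#l. w x) has_sum inverse (\<Prod>i. 1 - w i)) {l. set_mset l \<subseteq> A}"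
proof -
  have "(\<Prod>x\<in>#l. w x) = 0" if l: "l \<notin> {l. set_mset l \<subseteq> A}" for l
  proof -
    obtain x where "x \<in># l" "x \<notin> A" using l unfolding mem_Collect_eq subset_iff by blast
    then show ?thesis using assms(3) prod_mset_zero by metis
  qed
  then show ?thesis
    using has_sum_multisets(2)[OF assms(1,2)]
    by (subst has_sum_cong_neutral[where T = UNIV]) auto
qed

lemma prod_mset_cong:
  assumes "\<And>x. x \<in># l \<Longrightarrow> f x = g x"
  shows "(\<Prod>x\<in>#l. f x) = (\<Prod>x\<in>#l. g x)"
  using assms by (metis image_mset_cong)

lemma summable_norm_power:
  fixes q :: "'a::real_normed_field"
  assumes "norm q < 1"
  shows "summable (\<lambda>i. norm (q ^ i))"
  using assms by (simp add: norm_power summable_geometric)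

lemma qpoch_self: "qpoch q q = (\<Prod>i. 1 - q ^ Suc i)"
  by (simp add: qpoch_def)

lemma
  fixes q :: "'a::{real_normed_field, banach}"
  assumes q: "norm q < 1"
  shows has_sum_partitions: "((\<lambda>l. q ^ \<Sum>\<^sub># l) has_sum inverse (qpoch q q)) {l. 0 \<notin># l}"
    and abs_summable_partitions: "(\<lambda>l. norm (q ^ \<Sum>\<^sub># l)) summable_on {l. 0 \<notin># l}"
proof -
  define w where "w i = (if i = 0 then 0 else q ^ i)" for i :: nat
  have w: "norm (w i) < 1" for i using q by (simp add: w_def norm_power power_less_one_iff)
  have sm: "summable (\<lambda>i. norm (w i))"
    by (rule summable_comparison_test'[OF summable_norm_power[OF q], of 0]) (simp add: w_def)
  have eq: "(\<Prod>x\<in>#l. w x) = q ^ \<Sum>\<^sub># l" if "l \<in> {l. set_mset l \<subseteq> -{0}}" for l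
    unfolding prod_mset_powers[symmetric] using that
    by (intro prod_mset_cong) (auto simp: w_def, metis gr0I)
  have set: "{l. set_mset l \<subseteq> -{0}} = {l::nat multiset. 0 \<notin># l}" by auto
  have "(\<Prod>i. 1 - w i) = qpoch q q"
  proof -
    have "(\<Prod>i. 1 - w (Suc i)) = (\<Prod>i. 1 - w i) / (1 - w 0)"
      using convergent_prod_one_minus[OF w sm] by (intro prodinf_split_head) (auto simp: w_def)
    then show ?thesis by (simp add: w_def qpoch_self)
  qed
  moreover have "((\<lambda>l. \<Prod>x\<in>#l. w x) has_sum inverse (\<Prod>i. 1 - w i)) {l. set_mset l \<subseteq> -{0}}"
    by (rule has_sum_multisets_on[OF w sm]) (auto simp: w_def)
  ultimately show "((\<lambda>l. q ^ \<Sum>\<^sub># l) has_sum inverse (qpoch q q)) {l. 0 \<notin># l}"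
    using has_sum_cong[of "{l. set_mset l \<subseteq> -{0}}" "\<lambda>l. \<Prod>x\<in>#l. w x", OF eq] unfolding set by simp
  have "(\<lambda>l. norm (\<Prod>x\<in>#l. w x)) summable_on {l. set_mset l \<subseteq> -{0}}"
    using has_sum_multisets(1)[OF w sm] by (rule summable_on_subset_banach) auto
  then show "(\<lambda>l. norm (q ^ \<Sum>\<^sub># l)) summable_on {l. 0 \<notin># l}"
    using summable_on_cong[of "{l. set_mset l \<subseteq> -{0}}" "\<lambda>l. norm (\<Prod>x\<in>#l. w x)"] eq 
    unfolding set by (smt (verit, best))
qed

definition npart :: "nat \<Rightarrow> nat" where
  "npart n = card (partitions_of n)"

theorem npart_sums:
  fixes q :: "'a::{real_normed_field, banach}"
  assumes q: "norm q < 1"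
  shows "(\<lambda>n. of_nat (npart n) * q ^ n) sums inverse (qpoch q q)"
  using sums_partitions_of[of "\<lambda>_. 1" q] has_sum_partitions[OF q]
  by (simp add: npart_def)

section \<open>Generating function of the crank parity\<close>

definition crank_sign :: "nat multiset \<Rightarrow> complex" where
  "crank_sign l = (if even (crank l) then 1 else -1)"

definition crank_diff :: "nat \<Rightarrow> complex" where
  "crank_diff n = (\<Sum>l\<in>partitions_of n. crank_sign l)"

lemma crank_sign_no_ones:
  assumes "1 \<notin># l"
  shows "crank_sign l = (-1) ^ Max (insert 0 (set_mset l))"
  using assms by (simp add: crank_sign_def crank_def num_ones_def not_in_iff minus_one_power_iff)

text \<open>Modulo 2, \<nu> - \<omega> agrees with \<nu> + \<omega>. Hence the sign is
  multiplicative over the parts once the number j of ones is fixed: each 1 and each part above j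
  contributes -1.\<close>

lemma crank_sign_ones:
  assumes "1 \<notin># l" "j > 0"
  shows "crank_sign (replicate_mset j 1 + l) = (-1) ^ j * (-1) ^ size {#i \<in># l. j < i#}"
proof -
  have c: "num_ones (replicate_mset j 1 + l) = j"
    using assms by (simp add: num_ones_def not_in_iff)
  have "filter_mset (\<lambda>i. j < i) (replicate_mset j 1) = {#}"
    using assms by (simp add: filter_mset_eq_conv)
  then have "num_gt_ones (replicate_mset j 1 + l) = size {#i \<in># l. j < i#}"
    unfolding num_gt_ones_def c by simp
  then show ?thesis
    using assms by (simp add: crank_sign_def crank_def c minus_one_power_iff del: One_nat_def)
qed

lemma qpoch_split:
  fixes a q :: "'a::{real_normed_field, banach}"
  assumes "norm a < 1" "norm q < 1"
  shows "qpoch a q = (\<Prod>i<n. 1 - a * q ^ i) * qpoch (a * q ^ n) q"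
proof -
  have "summable (\<lambda>i. norm (a * q ^ i))"
    using assms(2) by (simp add: norm_mult norm_power summable_mult summable_geometric)
  then have "convergent_prod (\<lambda>i. 1 - a * q ^ i)"
    using assms by (intro convergent_prod_one_minus norm_mult_power_less_1) auto
  then have "qpoch a q = (\<Prod>i<n. 1 - a * q ^ i) * (\<Prod>i. 1 - a * q ^ (i + n))"
    unfolding qpoch_def using one_minus_mult_power_nonzero[OF assms]
    by (subst mult.commute) (intro prodinf_split_initial_segment; simp)
  then show ?thesis by (simp add: qpoch_def power_add mult_ac)
qed

text \<open>For fixed j the parts 2, ..., j have weight q^i and the larger ones -q^i, so the sum is
  an Euler product with denominators 1 - q^i up to j and 1 + q^i beyond. Completing the latter to
  (-q; q) leaves the j-th term of the q-binomial series with a = x = -q.\<close>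

lemma has_sum_fixed_ones:
  fixes q :: complex
  assumes q: "norm q < 1" and j: "j > 0"
  shows "((\<lambda>l. crank_sign (replicate_mset j 1 + l) * q ^ \<Sum>\<^sub># (replicate_mset j 1 + l)) has_sum
           ((1 - q) / qpoch (-q) q * ((\<Prod>i<j. (1 - (-q) * q ^ i) / (1 - q ^ Suc i)) * (-q) ^ j)))
           {l. set_mset l \<subseteq> {2..}}"
proof -
  define w where "w i = (if i < 2 then 0 else if j < i then - (q ^ i) else q ^ i)" for i
  have w: "norm (w i) < 1" for i using q by (simp add: w_def norm_power power_less_one_iff)
  have sm: "summable (\<lambda>i. norm (w i))"
    by (rule summable_comparison_test'[OF summable_norm_power[OF q], of 0]) (simp add: w_def)
  have q': "norm (-q) < 1" using q by simp
  have hs: "((\<lambda>l. \<Prod>x\<in>#l. w x) has_sum inverse (\<Prod>i. 1 - w i)) {l. set_mset l \<subseteq> {2..}}"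
    by (rule has_sum_multisets_on[OF w sm]) (auto simp: w_def)
  have prod_w: "(\<Prod>x\<in>#l. w x) = (-1) ^ size {#i \<in># l. j < i#} * q ^ \<Sum>\<^sub># l" if "set_mset l \<subseteq> {2..}" for l
    using that by (induction l) (auto simp: w_def power_add)
  have eq: "crank_sign (replicate_mset j 1 + l) * q ^ \<Sum>\<^sub># (replicate_mset j 1 + l) = (-q) ^ j * (\<Prod>x\<in>#l. w x)"
    if "l \<in> {l. set_mset l \<subseteq> {2..}}" for l
  proof -
    have "1 \<notin># l" using that by auto
    then show ?thesis using that j
      by (simp add: crank_sign_ones prod_w power_add power_minus[of q] del: One_nat_def)
  qed
  have "(\<Prod>i. 1 - w i) = (\<Prod>i<Suc j. 1 - w i) * (\<Prod>i. 1 - w (i + Suc j))"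
    using convergent_prod_one_minus[OF w sm] w
    by (subst mult.commute) (intro prodinf_split_initial_segment, auto, metis less_irrefl norm_one)
  also have "(\<Prod>i. 1 - w (i + Suc j)) = qpoch (-q * q ^ j) q"
    using j unfolding qpoch_def by (intro prodinf_cong) (simp add: w_def power_add mult_ac)
  also have "(\<Prod>i<Suc j. 1 - w i) = (\<Prod>i<j. 1 - w (Suc i))"
    unfolding prod.lessThan_Suc_shift by (simp add: w_def)
  finally have P: "(\<Prod>i. 1 - w i) = (\<Prod>i<j. 1 - w (Suc i)) * qpoch (-q * q ^ j) q" .
  \<comment> \<open>The part 1 has weight 0 here; the factor 1 - q fills its place in the
    product.\<close>
  have "(1 - q) * (\<Prod>i<j. 1 - w (Suc i)) = (\<Prod>i<j. 1 - q ^ Suc i)"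
  proof -
    obtain k where k: "j = Suc k" using j by (cases j) auto
    have "(\<Prod>i<k. 1 - w (Suc (Suc i))) = (\<Prod>i<k. 1 - q ^ Suc (Suc i))"
      by (intro prod.cong) (auto simp: w_def k)
    then show ?thesis unfolding k prod.lessThan_Suc_shift by (simp add: w_def)
  qed
  moreover have "qpoch (-q) q = (\<Prod>i<j. 1 - (-q) * q ^ i) * qpoch (-q * q ^ j) q"
    by (rule qpoch_split) (use q in auto)
  moreover have "(1 - q) * (X * Y) * Z = (Z * Y) * ((1 - q) * X)" for X Y Z by (simp only: mult_ac)
  ultimately have main: "(1 - q) * (\<Prod>i. 1 - w i) * (\<Prod>i<j. 1 - (-q) * q ^ i) = qpoch (-q) q * (\<Prod>i<j. 1 - q ^ Suc i)"
    unfolding P by (simp only:)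
  have nz: "qpoch (-q) q \<noteq> 0" "1 - q \<noteq> 0" "(\<Prod>i. 1 - w i) \<noteq> 0" "(\<Prod>i<j. 1 - q ^ Suc i) \<noteq> 0"
    using qpoch_nonzero[OF q' q] q convergent_prod_one_minus(2)[OF w sm] one_minus_power_nonzero[OF q]
    by auto
  have "inverse (\<Prod>i. 1 - w i) = (1 - q) / qpoch (-q) q * (\<Prod>i<j. (1 - (-q) * q ^ i) / (1 - q ^ Suc i))"
    unfolding prod_dividef using nz main by (simp add: field_simps del: power_Suc)
  moreover have "((\<lambda>l. crank_sign (replicate_mset j 1 + l) * q ^ \<Sum>\<^sub># (replicate_mset j 1 + l)) has_sum
      ((-q) ^ j * inverse (\<Prod>i. 1 - w i))) {l. set_mset l \<subseteq> {2..}}"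
    using has_sum_cmult_right[OF hs, of "(-q) ^ j"] by (subst has_sum_cong[OF eq])
  ultimately show ?thesis by (simp add: mult_ac)
qed

lemma bij_betw_add_Max:
  "bij_betw (\<lambda>(k, l). add_mset k l) (SIGMA k:{2::nat..}. {l. set_mset l \<subseteq> {2..k}}) ({l. set_mset l \<subseteq> {2..}} - {{#}})"
proof (rule bij_betwI[where g = "\<lambda>l. (Max (set_mset l), l - {#Max (set_mset l)#})"], goal_cases)
  case 1
  then show ?case by fastforce
next
  case 2
  show ?case
  proof
    fix l assume l: "l \<in> {l. set_mset l \<subseteq> {2::nat..}} - {{#}}"
    then have M: "Max (set_mset l) \<in># l" by auto
    then have "Max (set_mset l) \<in> {2..}" using l by blast
    moreover have "x \<le> Max (set_mset l)" if "x \<in># l - {#Max (set_mset l)#}" for x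
      using that by (auto dest: in_diffD)
    moreover have "x \<in># l" if "x \<in># l - {#Max (set_mset l)#}" for x
      using that by (auto dest: in_diffD)
    ultimately show "(Max (set_mset l), l - {#Max (set_mset l)#}) \<in> (SIGMA k:{2::nat..}. {l. set_mset l \<subseteq> {2..k}})"
      using l by (auto simp: subset_iff)
  qed
next
  case (3 x)
  then obtain k l where x: "x = (k, l)" "set_mset l \<subseteq> {2..k}" by auto
  then have "Max (insert k (set_mset l)) = k" by (intro Max_eqI) auto
  then show ?case using x by simp
next
  case (4 l)
  then have "Max (set_mset l) \<in># l" by auto
  then show ?case by simp
qed

lemma qpoch_zero [simp]: "qpoch 0 q = 1"
  by (simp add: qpoch_def)

text \<open>Without ones the crank is the largest part k. Sorting by k gives 1 - q times the terms k
  \<ge> 2 of the q-binomial series with a = 0, x = -q. Dropping the terms k = 0, 1 changes the sum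
  by -1 + 2 q, and the empty partition restores the 1.\<close>

lemma has_sum_no_ones:
  fixes q :: complex
  assumes q: "norm q < 1"
    and sm: "(\<lambda>l. crank_sign l * q ^ \<Sum>\<^sub># l) summable_on {l. set_mset l \<subseteq> {2..}}"
  shows "((\<lambda>l. crank_sign l * q ^ \<Sum>\<^sub># l) has_sum ((1 - q) / qpoch (-q) q + 2 * q)) {l. set_mset l \<subseteq> {2..}}"
proof -
  let ?f = "\<lambda>l. crank_sign l * q ^ \<Sum>\<^sub># l"
  let ?B = "{l. set_mset l \<subseteq> {2::nat..}}"
  define b where "b k = (\<Prod>i<k. 1 / (1 - q ^ Suc i)) * (-q) ^ k" for k
  have inner: "((\<lambda>l. ?f (add_mset k l)) has_sum ((1 - q) * b k)) {l. set_mset l \<subseteq> {2..k}}" if k: "k \<ge> 2" for k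
  proof -
    define w where "w i = (if i \<in> {2..k} then q ^ i else 0)" for i
    have w: "norm (w i) < 1" for i using q by (simp add: w_def norm_power power_less_one_iff)
    have sm: "summable (\<lambda>i. norm (w i))"
      by (rule summable_comparison_test'[OF summable_norm_power[OF q], of 0]) (simp add: w_def)
    have hs: "((\<lambda>l. \<Prod>x\<in>#l. w x) has_sum inverse (\<Prod>i. 1 - w i)) {l. set_mset l \<subseteq> {2..k}}"
      by (rule has_sum_multisets_on[OF w sm]) (auto simp: w_def)
    have eq: "?f (add_mset k l) = (-q) ^ k * (\<Prod>x\<in>#l. w x)" if l: "l \<in> {l. set_mset l \<subseteq> {2..k}}" for l
    proof -
      have "Max (insert 0 (set_mset (add_mset k l))) = k"
        using l by (intro Max_eqI) auto
      moreover have "1 \<notin># add_mset k l" using l k by auto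
      moreover have "(\<Prod>x\<in>#l. w x) = q ^ \<Sum>\<^sub># l"
        unfolding prod_mset_powers[symmetric] using l by (intro prod_mset_cong) (auto simp: w_def)
      ultimately show ?thesis by (simp add: crank_sign_no_ones power_add power_minus[of q])
    qed
    have "(\<Prod>i. 1 - w i) = (\<Prod>i<Suc k. 1 - w i) * (\<Prod>i. 1 - w (i + Suc k))"
      using convergent_prod_one_minus[OF w sm] w
      by (subst mult.commute) (intro prodinf_split_initial_segment, auto, metis less_irrefl norm_one)
    also have "(\<Prod>i. 1 - w (i + Suc k)) = 1" by (simp add: w_def)
    also have "(\<Prod>i<Suc k. 1 - w i) = (\<Prod>i<k. 1 - w (Suc i))"
      unfolding prod.lessThan_Suc_shift by (simp add: w_def)
    finally have P: "(\<Prod>i. 1 - w i) = (\<Prod>i<k. 1 - w (Suc i))" by simp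
    have main: "(1 - q) * (\<Prod>i. 1 - w i) = (\<Prod>i<k. 1 - q ^ Suc i)"
    proof -
      obtain m where m: "k = Suc m" using k by (cases k) auto
      have "(\<Prod>i<m. 1 - w (Suc (Suc i))) = (\<Prod>i<m. 1 - q ^ Suc (Suc i))"
        by (intro prod.cong) (auto simp: w_def m)
      then show ?thesis unfolding P m prod.lessThan_Suc_shift by (simp add: w_def)
    qed
    have nz: "1 - q \<noteq> 0" "(\<Prod>i. 1 - w i) \<noteq> 0" "(\<Prod>i<k. 1 - q ^ Suc i) \<noteq> 0"
      using q convergent_prod_one_minus(2)[OF w sm] one_minus_power_nonzero[OF q] by auto
    have "inverse (\<Prod>i. 1 - w i) = (1 - q) * (\<Prod>i<k. 1 / (1 - q ^ Suc i))"
      unfolding prod_dividef using nz main by (simp add: field_simps del: power_Suc)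
    moreover have "((\<lambda>l. ?f (add_mset k l)) has_sum ((-q) ^ k * inverse (\<Prod>i. 1 - w i))) {l. set_mset l \<subseteq> {2..k}}"
      using has_sum_cmult_right[OF hs, of "(-q) ^ k"] by (subst has_sum_cong[OF eq])
    ultimately show ?thesis by (simp add: mult_ac b_def)
  qed
  have "?f summable_on (?B - {{#}})" using sm by (rule summable_on_subset_banach) auto
  then obtain S where S: "(?f has_sum S) (?B - {{#}})" using has_sum_infsum by metis
  have "((\<lambda>z. ?f (case z of (k, l) \<Rightarrow> add_mset k l)) has_sum S) (SIGMA k:{2::nat..}. {l. set_mset l \<subseteq> {2..k}})"
    using has_sum_reindex_bij_betw[OF bij_betw_add_Max, of ?f] S by simp
  then have "((\<lambda>k. (1 - q) * b k) has_sum S) {2..}"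
    by (rule has_sum_SigmaD) (use inner in auto)
  then have "((\<lambda>k. (1 - q) * b (k + 2)) has_sum S) UNIV"
    by (subst has_sum_reindex_bij_witness[where i = "\<lambda>k. k - 2" and j = "\<lambda>k. k + 2" and T = "{2..}"]) auto
  then have 1: "(\<lambda>k. (1 - q) * b (k + 2)) sums S" by (rule has_sum_imp_sums)
  have "b sums (1 / qpoch (-q) q)"
    using q_binomial[of 0 q "-q"] q by (simp add: b_def[abs_def])
  then have "(\<lambda>k. b (k + 2)) sums (1 / qpoch (-q) q - (\<Sum>k<2. b k))"
    by (rule sums_split_initial_segment)
  then have 2: "(\<lambda>k. (1 - q) * b (k + 2)) sums ((1 - q) * (1 / qpoch (-q) q - (\<Sum>k<2. b k)))"
    by (rule sums_mult)
  have q1: "1 - q \<noteq> 0" using q by auto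
  have "(\<Sum>k<2. b k) = 1 - q / (1 - q)"
    by (simp add: b_def numeral_2_eq_2)
  moreover have "(1 - q) * (c - (1 - q / (1 - q))) = (1 - q) * c - 1 + 2 * q" for c
    using q1 by (simp add: field_simps)
  ultimately have "S = (1 - q) / qpoch (-q) q - 1 + 2 * q"
    using sums_unique2[OF 1 2] by simp
  moreover have "?f {#} = 1" by (simp add: crank_sign_no_ones)
  ultimately have "(?f has_sum ((1 - q) / qpoch (-q) q + 2 * q)) (insert {#} (?B - {{#}}))"
    using has_sum_insert[OF _ S, of "{#}"] by (simp add: algebra_simps)
  then show ?thesis by (simp add: insert_absorb)
qed

text \<open>The term \<open>2 q\<close> comes from the partition \<open>{#1#}\<close>, whose crank is \<open>-1\<close> whereas the product
  \<open>(q; q)\<^sub>\<infinity> / ((z q; q)\<^sub>\<infinity> (q / z; q)\<^sub>\<infinity>)\<close> has the coefficient \<open>z + 1 / z - 1\<close> at \<open>q\<close>.\<close>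

theorem crank_diff_sums:
  fixes q :: complex
  assumes q: "norm q < 1"
  shows "(\<lambda>n. crank_diff n * q ^ n) sums (qpoch q q / (qpoch (-q) q)\<^sup>2 + 2 * q)"
proof -
  let ?f = "\<lambda>l. crank_sign l * q ^ \<Sum>\<^sub># l"
  let ?B = "{l. set_mset l \<subseteq> {2::nat..}}"
  define c where "c j = (\<Prod>i<j. (1 - (-q) * q ^ i) / (1 - q ^ Suc i)) * (-q) ^ j" for j
  have f: "?f summable_on {l. 0 \<notin># l}"
  proof (rule abs_summable_summable)
    have "norm (?f l) = norm (q ^ \<Sum>\<^sub># l)" for l by (simp add: crank_sign_def norm_mult)
    then show "(\<lambda>l. norm (?f l)) summable_on {l. 0 \<notin># l}"
      using abs_summable_partitions[OF q] by simp
  qed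
  then obtain S where S: "(?f has_sum S) {l. 0 \<notin># l}" using has_sum_infsum by metis
  have "?f summable_on ?B" using f by (rule summable_on_subset_banach) auto
  note no_ones = has_sum_no_ones[OF q this]
  have "insert 1 {2..} = -{0::nat}" by auto
  then have bij: "bij_betw (\<lambda>(k, l). replicate_mset k 1 + l) (UNIV \<times> ?B) {l. 0 \<notin># l}"
    using bij_betw_replicate_mset_plus[of 1 "{2::nat..}"] by (simp add: subset_Compl_singleton)
  have "((\<lambda>z. ?f (case z of (k, l) \<Rightarrow> replicate_mset k 1 + l)) has_sum S) (UNIV \<times> ?B)"
    using has_sum_reindex_bij_betw[OF bij, of ?f] S by simp
  \<comment> \<open>The partitions without ones give the q-binomial term j = 0 up to 2 q, so a
    single series over all j covers both cases of the crank.\<close>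
  then have "((\<lambda>j. (1 - q) / qpoch (-q) q * c j + (if j = 0 then 2 * q else 0)) has_sum S) UNIV"
  proof (rule has_sum_SigmaD)
    fix j :: nat
    show "((\<lambda>y. ?f (case (j, y) of (k, l) \<Rightarrow> replicate_mset k 1 + l)) has_sum
            ((1 - q) / qpoch (-q) q * c j + (if j = 0 then 2 * q else 0))) ?B"
    proof (cases "j = 0")
      case True
      then show ?thesis using no_ones by (simp add: c_def)
    next
      case False
      then show ?thesis using has_sum_fixed_ones[OF q, of j] by (simp add: c_def)
    qed
  qed
  then have 1: "(\<lambda>j. (1 - q) / qpoch (-q) q * c j + (if j = 0 then 2 * q else 0)) sums S"
    by (rule has_sum_imp_sums)
  have "c sums (qpoch (q\<^sup>2) q / qpoch (-q) q)"
    using q_binomial[of "-q" q "-q"] q by (simp add: c_def[abs_def] power2_eq_square)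
  moreover have "(\<lambda>j::nat. if j = 0 then 2 * q else 0) sums (2 * q)"
    using sums_single[of 0 "\<lambda>_. 2 * q"] by simp
  ultimately have 2: "(\<lambda>j. (1 - q) / qpoch (-q) q * c j + (if j = 0 then 2 * q else 0)) sums
       ((1 - q) / qpoch (-q) q * (qpoch (q\<^sup>2) q / qpoch (-q) q) + 2 * q)"
    by (intro sums_add sums_mult)
  have "qpoch q q = (1 - q) * qpoch (q\<^sup>2) q"
    using qpoch_split[OF q q, of 1] by (simp add: power2_eq_square)
  then have "S = qpoch q q / (qpoch (-q) q)\<^sup>2 + 2 * q"
    using sums_unique2[OF 1 2] by (simp add: power2_eq_square)
  then show ?thesis
    unfolding crank_diff_def using sums_partitions_of[OF S] by simp
qed

lemma crank_parity_count_eq: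
  "complex_of_nat (crank_parity_count 0 n) = (of_nat (npart n) + crank_diff n) / 2"
  "complex_of_nat (crank_parity_count 1 n) = (of_nat (npart n) - crank_diff n) / 2"
proof -
  note fin = finite_partitions_of[of n]
  have "crank_sign l = 2 * of_bool (crank l mod 2 = int 0) - 1" 
       "crank_sign l = 1 - 2 * of_bool (crank l mod 2 = int 1)" for l
    by (auto simp: crank_sign_def even_iff_mod_2_eq_zero odd_iff_mod_2_eq_one)
  then have 1: "crank_diff n = (\<Sum>l\<in>partitions_of n. 2 * of_bool (crank l mod 2 = int 0) - 1)"
    and 2: "crank_diff n = (\<Sum>l\<in>partitions_of n. 1 - 2 * of_bool (crank l mod 2 = int 1))"
    unfolding crank_diff_def by (meson sum.cong)+
  have s: "(\<Sum>l\<in>partitions_of n. of_bool (crank l mod 2 = int k)) = complex_of_nat (crank_parity_count k n)" for k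
    using fin by (simp add: crank_parity_count_def Int_def)
  show "complex_of_nat (crank_parity_count 0 n) = (of_nat (npart n) + crank_diff n) / 2"
    unfolding 1 s[symmetric] by (simp add: sum_subtractf sum_distrib_left[symmetric] npart_def)
  show "complex_of_nat (crank_parity_count 1 n) = (of_nat (npart n) - crank_diff n) / 2"
    unfolding 2 s[symmetric] by (simp add: sum_subtractf sum_distrib_left[symmetric] npart_def)
qed

section \<open>The transformation law of the partition generating function\<close>

text \<open>This is the logarithm of P(exp (-s)) as a Lambert series: expand every -ln (1 - exp (-n
  s)) in powers and sum over n first.\<close>

definition etaF :: "real \<Rightarrow> real" where
  "etaF s = (\<Sum>m. 1 / (real (Suc m) * (exp (real (Suc m) * s) - 1)))"

lemma exp_neg_power:
  fixes s :: real
  shows "exp (-s) ^ k = inverse (exp (real k * s))"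
  using exp_of_nat_mult[of k "-s"] exp_minus[of "real k * s"] by simp

lemma etaF_bound_aux:
  assumes "s > 0"
  shows "1 / (real (Suc m) * (exp (real (Suc m) * s) - 1)) \<le> exp (-s) ^ Suc m / (1 - exp (-s))"
proof -
  define r where "r = exp (-s)"
  have r: "0 < r" "r < 1" using assms by (auto simp: r_def)
  have rm: "r ^ Suc m \<le> r" "0 < r ^ Suc m" "r ^ Suc m < 1"
    using r power_decreasing[of 1 "Suc m" r] by (auto simp: power_less_one_iff simp del: power_Suc)
  have R: "1 / (1 * (1 / R - 1)) = R / (1 - R)" if "0 < R" "R < 1" for R :: real
    using that by (simp add: field_simps)
  have e: "exp (real (Suc m) * s) = 1 / r ^ Suc m"
    by (simp only: r_def exp_neg_power) (simp add: inverse_eq_divide)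
  have "1 / (real (Suc m) * (exp (real (Suc m) * s) - 1)) \<le> 1 / (1 * (exp (real (Suc m) * s) - 1))"
    using assms by (intro divide_left_mono mult_right_mono mult_pos_pos) auto
  also have "\<dots> = r ^ Suc m / (1 - r ^ Suc m)" unfolding e by (rule R) (fact rm)+
  also have "\<dots> \<le> r ^ Suc m / (1 - r)" using r rm by (intro divide_left_mono mult_pos_pos) auto
  finally show ?thesis by (simp add: r_def)
qed

lemma etaF_pos_terms:
  assumes "s > 0"
  shows "1 / (real (Suc m) * (exp (real (Suc m) * s) - 1)) \<ge> 0"
  using assms by simp

lemma geometric_Suc_sums:
  fixes r :: real
  assumes "0 \<le> r" "r < 1"
  shows "(\<lambda>m. r ^ Suc m) sums (r / (1 - r))"
  using sums_mult[OF geometric_sums[of r], of r] assms by simp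

lemma summable_etaF:
  assumes "s > 0"
  shows "summable (\<lambda>m. 1 / (real (Suc m) * (exp (real (Suc m) * s) - 1)))"
proof (rule summable_comparison_test'[where N = 0])
  show "summable (\<lambda>m. exp (-s) ^ Suc m / (1 - exp (-s)))"
    using geometric_Suc_sums[of "exp (-s)"] assms by (intro summable_divide) (auto simp: sums_iff)
  show "norm (1 / (real (Suc m) * (exp (real (Suc m) * s) - 1))) \<le> exp (-s) ^ Suc m / (1 - exp (-s))" for m
    using etaF_bound_aux[OF assms, of m] etaF_pos_terms[OF assms, of m] by simp
qed

lemma etaF_le:
  assumes "s > 0"
  shows "etaF s \<le> exp (-s) / (1 - exp (-s))\<^sup>2"
proof -
  have g: "(\<lambda>m. exp (-s) ^ Suc m / (1 - exp (-s))) sums (exp (-s) / (1 - exp (-s)) / (1 - exp (-s)))"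
    using assms by (intro sums_divide geometric_Suc_sums) auto
  show ?thesis
    unfolding etaF_def using suminf_le[OF etaF_bound_aux[OF assms] summable_etaF[OF assms] sums_summable[OF g]]
    sums_unique[OF g] by (simp add: power2_eq_square)
qed

lemma etaF_nonneg: "s > 0 \<Longrightarrow> etaF s \<ge> 0"
  unfolding etaF_def by (intro suminf_nonneg summable_etaF etaF_pos_terms)

text \<open>Termwise from exp y - 1 \<ge> y, followed by the sum of the inverse squares. In the
  crank estimate it is used at arguments of order 1/t', where a bound of order t' is enough and no
  exponential smallness is required.\<close>

lemma etaF_le_inverse:
  assumes "s > 0"
  shows "etaF s \<le> pi\<^sup>2 / (6 * s)"
proof -
  have g: "(\<lambda>m. 1 / s * (1 / real (Suc m) ^ 2)) sums (1 / s * (pi\<^sup>2 / 6))"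
    using inverse_squares_sums by (intro sums_mult) (simp add: add.commute)
  have "1 / (real (Suc m) * (exp (real (Suc m) * s) - 1)) \<le> 1 / s * (1 / real (Suc m) ^ 2)" for m
  proof -
    have "real (Suc m) * s \<le> exp (real (Suc m) * s) - 1"
      using exp_ge_add_one_self[of "real (Suc m) * s"] by linarith
    then have "real (Suc m) * (real (Suc m) * s) \<le> real (Suc m) * (exp (real (Suc m) * s) - 1)"
      by (intro mult_left_mono) auto
    then have "1 / (real (Suc m) * (exp (real (Suc m) * s) - 1)) \<le> 1 / (real (Suc m) * (real (Suc m) * s))"
      using assms by (intro divide_left_mono mult_pos_pos) auto
    then show ?thesis by (simp add: power2_eq_square mult_ac)
  qed
  from suminf_le[OF this summable_etaF[OF assms] sums_summable[OF g]] sums_unique[OF g]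
  show ?thesis unfolding etaF_def by (simp add: mult_ac)
qed

lemma minus_ln_one_minus_sums:
  fixes y :: real
  assumes "0 < y" "y < 1"
  shows "(\<lambda>n. y ^ Suc n / real (Suc n)) sums (- ln (1 - y))"
proof -
  have "summable (\<lambda>n. y ^ Suc n / real (Suc n))"
  proof (rule summable_comparison_test'[where N = 0])
    show "summable (\<lambda>n. y ^ Suc n)" using geometric_Suc_sums[of y] assms by (auto simp: sums_iff)
    show "norm (y ^ Suc n / real (Suc n)) \<le> y ^ Suc n" for n
      using assms by (simp add: divide_le_eq mult_left_le)
  qed
  moreover have "ln (1 - y) = (\<Sum>n. - (y ^ Suc n / real (Suc n)))"
  proof -
    have "(-1) ^ n * (1 / real (n + 1)) * ((1 - y) - 1) ^ Suc n = - (y ^ Suc n / real (Suc n))" for n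
      by (cases "even n") simp_all
    then show ?thesis using ln_series[of "1 - y"] assms by (simp only:)
  qed
  ultimately show ?thesis by (simp add: sums_iff suminf_minus)
qed

lemma inverse_qpoch_exp:
  fixes s :: real
  assumes "s > 0"
  shows "inverse (qpoch (exp (-s)) (exp (-s))) = exp (etaF s)"
proof -
  define r where "r = exp (-s)"
  have r: "0 < r" "r < 1" using assms by (auto simp: r_def)
  define g where "g m = 1 / (real (Suc m) * (exp (real (Suc m) * s) - 1))" for m
  define f where "f m n = r ^ (Suc m * Suc n) / real (Suc m)" for m n
  have rm: "0 < r ^ Suc m" "r ^ Suc m < 1" for m using r by (auto simp: power_less_one_iff simp del: power_Suc)
  have f1: "((\<lambda>n. f m n) has_sum g m) UNIV" for m
  proof (rule norm_summable_imp_has_sum)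
    have e: "exp (real (Suc m) * s) = 1 / r ^ Suc m"
      by (simp only: r_def exp_neg_power) (simp add: inverse_eq_divide)
    have "(\<lambda>n. (r ^ Suc m) ^ Suc n / real (Suc m)) sums (r ^ Suc m / (1 - r ^ Suc m) / real (Suc m))"
      using rm[of m] by (intro sums_divide geometric_Suc_sums) auto
    moreover have "r ^ Suc m / (1 - r ^ Suc m) / real (Suc m) = g m"
    proof -
      have "R / (1 - R) / S = 1 / (S * (1 / R - 1))" if "0 < R" "R < 1" "S > 0" for R S :: real
        using that by (simp add: divide_simps)
      from this[OF rm] show ?thesis unfolding g_def e by simp
    qed
    ultimately show "f m sums g m" unfolding f_def power_mult by simp
    moreover have "norm (f m n) = f m n" for n using r by (simp add: f_def)
    ultimately show "summable (\<lambda>n. norm (f m n))" by (simp add: sums_iff)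
  qed
  have f2: "((\<lambda>m. f m n) has_sum (- ln (1 - r ^ Suc n))) UNIV" for n
  proof (rule norm_summable_imp_has_sum)
    have eq: "f m n = (r ^ Suc n) ^ Suc m / real (Suc m)" for m
      unfolding f_def by (subst mult.commute) (simp only: power_mult)
    show "(\<lambda>m. f m n) sums (- ln (1 - r ^ Suc n))"
      unfolding eq by (intro minus_ln_one_minus_sums rm)
    moreover have "norm (f m n) = f m n" for m using r by (simp add: f_def)
    ultimately show "summable (\<lambda>m. norm (f m n))" by (simp add: sums_iff)
  qed
  have gsum: "(g has_sum etaF s) UNIV"
    unfolding g_def etaF_def using summable_etaF[OF assms] etaF_pos_terms[OF assms]
    by (intro norm_summable_imp_has_sum summable_sums) auto
  have "(\<lambda>(m, n). f m n) summable_on UNIV \<times> UNIV"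
    by (rule summable_on_SigmaI[where g = g]) (use f1 gsum r in \<open>auto simp: has_sum_imp_summable f_def\<close>)
  then have "((\<lambda>(m, n). f m n) has_sum etaF s) (UNIV \<times> UNIV)"
    by (intro has_sum_SigmaI[where g = g] gsum) (use f1 in auto)
  then have "((\<lambda>(n, m). f m n) has_sum etaF s) (UNIV \<times> UNIV)"
    by (subst (asm) has_sum_swap) (simp add: case_prod_unfold)
  then have "((\<lambda>n. - ln (1 - r ^ Suc n)) has_sum etaF s) UNIV"
    by (rule has_sum_SigmaD) (use f2 in auto)
  then have "(\<lambda>n. - ln (1 - r ^ Suc n)) sums etaF s" by (rule has_sum_imp_sums)
  then have "(\<lambda>N. exp (\<Sum>n<N. - ln (1 - r ^ Suc n))) \<longlonglongrightarrow> exp (etaF s)"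
    unfolding sums_def by (intro tendsto_exp)
  moreover have "exp (\<Sum>n<N. - ln (1 - r ^ Suc n)) = inverse (\<Prod>i<N. 1 - r * r ^ i)" for N
  proof -
    have "exp (\<Sum>n<N. - ln (1 - r ^ Suc n)) = (\<Prod>n<N. exp (- ln (1 - r ^ Suc n)))"
      by (simp add: exp_sum)
    also have "\<dots> = (\<Prod>n<N. inverse (1 - r * r ^ n))"
      using rm by (intro prod.cong) (auto simp: exp_minus)
    finally show ?thesis unfolding prod_inversef[unfolded o_def] .
  qed
  ultimately have "(\<lambda>N. inverse (\<Prod>i<N. 1 - r * r ^ i)) \<longlonglongrightarrow> exp (etaF s)" by (simp only:)
  moreover have "(\<lambda>N. inverse (\<Prod>i<N. 1 - r * r ^ i)) \<longlonglongrightarrow> inverse (qpoch r r)"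
    using r by (intro tendsto_inverse qpoch_LIMSEQ qpoch_nonzero) auto
  ultimately show ?thesis unfolding r_def[symmetric] by (rule LIMSEQ_unique[symmetric])
qed

section \<open>The partial fraction expansion of coth\<close>

lemma Digamma_reflection:
  fixes z :: complex
  assumes "z \<notin> \<int>"
  shows "Digamma z - Digamma (1 - z) = - of_real pi * cos (of_real pi * z) / sin (of_real pi * z)"
proof -
  have z1: "1 - z \<notin> \<int>" using assms by (metis Ints_1 Ints_diff diff_diff_eq2 add_diff_cancel_left')
  have nz: "z \<notin> \<int>\<^sub>\<le>\<^sub>0" "1 - z \<notin> \<int>\<^sub>\<le>\<^sub>0" using assms z1 nonpos_Ints_subset_Ints by blast+
  have s: "sin (of_real pi * z) \<noteq> 0" using assms by (auto simp: sin_eq_0)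
  have "((\<lambda>z. Gamma z * Gamma (1 - z)) has_field_derivative
      Gamma z * Gamma (1 - z) * (Digamma z - Digamma (1 - z))) (at z)"
    using nz by (auto intro!: derivative_eq_intros simp: algebra_simps)
  moreover have "((\<lambda>z. of_real pi / sin (of_real pi * z)) has_field_derivative
      (of_real pi / sin (of_real pi * z)) * (- of_real pi * cos (of_real pi * z) / sin (of_real pi * z))) (at z)"
    using s by (auto intro!: derivative_eq_intros simp: field_simps)
  ultimately have "(of_real pi / sin (of_real pi * z)) * (Digamma z - Digamma (1 - z)) = 
     (of_real pi / sin (of_real pi * z)) * (- of_real pi * cos (of_real pi * z) / sin (of_real pi * z))"
    unfolding Gamma_reflection_complex using DERIV_unique by blast
  then show ?thesis by (subst (asm) mult_left_cancel) (use s in auto)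
qed

text \<open>The right-hand side is coth (x/2)/2 - 1/x. It comes from the logarithmic derivative of
  Euler's reflection formula at z = i x/(2\<pi>): in the limit formulas for \<open>Digamma\<close>
  at z and 1 - z the logarithms cancel and the reciprocals pair up.\<close>

lemma coth_partial_fractions:
  fixes x :: real
  assumes x: "x > 0"
  shows "(\<lambda>k. 2 * x / (x\<^sup>2 + 4 * pi\<^sup>2 * real (Suc k) ^ 2)) sums (1 / (exp x - 1) - 1 / x + 1 / 2)"
proof -
  define y where "y = x / (2 * pi)"
  have y: "y > 0" using x by (simp add: y_def)
  define z :: complex where "z = \<i> * of_real y"
  have zI: "z \<notin> \<int>" using y by (auto simp: z_def Ints_def complex_eq_iff)
  have z0: "z \<noteq> 0" "1 - z \<noteq> 0" using zI by auto
  have e: "exp (2 * pi * y) = exp x" by (simp add: y_def)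
  have lim: "(\<lambda>m. (of_real (ln (real m)) - (\<Sum>n<m. inverse (z + of_nat n)))
        - (of_real (ln (real m)) - (\<Sum>n<m. inverse (1 - z + of_nat n)))) \<longlonglongrightarrow> Digamma z - Digamma (1 - z)"
    using z0 by (intro tendsto_diff Digamma_LIMSEQ)
  have "(of_real (ln (real m)) - (\<Sum>n<m. inverse (z + of_nat n)))
        - (of_real (ln (real m)) - (\<Sum>n<m. inverse (1 - z + of_nat n))) =
        \<i> * of_real (\<Sum>n<m. 2 * y / (real (Suc n) ^ 2 + y\<^sup>2)) - inverse z + inverse (z + of_nat m)" for m
  proof -
    \<comment> \<open>The term 1 - z + n has to be paired with z + n + 1, one index later. The shift
      leaves the boundary terms 1/z, which becomes -1/x in the result, and 1/(z + m), which vanishes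
      in the limit.\<close>
    have "(\<Sum>n<m. inverse (z + of_nat n)) + inverse (z + of_nat m) = inverse z + (\<Sum>n<m. inverse (z + of_nat (Suc n)))"
      using sum.lessThan_Suc_shift[of "\<lambda>n. inverse (z + of_nat n)" m] by simp
    moreover have "(\<Sum>n<m. inverse (1 - z + of_nat n)) - (\<Sum>n<m. inverse (z + of_nat (Suc n))) = 
        (\<Sum>n<m. \<i> * of_real (2 * y / (real (Suc n) ^ 2 + y\<^sup>2)))"
      unfolding sum_subtractf[symmetric]
    proof (rule sum.cong[OF refl])
      fix n
      define a where "a = real (Suc n)"
      have a: "a > 0" by (simp add: a_def)
      have 1: "1 - z + of_nat n = of_real a - z" "z + of_nat (Suc n) = of_real a + z" by (simp_all add: a_def)
      have nz: "of_real a - z \<noteq> 0" "of_real a + z \<noteq> 0" using a by (auto simp: z_def complex_eq_iff)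
      have "inverse (of_real a - z) - inverse (of_real a + z) = 2 * z / ((of_real a - z) * (of_real a + z))"
        using nz by (simp add: field_simps)
      also have "(of_real a - z) * (of_real a + z) = of_real (a\<^sup>2 + y\<^sup>2)"
        by (simp add: z_def algebra_simps power2_eq_square)
      finally show "inverse (1 - z + of_nat n) - inverse (z + of_nat (Suc n)) = \<i> * of_real (2 * y / (real (Suc n) ^ 2 + y\<^sup>2))"
        unfolding 1 a_def[symmetric] by (simp add: z_def)
    qed
    ultimately show ?thesis by (simp add: sum_distrib_left algebra_simps)
  qed
  note lim = lim[unfolded this]
  have "filterlim (\<lambda>m. z + of_nat m) at_infinity sequentially"
    by (intro tendsto_add_filterlim_at_infinity[of _ z] tendsto_const tendsto_of_nat)
  then have "(\<lambda>m. inverse (z + of_nat m)) \<longlonglongrightarrow> 0"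
    by (rule filterlim_compose[OF tendsto_inverse_0])
  from tendsto_diff[OF tendsto_add[OF lim tendsto_const[of "inverse z"]] this]
  have lim2: "(\<lambda>m. \<i> * of_real (\<Sum>n<m. 2 * y / (real (Suc n) ^ 2 + y\<^sup>2))) \<longlonglongrightarrow> Digamma z - Digamma (1 - z) + inverse z"
    by simp
  have "- of_real pi * cos (of_real pi * z) / sin (of_real pi * z) = \<i> * of_real (pi * (exp x + 1) / (exp x - 1))"
  proof -
    have iz: "\<i> * (of_real pi * z) = of_real (- pi * y)" by (simp add: z_def complex_eq_iff)
    define E where "E = exp (pi * y)"
    have E: "E > 0" "E\<^sup>2 = exp x" by (simp_all add: E_def exp_double[symmetric] e[symmetric] mult_ac power2_eq_square exp_add[symmetric])
    have E1: "E\<^sup>2 \<noteq> 1" using E(2) x by simp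
    have "exp (- pi * y) = 1 / E" by (simp add: E_def exp_minus inverse_eq_divide)
    then have ex: "exp (complex_of_real (- pi * y)) = of_real (1 / E)" "exp (- complex_of_real (- pi * y)) = of_real E"
      by (simp_all only: of_real_minus[symmetric] exp_of_real E_def mult_minus_left minus_minus)
    have c: "cos (of_real pi * z) = of_real ((1 / E + E) / 2)"
      unfolding cos_exp_eq iz ex by simp
    have s: "sin (of_real pi * z) = of_real ((1 / E - E) / 2) / \<i>"
      unfolding sin_exp_eq iz ex by simp
    have "- of_real pi * cos (of_real pi * z) / sin (of_real pi * z) = 
        \<i> * of_real (- pi * ((1 / E + E) / 2) / ((1 / E - E) / 2))"
    proof -
      have "- a * C / (S / \<i>) = \<i> * (- a * C / S)" for a C S :: complex
        by (simp add: divide_inverse inverse_mult_distrib mult_ac)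
      then show ?thesis unfolding c s by (simp only: of_real_mult of_real_divide of_real_minus)
    qed
    also have "- pi * ((1 / E + E) / 2) / ((1 / E - E) / 2) = pi * (E\<^sup>2 + 1) / (E\<^sup>2 - 1)"
      using E(1) E1 by (simp add: divide_simps power2_eq_square) (simp add: algebra_simps)
    finally show ?thesis unfolding E(2) .
  qed
  then have D: "Digamma z - Digamma (1 - z) + inverse z = \<i> * of_real (pi * (exp x + 1) / (exp x - 1) - 1 / y)"
  proof -
    have iz: "inverse z = - (\<i> * of_real (1 / y))" by (simp add: z_def divide_inverse)
    show ?thesis unfolding Digamma_reflection[OF zI] \<open>_ = \<i> * of_real (pi * (exp x + 1) / (exp x - 1))\<close> iz
      by (simp add: ring_distribs)
  qed
  have "(\<lambda>m. Im (\<i> * of_real (\<Sum>n<m. 2 * y / (real (Suc n) ^ 2 + y\<^sup>2)))) \<longlonglongrightarrow> Im (\<i> * of_real (pi * (exp x + 1) / (exp x - 1) - 1 / y))"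
    using tendsto_Im[OF lim2[unfolded D]] .
  then have "(\<lambda>n. 2 * y / (real (Suc n) ^ 2 + y\<^sup>2)) sums (pi * (exp x + 1) / (exp x - 1) - 1 / y)"
    unfolding sums_def by simp
  then have "(\<lambda>n. 2 * y / (real (Suc n) ^ 2 + y\<^sup>2) / (2 * pi)) sums ((pi * (exp x + 1) / (exp x - 1) - 1 / y) / (2 * pi))"
    by (rule sums_divide)
  moreover have "(pi * (exp x + 1) / (exp x - 1) - 1 / y) / (2 * pi) = 1 / (exp x - 1) - 1 / x + 1 / 2"
  proof -
    have "exp x - 1 > 0" using x by simp
    then show ?thesis using x by (simp add: y_def field_simps)
  qed
  moreover have "2 * y / (a ^ 2 + y\<^sup>2) / (2 * pi) = 2 * x / (x\<^sup>2 + 4 * pi\<^sup>2 * a ^ 2)" if "a > 0" for a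
  proof -
    have "a\<^sup>2 + y\<^sup>2 = (x\<^sup>2 + 4 * pi\<^sup>2 * a ^ 2) / (4 * pi\<^sup>2)" by (simp add: y_def field_simps)
    moreover have "x\<^sup>2 + 4 * pi\<^sup>2 * a ^ 2 > 0" using x by (intro add_pos_nonneg) auto
    moreover have "2 * (x / (2 * pi)) / (D / (4 * pi\<^sup>2)) / (2 * pi) = 2 * x / D" if "D > 0" for D
      using that by (simp add: field_simps power2_eq_square)
    ultimately show ?thesis by (simp only: y_def)
  qed
  ultimately show ?thesis by simp
qed

section \<open>The inverse tangent integral\<close>

definition arctan_quot :: "real \<Rightarrow> real" where
  "arctan_quot u = (if u = 0 then 1 else arctan u / u)"

lemma continuous_arctan_quot: "isCont arctan_quot u"
proof (cases "u = 0")
  case True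
  have "((\<lambda>h. (arctan (0 + h) - arctan 0) / h) \<longlongrightarrow> 1) (at 0)"
    using DERIV_arctan[of 0] by (simp add: DERIV_def)
  then have "(arctan_quot \<longlongrightarrow> 1) (at 0)"
    by (rule Lim_transform_eventually) (auto simp: eventually_at_filter arctan_quot_def)
  then show ?thesis using True by (simp add: isCont_def arctan_quot_def)
next
  case False
  then have "eventually (\<lambda>x. x \<in> -{0}) (nhds u)" by (intro eventually_nhds_in_open) auto
  then have "eventually (\<lambda>x. arctan_quot x = arctan x / x) (nhds u)"
    by eventually_elim (auto simp: arctan_quot_def)
  moreover have "isCont (\<lambda>x. arctan x / x) u" using False by (intro continuous_intros) auto
  ultimately show ?thesis by (subst isCont_cong) 
qed

lemma arctan_quot_antimono:
  assumes "0 \<le> u" "u \<le> v"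
  shows "arctan_quot v \<le> arctan_quot u"
proof -
  have mvt: "\<exists>t. a < t \<and> t < b \<and> arctan b - arctan a = (b - a) * inverse (1 + t\<^sup>2)" if "a < b" for a b
    using MVT2[OF that, of arctan "\<lambda>t. inverse (1 + t\<^sup>2)"] DERIV_arctan by blast
  show ?thesis
  proof (cases "u = v")
    case False
    then have uv: "u < v" using assms by simp
    show ?thesis
    proof (cases "u = 0")
      case True
      obtain t where "arctan v = v * inverse (1 + t\<^sup>2)" using mvt[OF uv] True by auto
      moreover have "inverse (1 + t\<^sup>2) \<le> 1" by (simp add: inverse_le_1_iff)
      ultimately show ?thesis using uv True by (simp add: arctan_quot_def)
    next
      case False
      then have u: "u > 0" using assms by simp
      obtain t where t: "0 < t" "t < u" "arctan u = u * inverse (1 + t\<^sup>2)" using mvt[OF u] by auto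
      obtain t' where t': "u < t'" "arctan v - arctan u = (v - u) * inverse (1 + t'\<^sup>2)" using mvt[OF uv] by auto
      have "t\<^sup>2 \<le> t'\<^sup>2" using t t' by (intro power_mono) auto
      then have "inverse (1 + t'\<^sup>2) \<le> inverse (1 + t\<^sup>2)" by (intro le_imp_inverse_le) (auto intro: add_pos_nonneg)
      then have "(v - u) * inverse (1 + t'\<^sup>2) \<le> (v - u) * inverse (1 + t\<^sup>2)" using uv by (intro mult_left_mono) auto
      then have "arctan v \<le> v * inverse (1 + t\<^sup>2)" using t(3) t'(2) by (simp add: algebra_simps)
      then have "arctan v / v \<le> inverse (1 + t\<^sup>2)" using uv u by (simp add: divide_le_eq mult_ac)
      also have "\<dots> = arctan u / u" using t u by simp
      finally show ?thesis using u uv by (simp add: arctan_quot_def)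
    qed
  qed auto
qed

text \<open>The inverse tangent integral up to an additive constant; only differences of values
  occur. The base point -1 makes 0 an interior point, so the two-sided derivative exists there
  too.\<close>

definition arctan_int :: "real \<Rightarrow> real" where
  "arctan_int x = integral {-1..x} arctan_quot"

lemma arctan_int_deriv:
  assumes "x > -1"
  shows "(arctan_int has_real_derivative arctan_quot x) (at x)"
proof -
  have "((\<lambda>x. integral {-1..x} arctan_quot) has_real_derivative arctan_quot x) (at x within {-1..x+1})"
    using assms by (intro integral_has_real_derivative continuous_at_imp_continuous_on)
       (auto simp: continuous_arctan_quot)
  moreover have "at x within {-1..x+1} = at x" using assms by (intro at_within_Icc_at) auto
  ultimately show ?thesis by (simp add: arctan_int_def[abs_def])
qed

text \<open>Both sides have the same derivative because arctan x + arctan (1/x) = \<pi>/2, and both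
  vanish at 1. This is the origin of the logarithm, hence of the factor sqrt (s/(2\<pi>)), in the
  transformation law.\<close>

lemma arctan_int_reciprocal:
  assumes "a > 0"
  shows "arctan_int a - arctan_int (1 / a) = pi / 2 * ln a"
proof -
  define D where "D a = arctan_int a - arctan_int (1 / a) - pi / 2 * ln a" for a
  have "(D has_real_derivative 0) (at x within {0<..})" if x: "x \<in> {0<..}" for x
  proof -
    have x: "x > 0" using that by simp
    have "((\<lambda>x. arctan_int (1 / x)) has_real_derivative (arctan_quot (1 / x) * (- (1 / x\<^sup>2)))) (at x)"
      by (rule DERIV_chain2[OF arctan_int_deriv])
         (use x in \<open>auto intro!: derivative_eq_intros simp: power2_eq_square less_trans[of "-1" 0]\<close>)
    then have "(D has_real_derivative (arctan_quot x - arctan_quot (1 / x) * (- (1 / x\<^sup>2)) - pi / 2 * (1 / x))) (at x)"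
      unfolding D_def[abs_def] using x
      by (intro DERIV_diff arctan_int_deriv DERIV_cmult DERIV_ln_divide) auto
    moreover have "arctan_quot x - arctan_quot (1 / x) * (- (1 / x\<^sup>2)) - pi / 2 * (1 / x) = 0"
      using x arctan_inverse[of x] by (simp add: arctan_quot_def field_simps power2_eq_square)
    ultimately show ?thesis by (metis has_field_derivative_at_within)
  qed
  then obtain c where c: "\<And>x. x \<in> {0<..} \<Longrightarrow> D x = c"
    using has_field_derivative_zero_constant[of "{0<..}" D] by auto
  have "D a = D 1" using c[of a] c[of 1] assms by simp
  then show ?thesis by (simp add: D_def)
qed

text \<open>With m counted from 1, arctan (a m/M)/m is \<open>arctan_quot\<close> at a m/M times the
  mesh a/M, so this is a right Riemann sum on [0, a]. As the integrand decreases, upper and lower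
  sums enclose the integral, and their difference telescopes to O(1/M).\<close>

lemma arctan_Riemann:
  assumes a: "a > 0"
  shows "(\<lambda>M. \<Sum>m<M. arctan (a * real (Suc m) / real M) / real (Suc m)) \<longlonglongrightarrow> arctan_int a - arctan_int 0"
proof -
  let ?R = "\<lambda>M. \<Sum>m<M. arctan (a * real (Suc m) / real M) / real (Suc m)"
  have step: "arctan_quot v * (v - u) \<le> arctan_int v - arctan_int u \<and> arctan_int v - arctan_int u \<le> arctan_quot u * (v - u)"
    if "0 \<le> u" "u < v" for u v
  proof -
    have "\<exists>t. u < t \<and> t < v \<and> arctan_int v - arctan_int u = (v - u) * arctan_quot t"
      using that by (intro MVT2 arctan_int_deriv) auto
    then obtain t where t: "u < t" "t < v" "arctan_int v - arctan_int u = (v - u) * arctan_quot t" by auto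
    have "arctan_quot v \<le> arctan_quot t" "arctan_quot t \<le> arctan_quot u"
      using t that by (auto intro!: arctan_quot_antimono)
    then show ?thesis unfolding t(3) using that by (auto simp: mult.commute intro!: mult_left_mono)
  qed
  have bounds: "?R M \<le> arctan_int a - arctan_int 0 \<and> arctan_int a - arctan_int 0 - a * (1 - arctan_quot a) / real M \<le> ?R M" 
    if M: "M > 0" for M
  proof -
    define u where "u m = a * real m / real M" for m
    have du: "u (Suc m) - u m = a / real M" for m by (simp add: u_def diff_divide_distrib[symmetric] algebra_simps)
    have u: "0 \<le> u m" "u m < u (Suc m)" for m using a M by (auto simp: u_def divide_strict_right_mono)
    have R: "?R M = (\<Sum>m<M. arctan_quot (u (Suc m)) * (u (Suc m) - u m))"
      unfolding du
    proof (intro sum.cong refl)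
      fix m
      have "X / real (Suc m) = X / (a * real (Suc m) / real M) * (a / real M)" for X
        using a M by (simp add: divide_simps)
      then show "arctan (a * real (Suc m) / real M) / real (Suc m) = arctan_quot (u (Suc m)) * (a / real M)"
        using a M by (simp add: u_def arctan_quot_def)
    qed
    have tel: "(\<Sum>m<M. arctan_int (u (Suc m)) - arctan_int (u m)) = arctan_int a - arctan_int 0"
      by (subst sum_lessThan_telescope[of "\<lambda>m. arctan_int (u m)"]) (use M in \<open>simp add: u_def\<close>)
    have "?R M \<le> (\<Sum>m<M. arctan_int (u (Suc m)) - arctan_int (u m))"
      unfolding R using step u by (intro sum_mono) auto
    moreover have "(\<Sum>m<M. arctan_int (u (Suc m)) - arctan_int (u m)) \<le> (\<Sum>m<M. arctan_quot (u m) * (u (Suc m) - u m))"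
      using step u by (intro sum_mono) auto
    moreover have "(\<Sum>m<M. arctan_quot (u m) * (u (Suc m) - u m)) - ?R M = a * (1 - arctan_quot a) / real M"
    proof -
      have "(\<Sum>m<M. arctan_quot (u m) * (u (Suc m) - u m)) - ?R M = a / real M * (\<Sum>m<M. arctan_quot (u m) - arctan_quot (u (Suc m)))"
        unfolding R du sum_subtractf sum_distrib_right[symmetric] by (simp add: algebra_simps)
      also have "(\<Sum>m<M. arctan_quot (u m) - arctan_quot (u (Suc m))) = arctan_quot (u 0) - arctan_quot (u M)"
        by (rule sum_lessThan_telescope')
      finally show ?thesis using M by (simp add: u_def arctan_quot_def)
    qed
    ultimately show ?thesis unfolding tel by linarith
  qed
  have "(\<lambda>M. arctan_int a - arctan_int 0 - a * (1 - arctan_quot a) / real M) \<longlonglongrightarrow> arctan_int a - arctan_int 0 - 0"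
    by (intro tendsto_diff tendsto_const tendsto_divide_0[OF tendsto_const] filterlim_at_top_imp_at_infinity filterlim_real_sequentially)
  then have l: "(\<lambda>M. arctan_int a - arctan_int 0 - a * (1 - arctan_quot a) / real M) \<longlonglongrightarrow> arctan_int a - arctan_int 0"
    by simp
  show ?thesis
  proof (rule real_tendsto_sandwich[OF _ _ l tendsto_const])
    show "eventually (\<lambda>M. arctan_int a - arctan_int 0 - a * (1 - arctan_quot a) / real M \<le> ?R M) sequentially"
      using eventually_gt_at_top[of 0] by (rule eventually_mono) (rule bounds[THEN conjunct2])
    show "eventually (\<lambda>M. ?R M \<le> arctan_int a - arctan_int 0) sequentially"
      using eventually_gt_at_top[of 0] by (rule eventually_mono) (rule bounds[THEN conjunct1])
  qed
qed

text \<open>Integral comparison for a decreasing summand: \<open>A\<close> is the integral from M to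
  infinity, evaluated by the primitive -\<open>B\<close>. The error is at most the value of the
  summand function at M, of order 1/M^2, hence still negligible after summation over M rows.\<close>

lemma suminf_shift_bounds:
  fixes s :: real and m :: nat
  assumes s: "s > 0" and M: "M > 0"
  defines "h \<equiv> (\<lambda>k. 2 * s / ((real (Suc m))\<^sup>2 * s\<^sup>2 + 4 * pi\<^sup>2 * (real (Suc k))\<^sup>2))"
  defines "A \<equiv> arctan (s / (2 * pi) * real (Suc m) / real M) / (pi * real (Suc m))"
  assumes h: "summable h"
  shows "(\<Sum>k. h (k + M)) \<le> A" "A - (\<Sum>k. h (k + M)) \<le> s / (2 * pi\<^sup>2 * (real M)\<^sup>2)"
proof -
  define p where "p = real (Suc m)"
  have p: "p > 0" by (simp add: p_def)
  define g where "g y = 2 * s / (p\<^sup>2 * s\<^sup>2 + 4 * pi\<^sup>2 * y\<^sup>2)" for y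
  define B where "B y = arctan (s / (2 * pi) * p / y) / (pi * p)" for y
  have pos: "p\<^sup>2 * s\<^sup>2 + 4 * pi\<^sup>2 * y\<^sup>2 > 0" for y using p s by (intro add_pos_nonneg) auto
  have B': "(B has_real_derivative - g y) (at y)" if y: "y > 0" for y
  proof -
    have 1: "1 + (s / (2 * pi) * p / y)\<^sup>2 = (p\<^sup>2 * s\<^sup>2 + 4 * pi\<^sup>2 * y\<^sup>2) / (4 * pi\<^sup>2 * y\<^sup>2)"
      using y by (simp add: field_simps)
    have "((\<lambda>y. s / (2 * pi) * p / y) has_real_derivative - (s / (2 * pi) * p / y\<^sup>2)) (at y)"
      using y by (auto intro!: derivative_eq_intros simp: power2_eq_square mult_ac)
    then have "(B has_real_derivative (inverse (1 + (s / (2 * pi) * p / y)\<^sup>2) * - (s / (2 * pi) * p / y\<^sup>2)) / (pi * p)) (at y)"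
      unfolding B_def[abs_def] by (intro DERIV_cdivide DERIV_chain2[OF DERIV_arctan])
    moreover have "(inverse (1 + (s / (2 * pi) * p / y)\<^sup>2) * - (s / (2 * pi) * p / y\<^sup>2)) / (pi * p) = - g y"
    proof -
      have "(inverse (D / (4 * pi\<^sup>2 * y\<^sup>2)) * - (s / (2 * pi) * p / y\<^sup>2)) / (pi * p) = - (2 * s / D)" if "D > 0" for D
        using y p that by (simp add: field_simps power2_eq_square)
      from this[OF pos] show ?thesis unfolding 1 g_def .
    qed
    ultimately show ?thesis by simp
  qed
  have g_mono: "g y \<le> g x" if "0 \<le> x" "x \<le> y" for x y
    unfolding g_def using pos s that by (intro divide_left_mono mult_pos_pos add_left_mono mult_left_mono power_mono) auto
  have step: "g (real (Suc k)) \<le> B (real k) - B (real (Suc k)) \<and> B (real k) - B (real (Suc k)) \<le> g (real k)"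
    if "k > 0" for k
  proof -
    have "\<exists>t. real k < t \<and> t < real (Suc k) \<and> B (real (Suc k)) - B (real k) = (real (Suc k) - real k) * (- g t)"
      using that by (intro MVT2 B') auto
    then obtain t where t: "real k < t" "t < real (Suc k)" "B (real k) - B (real (Suc k)) = g t" by auto
    show ?thesis unfolding t(3) using t g_mono[of t "real (Suc k)"] g_mono[of "real k" t] by auto
  qed
  have B0: "(\<lambda>k. B (real (k + N))) \<longlonglongrightarrow> 0" for N
  proof -
    have "filterlim (\<lambda>k. real (k + N)) at_infinity sequentially"
      by (intro filterlim_at_top_imp_at_infinity filterlim_compose[OF filterlim_real_sequentially]
                filterlim_add_const_nat_at_top)
    then have "(\<lambda>k. s / (2 * pi) * p / real (k + N)) \<longlonglongrightarrow> 0" by (intro tendsto_divide_0[OF tendsto_const])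
    then have "(\<lambda>k. arctan (s / (2 * pi) * p / real (k + N)) / (pi * p)) \<longlonglongrightarrow> arctan 0 / (pi * p)"
      using p by (intro tendsto_divide tendsto_arctan tendsto_const) auto
    then show ?thesis by (simp add: B_def)
  qed
  have tel: "(\<lambda>k. B (real (k + N)) - B (real (Suc (k + N)))) sums B (real N)" for N
    using telescope_sums'[OF B0[of N]] by simp
  have hg: "h (k + M) = g (real (Suc (k + M)))" for k by (simp add: h_def g_def p_def)
  have hs: "summable (\<lambda>k. h (k + M))" using h by (rule summable_ignore_initial_segment)
  have "(\<Sum>k. h (k + M)) \<le> B (real M)"
    unfolding sums_unique[OF tel[of M]] hg
  proof (rule suminf_le[OF _ hs[unfolded hg] sums_summable[OF tel[of M]]])
    show "g (real (Suc (k + M))) \<le> B (real (k + M)) - B (real (Suc (k + M)))" for k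
      by (rule step[THEN conjunct1]) (use M in auto)
  qed
  then show "(\<Sum>k. h (k + M)) \<le> A" by (simp add: A_def B_def p_def)
  have "B (real (Suc M)) \<le> (\<Sum>k. h (k + M))"
    unfolding sums_unique[OF tel[of "Suc M"]] hg
  proof (rule suminf_le[OF _ sums_summable[OF tel[of "Suc M"]] hs[unfolded hg]])
    show "B (real (k + Suc M)) - B (real (Suc (k + Suc M))) \<le> g (real (Suc (k + M)))" for k
      unfolding add_Suc_right by (rule step[THEN conjunct2]) simp
  qed
  moreover have "B (real M) - B (real (Suc M)) \<le> g (real M)" using step[OF M] by blast
  moreover have "g (real M) \<le> s / (2 * pi\<^sup>2 * (real M)\<^sup>2)"
  proof -
    have "g (real M) \<le> 2 * s / (4 * pi\<^sup>2 * (real M)\<^sup>2)"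
      unfolding g_def using s M pos[of "real M"] by (intro divide_left_mono mult_pos_pos) auto
    then show ?thesis by simp
  qed
  ultimately show "A - (\<Sum>k. h (k + M)) \<le> s / (2 * pi\<^sup>2 * (real M)\<^sup>2)"
    by (simp add: A_def B_def p_def)
qed

text \<open>Expanding \<open>1 / (exp (m s) - 1)\<close> into partial fractions writes \<open>etaF s\<close> as a double sum of
  \<open>h m k = 2 s / (m\<^sup>2 s\<^sup>2 + 4 \<pi>\<^sup>2 k\<^sup>2)\<close> with a divergent harmonic correction. The substitution
  \<open>s \<mapsto> 4 \<pi>\<^sup>2 / s\<close> exchanges \<open>m\<close> and \<open>k\<close>, and the logarithm is the price
  for exchanging the order of summation.\<close>

theorem etaF_transform:
  assumes s: "s > 0"
  shows "etaF s = pi\<^sup>2 / (6 * s) + ln (s / (2 * pi)) / 2 - s / 24 + etaF (4 * pi\<^sup>2 / s)"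
proof -
  define h where "h s m k = 2 * s / ((real (Suc m))\<^sup>2 * s\<^sup>2 + 4 * pi\<^sup>2 * (real (Suc k))\<^sup>2)" for s m k
  \<comment> \<open>Row m (counted from 1) sums to the m-th term of \<open>etaF\<close> minus 1/(s
    m^2) plus 1/(2m). Subtracting half the harmonic number removes the divergent last part.\<close>
  define V where "V s M = (\<Sum>m<M. suminf (h s m)) - harm M / 2" for s M
  have hsum: "(h s m) sums (1 / (real (Suc m) * (exp (real (Suc m) * s) - 1)) - 1 / s * (1 / (real (Suc m))\<^sup>2) + inverse (real (Suc m)) / 2)"
    if "s > 0" for s m
  proof -
    define p where "p = real (Suc m)"
    have p: "p > 0" by (simp add: p_def)
    have "(\<lambda>k. 2 * (p * s) / ((p * s)\<^sup>2 + 4 * pi\<^sup>2 * real (Suc k) ^ 2) / p) sums ((1 / (exp (p * s) - 1) - 1 / (p * s) + 1 / 2) / p)"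
      using that p by (intro sums_divide coth_partial_fractions) auto
    moreover have "2 * (p * s) / ((p * s)\<^sup>2 + 4 * pi\<^sup>2 * real (Suc k) ^ 2) / p = h s m k" for k
      unfolding h_def p_def[symmetric] using p by (simp add: power_mult_distrib)
    moreover have "(1 / (exp (p * s) - 1) - 1 / (p * s) + 1 / 2) / p = 1 / (p * (exp (p * s) - 1)) - 1 / s * (1 / p\<^sup>2) + inverse p / 2"
      using p by (simp add: diff_divide_distrib add_divide_distrib power2_eq_square inverse_eq_divide mult_ac)
    ultimately show ?thesis by (simp only: p_def)
  qed
  have Vlim: "V s \<longlonglongrightarrow> etaF s - pi\<^sup>2 / (6 * s)" if s: "s > 0" for s
  proof -
    have "(\<lambda>M. \<Sum>m<M. 1 / (real (Suc m) * (exp (real (Suc m) * s) - 1)) - 1 / s * (1 / (real (Suc m))\<^sup>2)) \<longlonglongrightarrow> etaF s - 1 / s * (pi\<^sup>2 / 6)"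
      unfolding sums_def[symmetric]
    proof (intro sums_diff sums_mult)
      show "(\<lambda>m. 1 / (real (Suc m) * (exp (real (Suc m) * s) - 1))) sums etaF s"
        unfolding etaF_def by (rule summable_sums[OF summable_etaF[OF s]])
      show "(\<lambda>m. 1 / (real (Suc m))\<^sup>2) sums (pi\<^sup>2 / 6)"
        using inverse_squares_sums by (simp add: add.commute)
    qed
    moreover have "(\<Sum>m<M. 1 / (real (Suc m) * (exp (real (Suc m) * s) - 1)) - 1 / s * (1 / (real (Suc m))\<^sup>2)) = V s M" for M
    proof -
      have "harm M = (\<Sum>m<M. inverse (real (Suc m)))" 
        unfolding harm_def by (rule sum.reindex_bij_witness[of _ Suc "\<lambda>m. m - 1"]) auto
      then show ?thesis
        unfolding V_def sums_unique[OF hsum[OF s], symmetric] by (simp only: sum.distrib sum_divide_distrib)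
    qed
    ultimately show ?thesis by (simp add: mult_ac)
  qed
  define s' where "s' = 4 * pi\<^sup>2 / s"
  have s': "s' > 0" using s by (simp add: s'_def)
  have sym: "h s' k m = h s m k" for m k
  proof -
    define p q where "p = real (Suc m)" and "q = real (Suc k)"
    have "p > 0" "q > 0" by (auto simp: p_def q_def)
    then have d: "p\<^sup>2 * s\<^sup>2 + 4 * pi\<^sup>2 * q\<^sup>2 > 0" using s by (intro add_pos_nonneg) auto
    have "q\<^sup>2 * s'\<^sup>2 + 4 * pi\<^sup>2 * p\<^sup>2 = (p\<^sup>2 * s\<^sup>2 + 4 * pi\<^sup>2 * q\<^sup>2) * (4 * pi\<^sup>2 / s\<^sup>2)"
      using s by (simp add: s'_def field_simps power2_eq_square)
    then have "h s' k m = 2 * (4 * pi\<^sup>2 / s) / ((p\<^sup>2 * s\<^sup>2 + 4 * pi\<^sup>2 * q\<^sup>2) * (4 * pi\<^sup>2 / s\<^sup>2))"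
      unfolding h_def p_def[symmetric] q_def[symmetric] s'_def[symmetric] by (simp only:)
    also have "\<dots> = h s m k"
    proof -
      have "2 * (4 * pi\<^sup>2 / s) / (D * (4 * pi\<^sup>2 / s\<^sup>2)) = 2 * s / D" if "D > 0" for D
        using that s by (simp add: field_simps power2_eq_square)
      from this[OF d] show ?thesis unfolding h_def p_def[symmetric] q_def[symmetric] .
    qed
    finally show ?thesis .
  qed
  \<comment> \<open>\<open>T\<close> collects what the first M rows contain beyond column M. The
    remaining M by M square has the same sum for s and 4\<pi>^2/s, because \<open>sym\<close>
    transposes it; so the two values differ only through \<open>T\<close>.\<close>
  define T where "T s M = (\<Sum>m<M. \<Sum>k. h s m (k + M))" for s M
  have V_eq: "V s M = T s M + (\<Sum>m<M. \<Sum>k<M. h s m k) - harm M / 2" if "s > 0" for s M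
  proof -
    have "suminf (h s m) = (\<Sum>k. h s m (k + M)) + (\<Sum>k<M. h s m k)" for m
      by (rule suminf_split_initial_segment[OF sums_summable[OF hsum[OF that]]])
    then show ?thesis by (simp add: V_def T_def sum.distrib)
  qed
  have "(\<Sum>m<M. \<Sum>k<M. h s' m k) = (\<Sum>m<M. \<Sum>k<M. h s m k)" for M
    unfolding sym by (rule sum.swap)
  then have VT: "V s M - V s' M = T s M - T s' M" for M using V_eq[OF s] V_eq[OF s'] by simp
  have Tlim: "T s \<longlonglongrightarrow> (arctan_int (s / (2 * pi)) - arctan_int 0) / pi" if s: "s > 0" for s
  proof -
    define R where "R M = (\<Sum>m<M. arctan (s / (2 * pi) * real (Suc m) / real M) / real (Suc m)) / pi" for M
    have R: "R \<longlonglongrightarrow> (arctan_int (s / (2 * pi)) - arctan_int 0) / pi"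
      unfolding R_def[abs_def] using s by (intro tendsto_divide arctan_Riemann tendsto_const) auto
    have "norm (R M - T s M) \<le> s / (2 * pi\<^sup>2) * (1 / real M)" if M: "M > 0" for M
    proof -
      let ?A = "\<lambda>m. arctan (s / (2 * pi) * real (Suc m) / real M) / (pi * real (Suc m))"
      have "R M = (\<Sum>m<M. ?A m)" by (simp add: R_def sum_divide_distrib mult.commute)
      then have RT: "R M - T s M = (\<Sum>m<M. ?A m - (\<Sum>k. h s m (k + M)))" by (simp add: T_def sum_subtractf)
      note b = suminf_shift_bounds[OF s M sums_summable[OF hsum[OF s], unfolded h_def[abs_def]], folded h_def]
      have "R M - T s M \<ge> 0" unfolding RT using b(1) by (intro sum_nonneg) simp
      moreover have "R M - T s M \<le> (\<Sum>m<M. s / (2 * pi\<^sup>2 * (real M)\<^sup>2))" unfolding RT using b(2) by (intro sum_mono) simp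
      moreover have "(\<Sum>m<M. s / (2 * pi\<^sup>2 * (real M)\<^sup>2)) = s / (2 * pi\<^sup>2) * (1 / real M)"
        using M by (simp add: power2_eq_square)
      ultimately show ?thesis by simp
    qed
    then have ev: "eventually (\<lambda>M. norm (R M - T s M) \<le> s / (2 * pi\<^sup>2) * (1 / real M)) sequentially"
      using eventually_gt_at_top[of 0] by (rule_tac eventually_mono)
    have "(\<lambda>M. s / (2 * pi\<^sup>2) * (1 / real M)) \<longlonglongrightarrow> 0"
      by (intro tendsto_mult_right_zero lim_1_over_n)
    from Lim_null_comparison[OF ev this] have "(\<lambda>M. R M - T s M) \<longlonglongrightarrow> 0" .
    from tendsto_diff[OF R this] show ?thesis by simp
  qed
  have "(\<lambda>M. T s M - T s' M) \<longlonglongrightarrow> (arctan_int (s / (2 * pi)) - arctan_int 0) / pi - (arctan_int (s' / (2 * pi)) - arctan_int 0) / pi"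
    by (intro tendsto_diff Tlim s s')
  moreover have "(\<lambda>M. T s M - T s' M) \<longlonglongrightarrow> (etaF s - pi\<^sup>2 / (6 * s)) - (etaF s' - pi\<^sup>2 / (6 * s'))"
    unfolding VT[symmetric] by (intro tendsto_diff Vlim s s')
  ultimately have "(etaF s - pi\<^sup>2 / (6 * s)) - (etaF s' - pi\<^sup>2 / (6 * s')) = 
      (arctan_int (s / (2 * pi)) - arctan_int 0) / pi - (arctan_int (s' / (2 * pi)) - arctan_int 0) / pi"
    by (rule LIMSEQ_unique[rotated])
  also have "\<dots> = (arctan_int (s / (2 * pi)) - arctan_int (1 / (s / (2 * pi)))) / pi"
    using s by (simp add: s'_def diff_divide_distrib power2_eq_square)
  also have "\<dots> = ln (s / (2 * pi)) / 2"
    using s by (subst arctan_int_reciprocal) auto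
  finally have "etaF s = pi\<^sup>2 / (6 * s) + ln (s / (2 * pi)) / 2 - pi\<^sup>2 / (6 * s') + etaF s'" by simp
  also have "pi\<^sup>2 / (6 * s') = s / 24" using s by (simp add: s'_def)
  finally show ?thesis by (simp add: s'_def)
qed

section \<open>The transformation law in the right half-plane\<close>

definition pgf :: "complex \<Rightarrow> complex" where
  "pgf q = (\<Sum>n. of_nat (npart n) * q ^ n)"

lemma pgf_sums: "norm q < 1 \<Longrightarrow> (\<lambda>n. of_nat (npart n) * q ^ n) sums pgf q"
  unfolding pgf_def using npart_sums[of q] by (simp add: sums_iff)

lemma npart_sums_exp:
  assumes "s > 0"
  shows "(\<lambda>n. real (npart n) * exp (-s) ^ n) sums exp (etaF s)"
  using npart_sums[of "exp (-s)"] inverse_qpoch_exp[OF assms] assms by simp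

lemma pgf_exp_of_real:
  assumes "s > 0"
  shows "pgf (exp (- of_real s)) = of_real (exp (etaF s))"
proof -
  have "(\<lambda>n. complex_of_real (real (npart n) * exp (-s) ^ n)) sums of_real (exp (etaF s))"
    using npart_sums_exp[OF assms] by (rule sums_of_real)
  moreover have "complex_of_real (real (npart n) * exp (-s) ^ n) = of_nat (npart n) * exp (- of_real s) ^ n" for n
    by (simp flip: exp_of_real of_real_minus)
  ultimately have "(\<lambda>n. of_nat (npart n) * exp (- of_real s) ^ n) sums complex_of_real (exp (etaF s))"
    by (simp only:)
  then show ?thesis unfolding pgf_def by (rule sums_unique[symmetric])
qed

lemma norm_exp_minus_less_1: "Re s > 0 \<Longrightarrow> norm (exp (-s)) < 1"
  by simp

text \<open>The coefficients are nonnegative, so the series without its constant term 1 is dominated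
  by its value at the real point exp (- Re u).\<close>

lemma norm_pgf_minus_1_le:
  assumes "Re u > 0"
  shows "norm (pgf (exp (-u)) - 1) \<le> exp (etaF (Re u)) - 1"
proof -
  have p0: "npart 0 = 1"
  proof -
    have "partitions_of 0 = {{#}}"
      unfolding partitions_of_def by (auto, metis less_irrefl multiset_nonemptyE)
    then show ?thesis by (simp add: npart_def)
  qed
  have 1: "(\<lambda>n. of_nat (npart (Suc n)) * exp (-u) ^ Suc n) sums (pgf (exp (-u)) - 1)"
    using sums_split_initial_segment[OF pgf_sums[OF norm_exp_minus_less_1[OF assms]], of 1] by (simp add: p0)
  have 2: "(\<lambda>n. real (npart (Suc n)) * exp (-Re u) ^ Suc n) sums (exp (etaF (Re u)) - 1)"
    using sums_split_initial_segment[OF npart_sums_exp[OF assms], of 1] by (simp add: p0)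
  have eq: "norm (of_nat (npart (Suc n)) * exp (-u) ^ Suc n) = real (npart (Suc n)) * exp (-Re u) ^ Suc n" for n
    by (simp add: norm_mult norm_power)
  have "norm (\<Sum>n. of_nat (npart (Suc n)) * exp (-u) ^ Suc n) \<le> (\<Sum>n. norm (of_nat (npart (Suc n)) * exp (-u) ^ Suc n))"
    by (rule summable_norm) (unfold eq, rule sums_summable[OF 2])
  then show ?thesis unfolding eq using 1 2 by (simp add: sums_iff)
qed

lemma pgf_holomorphic: "(\<lambda>s. pgf (exp (-s))) holomorphic_on {s. Re s > 0}"
proof -
  have "pgf holomorphic_on ball 0 1"
    by (rule power_series_holomorphic[of _ _ "\<lambda>n. of_nat (npart n)"]) (use pgf_sums in simp)
  then have "pgf \<circ> (\<lambda>s. exp (-s)) holomorphic_on {s. Re s > 0}"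
    by (rule holomorphic_on_compose_gen[rotated]) (auto intro!: holomorphic_intros)
  then show ?thesis by (simp add: o_def)
qed

lemma not_nonpos_Reals: "Re s > 0 \<Longrightarrow> s \<notin> \<real>\<^sub>\<le>\<^sub>0"
  by (auto simp: complex_nonpos_Reals_iff)

text \<open>Both sides are holomorphic for Re s > 0, the principal square root included, and agree
  on the positive real axis by the real law; analytic continuation does the rest.\<close>

theorem pgf_transform:
  assumes "Re s > 0"
  shows "pgf (exp (-s)) = csqrt (s / (2 * of_real pi)) * exp (of_real (pi\<^sup>2) / (6 * s) - s / 24)
           * pgf (exp (- (of_real (4 * pi\<^sup>2) / s)))"
proof -
  define H where "H = {s. Re s > 0}"
  define f where "f s = pgf (exp (-s)) - csqrt (s / (2 * of_real pi)) * exp (of_real (pi\<^sup>2) / (6 * s) - s / 24)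
           * pgf (exp (- (of_real (4 * pi\<^sup>2) / s)))" for s
  have inv: "Re (of_real c / s) > 0" if "c > 0" "Re s > 0" for c s
  proof -
    have "s \<noteq> 0" using that by auto
    then have "Re s * Re s + Im s * Im s > 0" by (metis complex_neq_0 power2_eq_square)
    then show ?thesis using that by (simp add: Re_divide power2_eq_square)
  qed
  have "(\<lambda>s. pgf (exp (-s))) \<circ> (\<lambda>s. of_real (4 * pi\<^sup>2) / s) holomorphic_on H"
  proof (rule holomorphic_on_compose_gen[OF _ pgf_holomorphic])
    show "(\<lambda>s. of_real (4 * pi\<^sup>2) / s) holomorphic_on H"
      by (intro holomorphic_intros) (auto simp: H_def)
    show "(\<lambda>s. of_real (4 * pi\<^sup>2) / s) ` H \<subseteq> {s. Re s > 0}"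
      using inv[of "4 * pi\<^sup>2"] by (auto simp: H_def simp del: of_real_mult of_real_power)
  qed
  then have 1: "(\<lambda>s. pgf (exp (- (of_real (4 * pi\<^sup>2) / s)))) holomorphic_on H" by (simp add: o_def)
  have hol: "f holomorphic_on H"
    unfolding f_def
  proof (intro holomorphic_intros 1)
    show "(\<lambda>s. pgf (exp (-s))) holomorphic_on H" unfolding H_def by (rule pgf_holomorphic)
    show "s / (2 * of_real pi) \<notin> \<real>\<^sub>\<le>\<^sub>0" if "s \<in> H" for s
      using that by (intro not_nonpos_Reals) (simp add: H_def Re_divide)
    show "2 * complex_of_real pi \<noteq> 0" by simp
  qed (auto simp: H_def)
  have real0: "f z = 0" if z: "z \<in> of_real ` {0<..}" for z
  proof -
    obtain x where x: "x > 0" "z = of_real x" using z by auto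
    have e: "exp (etaF x) = exp (pi\<^sup>2 / (6 * x) - x / 24) * sqrt (x / (2 * pi)) * exp (etaF (4 * pi\<^sup>2 / x))"
    proof -
      have "exp (ln (x / (2 * pi)) / 2) = sqrt (x / (2 * pi))"
        using x by (subst ln_sqrt[symmetric]) auto
      then show ?thesis
        by (subst etaF_transform[OF x(1)]) (simp add: exp_add exp_diff)
    qed
    have p: "pgf (exp (- (of_real (4 * pi\<^sup>2) / of_real x))) = of_real (exp (etaF (4 * pi\<^sup>2 / x)))"
      using pgf_exp_of_real[of "4 * pi\<^sup>2 / x"] x by simp
    have c: "csqrt (of_real x / (2 * of_real pi)) = of_real (sqrt (x / (2 * pi)))"
      using csqrt_of_real[of "x / (2 * pi)"] x by simp
    have ex: "exp (of_real (pi\<^sup>2) / (6 * of_real x) - of_real x / 24) = complex_of_real (exp (pi\<^sup>2 / (6 * x) - x / 24))"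
      by (simp add: exp_of_real[symmetric])
    show ?thesis
      unfolding x(2) f_def p c ex pgf_exp_of_real[OF x(1)] e by (simp add: mult_ac)
  qed
  have "f s = 0"
  proof (rule analytic_continuation[OF hol])
    show "open H" unfolding H_def by (rule open_halfspace_Re_gt)
    show "connected H" unfolding H_def by (intro convex_connected convex_halfspace_Re_gt)
    show "complex_of_real ` {0<..} \<subseteq> H" by (auto simp: H_def)
    show "1 \<in> H" by (simp add: H_def)
    show "1 islimpt complex_of_real ` {0<..}"
    proof (rule connected_imp_perfect)
      show "connected (complex_of_real ` {0<..})"
        by (intro connected_continuous_image continuous_intros convex_connected) auto
      show "1 \<in> complex_of_real ` {0<..}" by (intro image_eqI[of _ _ 1]) auto
      have "1 \<in> complex_of_real ` {0<..}" "2 \<in> complex_of_real ` {0<..}"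
        by (intro image_eqI[of _ _ 1]; simp) (intro image_eqI[of _ _ 2]; simp)
      moreover have "(1::complex) \<noteq> 2" by simp
      ultimately show "complex_of_real ` {0<..} \<noteq> {x}" for x by (metis singletonD)
    qed
    show "s \<in> H" using assms by (simp add: H_def)
  qed (use real0 in auto)
  then show ?thesis by (simp add: f_def)
qed

section \<open>Contour integrals\<close>

lemma closed_segment_same_Re:
  assumes "x \<in> closed_segment (Complex c u) (Complex c v)" "u \<le> v"
  shows "Re x = c" "u \<le> Im x" "Im x \<le> v"
proof -
  obtain r where r: "0 \<le> r" "r \<le> 1" "x = (1 - r) *\<^sub>R Complex c u + r *\<^sub>R Complex c v"
    using assms(1) by (auto simp: closed_segment_def)
  show "Re x = c" unfolding r(3) by (simp add: algebra_simps)
  have "Im x = u + r * (v - u)" unfolding r(3) by (simp add: algebra_simps)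
  moreover have "0 \<le> r * (v - u)" "r * (v - u) \<le> 1 * (v - u)"
    using r assms(2) mult_right_mono[of r 1 "v - u"] by auto
  ultimately show "u \<le> Im x" "Im x \<le> v" by auto
qed

text \<open>Cauchy's coefficient formula in the coordinate q = exp (-s), in which the circle of
  radius exp (-t) becomes a segment of length 2\<pi>. The series is integrated termwise: for k
  \<noteq> n the primitive takes equal values at both ends.\<close>

theorem coeff_has_contour_integral:
  fixes c :: "nat \<Rightarrow> complex"
  assumes f: "\<And>q. norm q < 1 \<Longrightarrow> (\<lambda>k. c k * q ^ k) sums f q" and t: "t > 0"
  shows "((\<lambda>s. f (exp (-s)) * exp (of_nat n * s)) has_contour_integral (2 * of_real pi * \<i> * c n))
           (linepath (Complex t (-pi)) (Complex t pi))"
proof -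
  let ?g = "linepath (Complex t (-pi)) (Complex t pi)"
  define h where "h k s = c k * exp (-s) ^ k * exp (of_nat n * s)" for k s
  have hk: "(h k has_contour_integral (if k = n then 2 * of_real pi * \<i> * c n else 0)) ?g" for k
  proof -
    define m :: complex where "m = of_nat n - of_nat k"
    have h: "h k s = c k * exp (m * s)" for s
      unfolding h_def m_def by (simp add: exp_of_nat_mult[symmetric] exp_add[symmetric] algebra_simps mult.assoc)
    have d: "Complex t pi - Complex t (- pi) = 2 * of_real pi * \<i>" by (simp add: complex_eq_iff)
    show ?thesis
    proof (cases "k = n")
      case True
      have "h k = (\<lambda>s. c k * exp (m * s))" by (rule ext) (rule h)
      with True have "h k = (\<lambda>_. c n)" by (simp add: m_def)
      then show ?thesis
        using True has_contour_integral_const_linepath[of "c n" "Complex t pi" "Complex t (- pi)", unfolded d]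
        by (simp add: mult_ac)
    next
      case False
      then have m: "m \<noteq> 0" by (simp add: m_def)
      have "((\<lambda>s. c k * exp (m * s)) has_contour_integral 
          (c k * exp (m * pathfinish ?g) / m - c k * exp (m * pathstart ?g) / m)) ?g"
        by (rule contour_integral_primitive[of UNIV]) (use m in \<open>auto intro!: derivative_eq_intros\<close>)
      moreover have "exp (m * Complex t pi) = exp (m * Complex t (-pi))"
      proof -
        have "m * Complex t pi = m * Complex t (-pi) + complex_of_real (real_of_int (2 * (int n - int k)) * pi) * \<i>"
          using d by (simp add: m_def algebra_simps)
        then show ?thesis by (subst exp_eq) (rule exI)
      qed
      ultimately show ?thesis using False by (simp add: h[abs_def])
    qed
  qed
  have sumk: "((\<lambda>s. \<Sum>k<N. h k s) has_contour_integral (\<Sum>k<N. if k = n then 2 * of_real pi * \<i> * c n else 0)) ?g" for N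
    by (intro has_contour_integral_sum hk) auto
  have seg: "Re s = t" if "s \<in> path_image ?g" for s
    using that closed_segment_same_Re[of s t "-pi" pi] by simp
  have ul: "uniform_limit (path_image ?g) (\<lambda>N s. \<Sum>k<N. h k s) (\<lambda>s. \<Sum>k. h k s) sequentially"
  proof (rule Weierstrass_m_test)
    \<comment> \<open>Convergence at the larger radius exp (-t/2) gives absolute convergence at exp
      (-t), and with it a summable majorant on the segment.\<close>
    have "summable (\<lambda>k. c k * complex_of_real (exp (- t / 2)) ^ k)"
      using f[of "of_real (exp (- t / 2))"] t by (simp add: sums_iff)
    then have "summable (\<lambda>k. norm (c k * complex_of_real (exp (- t)) ^ k))"
      by (rule powser_insidea) (use t in simp)
    then show "summable (\<lambda>k. norm (c k * complex_of_real (exp (- t)) ^ k) * exp (real n * t))"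
      by (rule summable_mult2)
    show "norm (h k s) \<le> norm (c k * complex_of_real (exp (- t)) ^ k) * exp (real n * t)" if "s \<in> path_image ?g" for k s
      using seg[OF that] by (simp add: h_def norm_mult norm_power)
  qed
  have lim: "(\<Sum>k. h k s) = f (exp (-s)) * exp (of_nat n * s)" if "s \<in> path_image ?g" for s
  proof -
    have "(\<lambda>k. h k s) sums (f (exp (-s)) * exp (of_nat n * s))"
      unfolding h_def using seg[OF that] t by (intro sums_mult2 f) simp
    then show ?thesis by (simp add: sums_iff)
  qed
  have ul': "uniform_limit (path_image ?g) (\<lambda>N s. \<Sum>k<N. h k s) (\<lambda>s. f (exp (-s)) * exp (of_nat n * s)) sequentially"
    using ul by (rule uniform_limit_cong'[THEN iffD1, rotated 2]) (use lim in auto)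
  have B: "norm (vector_derivative ?g (at x)) \<le> norm (Complex t pi - Complex t (- pi))" for x
    by simp
  have "eventually (\<lambda>N. (\<lambda>s. \<Sum>k<N. h k s) contour_integrable_on ?g) sequentially"
    unfolding contour_integrable_on_def by (intro always_eventually allI exI) (rule sumk)
  note * = contour_integral_uniform_limit[OF this ul' B valid_path_linepath sequentially_bot]
  have int: "(\<lambda>s. f (exp (-s)) * exp (of_nat n * s)) contour_integrable_on ?g"
    by (rule *(1))
  have "(\<lambda>N. contour_integral ?g (\<lambda>s. \<Sum>k<N. h k s)) \<longlonglongrightarrow> contour_integral ?g (\<lambda>s. f (exp (-s)) * exp (of_nat n * s))"
    by (rule *(2))
  moreover have "contour_integral ?g (\<lambda>s. \<Sum>k<N. h k s) = (\<Sum>k<N. if k = n then 2 * of_real pi * \<i> * c n else 0)" for N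
    using sumk by (rule contour_integral_unique)
  moreover have "(\<lambda>N. \<Sum>k<N. if k = n then 2 * of_real pi * \<i> * c n else 0) \<longlonglongrightarrow> 2 * of_real pi * \<i> * c n"
    using sums_single[of n "\<lambda>_. 2 * of_real pi * \<i> * c n"] by (simp add: sums_def)
  ultimately have "contour_integral ?g (\<lambda>s. f (exp (-s)) * exp (of_nat n * s)) = 2 * of_real pi * \<i> * c n"
    using LIMSEQ_unique by simp
  then show ?thesis using has_contour_integral_integral[OF int] by simp
qed

section \<open>The imaginary error function\<close>

lemma erfi_exists: "\<exists>E :: complex \<Rightarrow> complex. (\<forall>y. (E has_field_derivative exp (y\<^sup>2)) (at y)) \<and> E 0 = 0"
proof -
  have "(\<lambda>y::complex. exp (y\<^sup>2)) holomorphic_on UNIV" by (intro holomorphic_intros)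
  then obtain g where g: "\<And>y::complex. y \<in> UNIV \<Longrightarrow> (g has_field_derivative exp (y\<^sup>2)) (at y)"
    by (rule holomorphic_convex_primitive'[OF convex_UNIV open_UNIV]) (rule that)
  have "((\<lambda>y. g y - g 0) has_field_derivative exp (y\<^sup>2)) (at y)" for y
    using DERIV_diff[OF g[OF UNIV_I, of y] DERIV_const[of "g 0"]] by simp
  then show ?thesis by (intro exI[of _ "\<lambda>y. g y - g 0"]) auto
qed

text \<open>The usual imaginary error function is \<open>2 / sqrt \<pi>\<close> times this one.\<close>

definition erfi :: "complex \<Rightarrow> complex" where
  "erfi = (SOME E. (\<forall>y. (E has_field_derivative exp (y\<^sup>2)) (at y)) \<and> E 0 = 0)"

lemma erfi_deriv: "(erfi has_field_derivative exp (y\<^sup>2)) (at y)"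
  and erfi_0 [simp]: "erfi 0 = 0"
  using someI_ex[OF erfi_exists] unfolding erfi_def by auto

lemma erfi_minus: "erfi (-y) = - erfi y"
proof -
  have "((\<lambda>y. erfi y + erfi (-y)) has_field_derivative 0) (at y within UNIV)" for y
  proof -
    have "((\<lambda>y. erfi (-y)) has_field_derivative (exp ((-y)\<^sup>2) * (-1))) (at y)"
      by (rule DERIV_chain2[OF erfi_deriv]) (auto intro!: derivative_eq_intros)
    from DERIV_add[OF erfi_deriv this] show ?thesis by simp
  qed
  then obtain c where "\<And>y. erfi y + erfi (-y) = c"
    using has_field_derivative_zero_constant[of UNIV "\<lambda>y. erfi y + erfi (-y)"] by auto
  from this[of 0] this[of y] show ?thesis by (simp add: add_eq_0_iff2)
qed

lemma gaussian_has_integral: "((\<lambda>x::real. exp (- x\<^sup>2)) has_integral (sqrt pi / 2)) {0..}"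
proof -
  have "((\<lambda>x::real. indicator {0..} x *\<^sub>R exp (- x\<^sup>2)) has_integral (sqrt pi / 2)) UNIV"
    using gaussian_moment_0 has_integral_integral_lborel by (metis has_bochner_integral_iff)
  moreover have "(\<lambda>x::real. indicator {0..} x *\<^sub>R exp (- x\<^sup>2)) = (\<lambda>x. if x \<in> {0..} then exp (- x\<^sup>2) else 0)"
    by (auto simp: indicator_def)
  ultimately show ?thesis using has_integral_restrict_UNIV[of "{0..}" "\<lambda>x::real. exp (- x\<^sup>2)"] by simp
qed

lemma gaussian_integrable: "(\<lambda>x::real. exp (- x\<^sup>2)) integrable_on {a..b}"
  by (intro integrable_continuous_interval continuous_intros)

text \<open>For x \<ge> b \<ge> 0 one has x^2 \<ge> b^2 + (x - b)^2, so the tail is at most exp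
  (-b^2) times the half-line Gaussian integral. Unlike the asymptotic bound with 1/b, this remains
  usable down to b = 0.\<close>

lemma gaussian_tail:
  assumes "0 \<le> b"
  shows "integral {b..B} (\<lambda>x::real. exp (- x\<^sup>2)) \<le> exp (- b\<^sup>2) * (sqrt pi / 2)"
proof -
  have "integral {b..B} (\<lambda>x::real. exp (- x\<^sup>2)) \<le> integral {b..B} (\<lambda>x. exp (- b\<^sup>2) * exp (- (x - b)\<^sup>2))"
  proof (rule integral_le)
    show "(\<lambda>x. exp (- b\<^sup>2) * exp (- (x - b)\<^sup>2)) integrable_on {b..B}"
      by (intro integrable_continuous_interval continuous_intros)
    fix x assume x: "x \<in> {b..B}"
    have "0 \<le> 2 * (b * (x - b))" using x assms by (intro mult_nonneg_nonneg) auto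
    then have "- x\<^sup>2 \<le> - b\<^sup>2 + - (x - b)\<^sup>2" by (simp add: power2_eq_square algebra_simps)
    then show "exp (- x\<^sup>2) \<le> exp (- b\<^sup>2) * exp (- (x - b)\<^sup>2)" by (simp flip: exp_add)
  qed (rule gaussian_integrable)
  also have "\<dots> = exp (- b\<^sup>2) * integral {b..B} (\<lambda>x. exp (- (x - b)\<^sup>2))" by simp
  also have "integral {b..B} (\<lambda>x. exp (- (x - b)\<^sup>2)) = integral {b - b..B - b} (\<lambda>x. exp (- x\<^sup>2))"
  proof -
    have "((\<lambda>x::real. exp (- x\<^sup>2)) has_integral integral {b - b..B - b} (\<lambda>x. exp (- x\<^sup>2))) {b + -b..B + -b}"
      using integrable_integral[OF gaussian_integrable, of "b - b" "B - b"] by simp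
    then have "((\<lambda>x. exp (- (x - b)\<^sup>2)) has_integral integral {b - b..B - b} (\<lambda>x. exp (- x\<^sup>2))) {b..B}"
      unfolding has_integral_shift_Icc_real[symmetric] by (simp add: o_def)
    then show ?thesis by (rule integral_unique)
  qed
  also have "\<dots> \<le> integral {0..} (\<lambda>x. exp (- x\<^sup>2))"
    using gaussian_has_integral gaussian_integrable
    by (intro integral_subset_le) (auto simp: has_integral_iff)
  also have "integral {0..} (\<lambda>x::real. exp (- x\<^sup>2)) = sqrt pi / 2"
    using gaussian_has_integral by (rule integral_unique)
  finally show ?thesis by simp
qed

lemma gaussian_tendsto:
  "((\<lambda>B. integral {0..B} (\<lambda>x::real. exp (- x\<^sup>2))) \<longlongrightarrow> sqrt pi / 2) at_top"
proof -
  have i: "integrable lborel (\<lambda>x::real. indicator {0..} x *\<^sub>R exp (- x\<^sup>2))"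
    and v: "integral\<^sup>L lborel (\<lambda>x::real. indicator {0..} x *\<^sub>R exp (- x\<^sup>2)) = sqrt pi / 2"
    using gaussian_moment_0 by (auto simp: has_bochner_integral_iff)
  have "((\<lambda>B. \<integral>x. indicator {..B} x *\<^sub>R (indicator {0..} x *\<^sub>R exp (- x\<^sup>2)) \<partial>lborel) \<longlongrightarrow> sqrt pi / 2) at_top"
    using tendsto_integral_at_top[OF sets_lborel i] unfolding v .
  moreover have "(\<integral>x. indicator {..B} x *\<^sub>R (indicator {0..} x *\<^sub>R exp (- x\<^sup>2)) \<partial>lborel) = integral {0..B} (\<lambda>x::real. exp (- x\<^sup>2))" for B
  proof -
    have "set_integrable lborel {0..B} (\<lambda>x::real. exp (- x\<^sup>2))"
      by (intro borel_integrable_atLeastAtMost' continuous_intros)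
    from set_borel_integral_eq_integral(2)[OF this]
    have "(\<integral>x. indicator {0..B} x *\<^sub>R exp (- x\<^sup>2) \<partial>lborel) = integral {0..B} (\<lambda>x::real. exp (- x\<^sup>2))"
      by (simp add: set_lebesgue_integral_def)
    moreover have "indicator {..B} x *\<^sub>R (indicator {0..} x *\<^sub>R exp (- x\<^sup>2)) = indicator {0..B} x *\<^sub>R exp (- x\<^sup>2)" for x :: real
      by (auto simp: indicator_def)
    ultimately show ?thesis by (simp only:)
  qed
  ultimately show ?thesis by (simp only:)
qed

lemma erfi_vertical:
  assumes "b \<le> B"
  shows "((\<lambda>x. exp ((Complex a x)\<^sup>2)) has_integral (- \<i> * (erfi (Complex a B) - erfi (Complex a b)))) {b..B}"
proof (cases "b = B")
  case False
  have "((\<lambda>y. exp (y\<^sup>2)) has_contour_integral (erfi (pathfinish (linepath (Complex a b) (Complex a B))) 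
           - erfi (pathstart (linepath (Complex a b) (Complex a B))))) (linepath (Complex a b) (Complex a B))"
    by (rule contour_integral_primitive[of UNIV]) (auto intro: erfi_deriv)
  then show ?thesis
    using False assms by (subst (asm) has_contour_integral_linepath_same_Re_iff[of _ a _ b B]) auto
qed auto

lemma norm_exp_square: "norm (exp ((Complex a x)\<^sup>2)) = exp (a\<^sup>2) * exp (- x\<^sup>2)"
  by (simp add: power2_eq_square flip: exp_add)

text \<open>On the imaginary axis this is the Gaussian integral. Moving horizontally to real part a
  changes the value by at most |a| exp (a^2 - B^2), which tends to 0.\<close>

lemma erfi_tendsto_imag: "((\<lambda>B. erfi (Complex a B)) \<longlongrightarrow> \<i> * of_real (sqrt pi / 2)) at_top"
proof -
  have "((\<lambda>B. \<i> * of_real (integral {0..B} (\<lambda>x::real. exp (- x\<^sup>2)))) \<longlongrightarrow> \<i> * of_real (sqrt pi / 2)) at_top"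
    by (intro tendsto_intros gaussian_tendsto)
  moreover have "eventually (\<lambda>B. \<i> * of_real (integral {0..B} (\<lambda>x::real. exp (- x\<^sup>2))) = erfi (Complex 0 B)) at_top"
    using eventually_ge_at_top[of 0]
  proof eventually_elim
    case (elim B)
    have "exp ((Complex 0 x)\<^sup>2) = complex_of_real (exp (- x\<^sup>2))" for x
      by (simp add: Complex_eq power_mult_distrib exp_of_real[symmetric])
    then have "((\<lambda>x. complex_of_real (exp (- x\<^sup>2))) has_integral (- \<i> * (erfi (Complex 0 B) - erfi (Complex 0 0)))) {0..B}"
      using erfi_vertical[OF elim, of 0] by simp
    moreover have "((\<lambda>x. complex_of_real (exp (- x\<^sup>2))) has_integral of_real (integral {0..B} (\<lambda>x::real. exp (- x\<^sup>2)))) {0..B}"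
      using gaussian_integrable by (intro has_integral_of_real) (simp add: integrable_integral)
    ultimately have "- \<i> * (erfi (Complex 0 B) - erfi (Complex 0 0)) = of_real (integral {0..B} (\<lambda>x::real. exp (- x\<^sup>2)))"
      by (rule has_integral_unique)
    moreover have "erfi (Complex 0 0) = 0" using erfi_0 by (simp add: Complex_eq)
    ultimately show ?case by (metis diff_zero i_squared minus_mult_minus mult.assoc mult.left_neutral mult_minus1 power2_eq_square)
  qed
  ultimately have l0: "((\<lambda>B. erfi (Complex 0 B)) \<longlongrightarrow> \<i> * of_real (sqrt pi / 2)) at_top"
    by (rule Lim_transform_eventually)
  have bnd: "norm (erfi (Complex a B) - erfi (Complex 0 B)) \<le> exp (a\<^sup>2) * \<bar>a\<bar> * exp (- B\<^sup>2)" for B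
  proof -
    let ?g = "linepath (Complex 0 B) (Complex a B)"
    have "((\<lambda>y. exp (y\<^sup>2)) has_contour_integral (erfi (pathfinish ?g) - erfi (pathstart ?g))) ?g"
      by (rule contour_integral_primitive[of UNIV]) (auto intro: erfi_deriv)
    then have "norm (erfi (pathfinish ?g) - erfi (pathstart ?g)) \<le> (exp (a\<^sup>2) * exp (- B\<^sup>2)) * norm (Complex a B - Complex 0 B)"
    proof (rule has_contour_integral_bound_linepath)
      fix x assume "x \<in> closed_segment (Complex 0 B) (Complex a B)"
      then obtain r where r: "0 \<le> r" "r \<le> 1" "x = (1 - r) *\<^sub>R Complex 0 B + r *\<^sub>R Complex a B"
        by (auto simp: closed_segment_def)
      have x: "x = Complex (r * a) B" unfolding r(3) by (simp add: complex_eq_iff algebra_simps)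
      have "r\<^sup>2 * a\<^sup>2 \<le> 1 * a\<^sup>2" using r by (intro mult_right_mono) (auto simp: power_le_one)
      then show "norm (exp (x\<^sup>2)) \<le> exp (a\<^sup>2) * exp (- B\<^sup>2)"
        unfolding x norm_exp_square by (simp add: power_mult_distrib)
    qed auto
    moreover have "norm (Complex a B - Complex 0 B) = \<bar>a\<bar>" by (simp add: cmod_def)
    ultimately show ?thesis by (simp add: mult_ac)
  qed
  have "((\<lambda>B::real. exp (a\<^sup>2) * \<bar>a\<bar> * exp (- B\<^sup>2)) \<longlongrightarrow> 0) at_top"
    by real_asymp
  then have "((\<lambda>B. erfi (Complex a B) - erfi (Complex 0 B)) \<longlongrightarrow> 0) at_top"
    by (rule Lim_null_comparison[rotated]) (use bnd in auto)
  from tendsto_add[OF this l0] show ?thesis by simp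
qed

text \<open>Integrate exp (w^2) vertically upwards from y: its norm decays like a Gaussian, and the
  limit is i sqrt \<pi>/2. So \<open>erfi\<close> in the upper half-plane is a constant up to an
  error of the size of its own derivative.\<close>

theorem erfi_upper:
  assumes "Im y \<ge> 0"
  shows "norm (erfi y - \<i> * of_real (sqrt pi / 2)) \<le> sqrt pi / 2 * norm (exp (y\<^sup>2))"
proof -
  obtain a b where y: "y = Complex a b" by (cases y)
  have b: "b \<ge> 0" using assms y by simp
  have "((\<lambda>B. norm (erfi y - erfi (Complex a B))) \<longlongrightarrow> norm (erfi y - \<i> * of_real (sqrt pi / 2))) at_top"
    by (intro tendsto_intros erfi_tendsto_imag)
  moreover have "eventually (\<lambda>B. norm (erfi y - erfi (Complex a B)) \<le> sqrt pi / 2 * norm (exp (y\<^sup>2))) at_top"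
    using eventually_ge_at_top[of b]
  proof eventually_elim
    case (elim B)
    have "norm (erfi y - erfi (Complex a B)) = norm (- \<i> * (erfi (Complex a B) - erfi (Complex a b)))"
      by (simp add: y norm_mult norm_minus_commute)
    also have "\<dots> = norm (integral {b..B} (\<lambda>x. exp ((Complex a x)\<^sup>2)))"
      using erfi_vertical[OF elim, of a] by (metis integral_unique)
    also have "\<dots> \<le> integral {b..B} (\<lambda>x. exp (a\<^sup>2) * exp (- x\<^sup>2))"
    proof (rule integral_norm_bound_integral)
      show "(\<lambda>x. exp ((Complex a x)\<^sup>2)) integrable_on {b..B}" using erfi_vertical[OF elim, of a] by blast
      show "(\<lambda>x. exp (a\<^sup>2) * exp (- x\<^sup>2)) integrable_on {b..B}"
        by (intro integrable_continuous_interval continuous_intros)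
    qed (simp only: norm_exp_square order_refl)
    also have "\<dots> = exp (a\<^sup>2) * integral {b..B} (\<lambda>x. exp (- x\<^sup>2))" by simp
    also have "\<dots> \<le> exp (a\<^sup>2) * (exp (- b\<^sup>2) * (sqrt pi / 2))" by (intro mult_left_mono gaussian_tail b) auto
    also have "\<dots> = sqrt pi / 2 * norm (exp (y\<^sup>2))" by (simp only: y norm_exp_square mult_ac)
    finally show ?case .
  qed
  ultimately show ?thesis by (rule tendsto_upperbound) auto
qed

lemma erfi_lower:
  assumes "Im y \<le> 0"
  shows "norm (erfi y + \<i> * of_real (sqrt pi / 2)) \<le> sqrt pi / 2 * norm (exp (y\<^sup>2))"
proof -
  have "norm (erfi (-y) - \<i> * of_real (sqrt pi / 2)) = norm (erfi y + \<i> * of_real (sqrt pi / 2))"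
    unfolding erfi_minus by (metis minus_add_distrib norm_minus_cancel uminus_add_conv_diff add.commute)
  then show ?thesis using erfi_upper[of "-y"] assms by simp
qed

lemma erfi_half_plane:
  assumes "\<sigma> = 1 \<or> \<sigma> = -1" "\<sigma> * Im y \<ge> 0"
  shows "norm (erfi y - of_real \<sigma> * (\<i> * of_real (sqrt pi / 2))) \<le> sqrt pi / 2 * norm (exp (y\<^sup>2))"
  using assms erfi_upper[of y] erfi_lower[of y] by auto

text \<open>Substituting \<open>s = v\<^sup>2\<close> and completing the square in \<open>x v\<^sup>2 + a / v\<^sup>2\<close> reduces
  \<open>\<integral> sqrt s exp (x s + a / s) ds\<close> to Gaussian integrals in \<open>sqrt x v \<minusplus> sqrt a / v\<close>.\<close>

definition saddle_prim :: "real \<Rightarrow> real \<Rightarrow> complex \<Rightarrow> complex" where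
  "saddle_prim a x s = (csqrt s * exp (of_real x * s + of_real a / s)
     + of_real ((sqrt a - 1 / (2 * sqrt x)) * exp (2 * sqrt (a * x))) * erfi (of_real (sqrt x) * csqrt s - of_real (sqrt a) / csqrt s)
     - of_real ((sqrt a + 1 / (2 * sqrt x)) * exp (- 2 * sqrt (a * x))) * erfi (of_real (sqrt x) * csqrt s + of_real (sqrt a) / csqrt s)) / of_real x"

lemma saddle_squares:
  assumes "a > 0" "x > 0" "s \<noteq> 0" 
  shows "(of_real (sqrt x) * csqrt s - of_real (sqrt a) / csqrt s)\<^sup>2 = of_real x * s + of_real a / s - of_real (2 * sqrt (a * x))"
    and "(of_real (sqrt x) * csqrt s + of_real (sqrt a) / csqrt s)\<^sup>2 = of_real x * s + of_real a / s + of_real (2 * sqrt (a * x))"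
proof -
  define v X A where "v = csqrt s" and "X = complex_of_real (sqrt x)" and "A = complex_of_real (sqrt a)"
  have v: "v \<noteq> 0" "v\<^sup>2 = s" using assms by (auto simp: v_def)
  have X: "X\<^sup>2 = of_real x" "A\<^sup>2 = of_real a" using assms by (simp_all add: X_def A_def flip: of_real_power)
  have AX: "of_real (2 * sqrt (a * x)) = 2 * A * X" by (simp add: A_def X_def real_sqrt_mult)
  have "(X * v - A / v)\<^sup>2 = X\<^sup>2 * v\<^sup>2 + A\<^sup>2 / v\<^sup>2 - 2 * A * X"
    "(X * v + A / v)\<^sup>2 = X\<^sup>2 * v\<^sup>2 + A\<^sup>2 / v\<^sup>2 + 2 * A * X"
    using v(1) by (simp_all add: field_simps power2_eq_square)
  then show "(of_real (sqrt x) * csqrt s - of_real (sqrt a) / csqrt s)\<^sup>2 = of_real x * s + of_real a / s - of_real (2 * sqrt (a * x))"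
    "(of_real (sqrt x) * csqrt s + of_real (sqrt a) / csqrt s)\<^sup>2 = of_real x * s + of_real a / s + of_real (2 * sqrt (a * x))"
    unfolding AX v(2) X by (simp_all only: v_def X_def A_def)
qed

lemma saddle_prim_deriv:
  assumes a: "a > 0" and x: "x > 0" and s: "Re s > 0"
  shows "(saddle_prim a x has_field_derivative csqrt s * exp (of_real x * s + of_real a / s)) (at s)"
proof -
  define v X A where "v = csqrt s" and "X = complex_of_real (sqrt x)" and "A = complex_of_real (sqrt a)"
  define e where "e = exp (of_real x * s + of_real a / s)"
  have s0: "s \<noteq> 0" using s by auto
  have v: "v \<noteq> 0" "v\<^sup>2 = s" using s0 by (auto simp: v_def)
  have X: "X\<^sup>2 = of_real x" "A\<^sup>2 = of_real a" "X \<noteq> 0" using a x by (simp_all add: X_def A_def flip: of_real_power)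
  have dv: "(csqrt has_field_derivative (1 / (2 * v))) (at s)"
    using has_field_derivative_csqrt[OF not_nonpos_Reals[OF s]] by (simp add: v_def inverse_eq_divide)
  have de: "((\<lambda>s. exp (of_real x * s + of_real a / s)) has_field_derivative (e * (of_real x - of_real a / s\<^sup>2))) (at s)"
    using s0 by (auto intro!: derivative_eq_intros simp: e_def power2_eq_square)
  have dq: "((\<lambda>s. of_real (sqrt a) / csqrt s) has_field_derivative (- A / v\<^sup>2 * (1 / (2 * v)))) (at s)"
    using DERIV_divide[OF DERIV_const dv, of "A"] v(1) by (simp add: A_def v_def power2_eq_square mult_ac)
  have dp: "((\<lambda>s. of_real (sqrt x) * csqrt s) has_field_derivative (X * (1 / (2 * v)))) (at s)"
    using DERIV_cmult[OF dv, of X] by (simp add: X_def)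
  have d1: "((\<lambda>s. erfi (of_real (sqrt x) * csqrt s - of_real (sqrt a) / csqrt s)) has_field_derivative
      (exp (of_real x * s + of_real a / s - of_real (2 * sqrt (a * x))) * (X * (1 / (2 * v)) - - A / v\<^sup>2 * (1 / (2 * v))))) (at s)"
    using DERIV_chain2[OF erfi_deriv DERIV_diff[OF dp dq]] by (simp only: saddle_squares[OF a x s0])
  have d2: "((\<lambda>s. erfi (of_real (sqrt x) * csqrt s + of_real (sqrt a) / csqrt s)) has_field_derivative
      (exp (of_real x * s + of_real a / s + of_real (2 * sqrt (a * x))) * (X * (1 / (2 * v)) + - A / v\<^sup>2 * (1 / (2 * v))))) (at s)"
    using DERIV_chain2[OF erfi_deriv DERIV_add[OF dp dq]] by (simp only: saddle_squares[OF a x s0])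
  have e1: "complex_of_real (exp (2 * sqrt (a * x))) * exp (of_real x * s + of_real a / s - of_real (2 * sqrt (a * x))) = e"
    unfolding exp_of_real[symmetric] exp_add[symmetric] e_def by (simp add: algebra_simps)
  have e2: "complex_of_real (exp (- 2 * sqrt (a * x))) * exp (of_real x * s + of_real a / s + of_real (2 * sqrt (a * x))) = e"
    unfolding exp_of_real[symmetric] exp_add[symmetric] e_def by (simp add: algebra_simps)
  let ?D = "(((1 / (2 * v)) * e + e * (of_real x - of_real a / s\<^sup>2) * v)
     + of_real ((sqrt a - 1 / (2 * sqrt x)) * exp (2 * sqrt (a * x))) * (exp (of_real x * s + of_real a / s - of_real (2 * sqrt (a * x))) * (X * (1 / (2 * v)) - - A / v\<^sup>2 * (1 / (2 * v))))
     - of_real ((sqrt a + 1 / (2 * sqrt x)) * exp (- 2 * sqrt (a * x))) * (exp (of_real x * s + of_real a / s + of_real (2 * sqrt (a * x))) * (X * (1 / (2 * v)) + - A / v\<^sup>2 * (1 / (2 * v))))) / of_real x"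
  have D: "(saddle_prim a x has_field_derivative ?D) (at s)"
    unfolding saddle_prim_def[abs_def]
    by (intro DERIV_cdivide DERIV_diff DERIV_add DERIV_cmult d1 d2) (use DERIV_mult[OF dv de] in \<open>simp add: e_def v_def\<close>)
  have "?D = e * (((1 / (2 * v)) + (X\<^sup>2 - A\<^sup>2 / (v\<^sup>2)\<^sup>2) * v) + (A - 1 / (2 * X)) * (X * (1 / (2 * v)) - - A / v\<^sup>2 * (1 / (2 * v)))
      - (A + 1 / (2 * X)) * (X * (1 / (2 * v)) + - A / v\<^sup>2 * (1 / (2 * v)))) / X\<^sup>2"
  proof -
    have 1: "complex_of_real ((sqrt a - 1 / (2 * sqrt x)) * exp (2 * sqrt (a * x))) * (exp (of_real x * s + of_real a / s - of_real (2 * sqrt (a * x))) * Y)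
        = (A - 1 / (2 * X)) * (e * Y)" for Y
      unfolding e1[symmetric] by (simp add: A_def X_def)
    have 2: "complex_of_real ((sqrt a + 1 / (2 * sqrt x)) * exp (- 2 * sqrt (a * x))) * (exp (of_real x * s + of_real a / s + of_real (2 * sqrt (a * x))) * Y)
        = (A + 1 / (2 * X)) * (e * Y)" for Y
      unfolding e2[symmetric] by (simp add: A_def X_def)
    have "(p * e + e * r * v + C * (e * Y) - D * (e * Z)) / w = e * (p + r * v + C * Y - D * Z) / w" for p r C D Y Z w
      by (simp add: algebra_simps)
    then show ?thesis unfolding 1 2 X v(2) .
  qed
  also have "\<dots> = e * v"
    using v(1) X(3) by (simp add: divide_simps) (simp add: algebra_simps power2_eq_square power4_eq_xxxx)
  finally show ?thesis using D by (simp add: e_def v_def mult.commute)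
qed

lemma Re_csqrt_pos:
  assumes "Re s > 0"
  shows "Re (csqrt s) > 0"
proof -
  have "Re (csqrt s) \<noteq> 0"
  proof
    assume "Re (csqrt s) = 0"
    then have "Re ((csqrt s)\<^sup>2) = - (Im (csqrt s))\<^sup>2"
      by (simp only: power2_eq_square times_complex.simps mult_zero_left diff_0)
    also have "\<dots> \<le> 0" by (simp only: neg_le_0_iff_le zero_le_power2)
    finally show False using assms unfolding power2_csqrt by simp
  qed
  then show ?thesis using Re_csqrt[of s] by simp
qed

text \<open>The hypothesis |s| \<ge> sqrt (a/x) makes the imaginary parts of both sqrt x v - sqrt
  a/v and sqrt x v + sqrt a/v, where v = csqrt s, agree in sign with Im s; so both
  \<open>erfi\<close> values are governed by the same constant. With the factor exp (2 sqrt (a x))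
  this constant is the main term; with exp (-2 sqrt (a x)) it goes into the error.\<close>

lemma saddle_prim_bound:
  assumes a: "a > 0" and x: "x > 0" and s: "Re s > 0" "norm s \<ge> sqrt (a / x)"
    and \<sigma>: "\<sigma> = 1 \<or> \<sigma> = -1" "\<sigma> * Im s \<ge> 0"
  defines "b \<equiv> norm (exp (of_real x * s + of_real a / s))"
  shows "norm (saddle_prim a x s - of_real \<sigma> * (\<i> * of_real (sqrt pi / 2 * (sqrt a - 1 / (2 * sqrt x)) * exp (2 * sqrt (a * x)) / x))) \<le>
     (sqrt (norm s) * b + \<bar>sqrt a - 1 / (2 * sqrt x)\<bar> * (sqrt pi / 2 * b) 
       + (sqrt a + 1 / (2 * sqrt x)) * (sqrt pi / 2 * (exp (- 2 * sqrt (a * x)) + b))) / x"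
proof -
  define v where "v = csqrt s"
  define y1 y2 where "y1 = of_real (sqrt x) * v - of_real (sqrt a) / v" and "y2 = of_real (sqrt x) * v + of_real (sqrt a) / v"
  define m where "m = 2 * sqrt (a * x)"
  define c where "c = sqrt pi / 2"
  have s0: "s \<noteq> 0" using s by auto
  have v: "v \<noteq> 0" "v\<^sup>2 = s" using s0 by (auto simp: v_def)
  have nv: "norm v ^ 2 = norm s" using v by (metis norm_power)
  have Rv: "Re v > 0" unfolding v_def by (rule Re_csqrt_pos[OF s(1)])
  have "Im s = 2 * Re v * Im v" using v(2) by (auto simp: power2_eq_square)
  then have "Re v * (2 * (\<sigma> * Im v)) \<ge> 0" using \<sigma>(2) by (simp add: mult_ac)
  then have Iv: "\<sigma> * Im v \<ge> 0" using Rv by (simp add: zero_le_mult_iff)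
  have inv: "Im (of_real r / v) = - (r * Im v) / norm s" for r
    unfolding nv[symmetric] by (simp add: Im_divide cmod_power2)
  have ns: "norm s > 0" using s0 by simp
  have "\<sigma> * Im y1 = (\<sigma> * Im v) * (sqrt x + sqrt a / norm s)" unfolding y1_def by (simp add: inv algebra_simps)
  moreover have "sqrt x + sqrt a / norm s \<ge> 0" using a x by simp
  ultimately have I1: "\<sigma> * Im y1 \<ge> 0" using Iv by (simp only: mult_nonneg_nonneg)
  have "sqrt a / norm s \<le> sqrt x"
  proof -
    have "sqrt x * sqrt (a / x) \<le> sqrt x * norm s" using s x by (intro mult_left_mono) auto
    moreover have "sqrt x * sqrt (a / x) = sqrt a" using x by (simp flip: real_sqrt_mult)
    ultimately show ?thesis using ns by (simp add: divide_le_eq)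
  qed
  then have "sqrt x - sqrt a / norm s \<ge> 0" by simp
  moreover have "\<sigma> * Im y2 = (\<sigma> * Im v) * (sqrt x - sqrt a / norm s)" unfolding y2_def by (simp add: inv algebra_simps)
  ultimately have I2: "\<sigma> * Im y2 \<ge> 0" using Iv by (simp only: mult_nonneg_nonneg)
  have E1: "norm (exp (y1\<^sup>2)) = b * exp (- m)"
    unfolding y1_def v_def saddle_squares[OF a x s0] b_def m_def by (simp add: exp_diff norm_divide exp_minus field_simps norm_mult)
  have E2: "norm (exp (y2\<^sup>2)) = b * exp m"
    unfolding y2_def v_def saddle_squares[OF a x s0] b_def m_def by (simp add: exp_add norm_mult)
  define P Q where "P = sqrt a - 1 / (2 * sqrt x)" and "Q = sqrt a + 1 / (2 * sqrt x)"
  have Q: "Q \<ge> 0" using a x by (simp add: Q_def)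
  define w where "w = of_real \<sigma> * (\<i> * complex_of_real c)"
  have nw: "norm w = c" using \<sigma>(1) by (auto simp: w_def norm_mult c_def)
  have b1: "norm (erfi y1 - w) \<le> c * (b * exp (- m))"
    using erfi_half_plane[OF \<sigma>(1) I1] unfolding E1 by (simp add: w_def c_def)
  have "norm (erfi y2) \<le> norm (erfi y2 - w) + norm w" by (metis diff_add_cancel norm_triangle_ineq)
  also have "\<dots> \<le> c * (b * exp m) + c"
    using erfi_half_plane[OF \<sigma>(1) I2] unfolding E2 nw by (simp add: w_def c_def)
  finally have b2: "norm (erfi y2) \<le> c * (b * exp m) + c" .
  have "saddle_prim a x s - of_real \<sigma> * (\<i> * of_real (sqrt pi / 2 * (sqrt a - 1 / (2 * sqrt x)) * exp (2 * sqrt (a * x)) / x)) =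
     (v * exp (of_real x * s + of_real a / s) + of_real (P * exp m) * (erfi y1 - w) - of_real (Q * exp (- m)) * erfi y2) / of_real x"
    unfolding saddle_prim_def y1_def y2_def v_def w_def P_def Q_def m_def c_def using x by (simp add: field_simps)
  then have "norm (saddle_prim a x s - of_real \<sigma> * (\<i> * of_real (sqrt pi / 2 * (sqrt a - 1 / (2 * sqrt x)) * exp (2 * sqrt (a * x)) / x))) =
     norm (v * exp (of_real x * s + of_real a / s) + of_real (P * exp m) * (erfi y1 - w) - of_real (Q * exp (- m)) * erfi y2) / x"
    using x by (simp only: norm_divide norm_of_real abs_of_pos)
  also have "\<dots> \<le> (norm v * b + (\<bar>P\<bar> * exp m) * (c * (b * exp (- m))) + (Q * exp (- m)) * (c * (b * exp m) + c)) / x"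
  proof (rule divide_right_mono)
    have "norm (v * exp (of_real x * s + of_real a / s) + of_real (P * exp m) * (erfi y1 - w) - of_real (Q * exp (- m)) * erfi y2) \<le>
      norm (v * exp (of_real x * s + of_real a / s)) + norm (of_real (P * exp m) * (erfi y1 - w)) + norm (of_real (Q * exp (- m)) * erfi y2)"
      by (rule order.trans[OF norm_triangle_ineq4]) (intro add_right_mono norm_triangle_ineq)
    also have "\<dots> = norm v * b + (\<bar>P\<bar> * exp m) * norm (erfi y1 - w) + (Q * exp (- m)) * norm (erfi y2)"
      using Q by (simp only: norm_mult norm_of_real b_def abs_mult abs_exp_cancel abs_of_nonneg)
    also have "\<dots> \<le> norm v * b + (\<bar>P\<bar> * exp m) * (c * (b * exp (- m))) + (Q * exp (- m)) * (c * (b * exp m) + c)"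
      using Q by (intro add_mono mult_left_mono b1 b2) auto
    finally show "norm (v * exp (of_real x * s + of_real a / s) + of_real (P * exp m) * (erfi y1 - w) - of_real (Q * exp (- m)) * erfi y2) \<le>
      norm v * b + (\<bar>P\<bar> * exp m) * (c * (b * exp (- m))) + (Q * exp (- m)) * (c * (b * exp m) + c)" .
  qed (use x in auto)
  also have "(\<bar>P\<bar> * exp m) * (c * (b * exp (- m))) = \<bar>P\<bar> * (c * b)" by (simp add: exp_minus)
  also have "(Q * exp (- m)) * (c * (b * exp m) + c) = Q * (c * (exp (- m) + b))" by (simp add: exp_minus field_simps)
  also have "norm v = sqrt (norm s)" by (simp add: v_def)
  finally show ?thesis by (simp add: P_def Q_def c_def m_def)
qed

section \<open>Explicit estimates\<close>

text \<open>The threshold 6 lies below 2\<pi>, the fixed point of s \<mapsto> 4\<pi>^2/s, so s or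
  its image always exceeds it. From exp (-u) \<le> 1/400 the denominator costs (400/399)^2 <
  1.006.\<close>

lemma etaF_small:
  assumes "u \<ge> 6"
  shows "etaF u \<le> 1.006 * exp (-u)" "exp (-u) \<le> 1 / 400"
proof -
  have "exp 1 \<ge> (2.718 :: real)" using e_approx_32 by (simp add: abs_if split: if_splits)
  then have "exp 1 ^ 6 \<ge> (2.718 ^ 6 :: real)" by (intro power_mono) auto
  moreover have "exp 1 ^ 6 = exp (6 :: real)" by (simp flip: exp_of_nat_mult)
  moreover have "(2.718 ^ 6 :: real) \<ge> 400" by (simp add: power_numeral_reduce)
  ultimately have "exp (6 :: real) \<ge> 400" by linarith
  moreover have "exp u \<ge> exp 6" using assms by simp
  ultimately have "exp u \<ge> 400" by linarith
  then show r: "exp (-u) \<le> 1 / 400" by (simp add: exp_minus divide_simps)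
  have "(399 / 400) ^ 2 \<le> (1 - exp (-u))\<^sup>2" using r by (intro power_mono) auto
  then have "1 / 1.006 \<le> (1 - exp (-u))\<^sup>2" by (simp add: power2_eq_square)
  then have "exp (-u) / (1 - exp (-u))\<^sup>2 \<le> exp (-u) / (1 / 1.006)"
    by (intro divide_left_mono) (auto intro!: mult_pos_pos less_le_trans[of 0 "1 / 1.006"])
  also have "\<dots> = 1.006 * exp (-u)" by simp
  finally show "etaF u \<le> 1.006 * exp (-u)"
    using etaF_le[of u] assms by linarith
qed

lemma exp_etaF_small:
  assumes "u \<ge> 6"
  shows "exp (etaF u) \<le> 1.003" "exp (etaF u) - 1 \<le> 2 * exp (-u)"
proof -
  define y where "y = etaF u"
  have y: "0 \<le> y" "y \<le> 1.006 * exp (-u)" "exp (-u) \<le> 1 / 400"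
    using etaF_small[OF assms] etaF_nonneg[of u] assms by (auto simp: y_def)
  have y1: "y \<le> 0.003" using y by simp
  have "exp y \<le> 1 + y + y\<^sup>2" using y y1 by (intro exp_bound) auto
  moreover have "y\<^sup>2 \<le> 0.003 * y" unfolding power2_eq_square using y y1 by (intro mult_right_mono) auto
  ultimately have e: "exp y - 1 \<le> 1.003 * y" by simp
  show "exp (etaF u) \<le> 1.003" using e y unfolding y_def[symmetric] by simp
  show "exp (etaF u) - 1 \<le> 2 * exp (-u)" using e y unfolding y_def[symmetric] by simp
qed

text \<open>For \<rho> \<ge> 2\<pi> the factor exp (etaF \<rho>) - 1 is of size exp (-\<rho>) and
  gives at most 1. Below 2\<pi> the real transformation law is applied: exp (\<rho>/24) cancels
  against its elementary factor, and the dual argument is at least 6.\<close>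

lemma eta_remainder_le:
  assumes "\<rho> > 0"
  shows "exp (\<rho> / 24) * (exp (etaF \<rho>) - 1) \<le> 1 + 1.003 * (sqrt (\<rho> / (2 * pi)) * exp (pi\<^sup>2 / (6 * \<rho>)))"
proof (cases "\<rho> \<ge> 2 * pi")
  case True
  then have r6: "\<rho> \<ge> 6" using pi_gt3 by linarith
  have "exp (\<rho> / 24) * (exp (etaF \<rho>) - 1) \<le> exp (\<rho> / 24) * (2 * exp (- \<rho>))"
    by (intro mult_left_mono exp_etaF_small r6) auto
  also have "\<dots> = 2 * exp (- (23 / 24 * \<rho>))" by (simp flip: exp_add)
  also have "exp (- (23 / 24 * \<rho>)) \<le> exp (- 1)" using r6 by simp
  also have "2 * exp (- 1 :: real) \<le> 1"
    using exp_ge_add_one_self[of "1::real"] by (simp add: exp_minus divide_simps)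
  finally have "exp (\<rho> / 24) * (exp (etaF \<rho>) - 1) \<le> 1" by simp
  moreover have "0 \<le> 1.003 * (sqrt (\<rho> / (2 * pi)) * exp (pi\<^sup>2 / (6 * \<rho>)))" using assms by simp
  ultimately show ?thesis by linarith
next
  case False
  have "6 \<le> 4 * pi\<^sup>2 / \<rho>"
  proof -
    have "6 * \<rho> \<le> 6 * (2 * pi)" using False by simp
    also have "\<dots> \<le> 4 * pi\<^sup>2" using pi_gt3 by (simp add: power2_eq_square)
    finally show ?thesis using assms by (simp add: le_divide_eq)
  qed
  then have 1: "exp (etaF (4 * pi\<^sup>2 / \<rho>)) \<le> 1.003" by (rule exp_etaF_small)
  have "exp (ln (\<rho> / (2 * pi)) / 2) = sqrt (\<rho> / (2 * pi))"
    using assms by (subst ln_sqrt[symmetric]) auto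
  then have "exp (\<rho> / 24) * exp (etaF \<rho>) = sqrt (\<rho> / (2 * pi)) * exp (pi\<^sup>2 / (6 * \<rho>)) * exp (etaF (4 * pi\<^sup>2 / \<rho>))"
    by (subst etaF_transform[OF assms]) (simp add: exp_add exp_diff)
  also have "\<dots> \<le> sqrt (\<rho> / (2 * pi)) * exp (pi\<^sup>2 / (6 * \<rho>)) * 1.003"
    using assms by (intro mult_left_mono 1) auto
  finally have "exp (\<rho> / 24) * exp (etaF \<rho>) \<le> 1.003 * (sqrt (\<rho> / (2 * pi)) * exp (pi\<^sup>2 / (6 * \<rho>)))" by simp
  moreover have "exp (\<rho> / 24) * (exp (etaF \<rho>) - 1) \<le> exp (\<rho> / 24) * exp (etaF \<rho>)"
    by (intro mult_left_mono) auto
  ultimately show ?thesis by linarith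
qed

lemma csqrt_divide_real:
  assumes "c > 0" "Re s > 0"
  shows "csqrt (s / of_real c) = csqrt s / of_real (sqrt c)"
proof (rule csqrt_unique)
  show "(csqrt s / of_real (sqrt c))\<^sup>2 = s / of_real c"
    using assms by (simp add: power_divide flip: of_real_power)
  have "Re (csqrt s) > 0" using assms(2) by (rule Re_csqrt_pos)
  then show "0 < Re (csqrt s / of_real (sqrt c)) \<or> Re (csqrt s / of_real (sqrt c)) = 0 \<and> 0 \<le> Im (csqrt s / of_real (sqrt c))"
    using assms by (simp add: Re_divide_of_real)
qed

text \<open>The factor exp (-s/24) of the law is absorbed into exp (n s), which replaces n by n -
  1/24 and gives the exponent the shape x s + a/s of \<open>saddle_prim\<close>.\<close>

lemma pgf_transform':
  assumes s: "Re s > 0"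
  shows "of_real (sqrt (2 * pi)) * (pgf (exp (-s)) * exp (of_nat n * s)) =
     csqrt s * exp (of_real (real n - 1 / 24) * s + of_real (pi\<^sup>2 / 6) / s) * pgf (exp (- (of_real (4 * pi\<^sup>2) / s)))"
proof -
  have "csqrt (s / (2 * of_real pi)) = csqrt s / of_real (sqrt (2 * pi))"
    using csqrt_divide_real[of "2 * pi" s] s by simp
  moreover have "exp (of_real (real n - 1 / 24) * s + of_real (pi\<^sup>2 / 6) / s) = exp (of_real (pi\<^sup>2) / (6 * s) - s / 24) * exp (of_nat n * s)"
    unfolding exp_add[symmetric] by (simp add: algebra_simps)
  ultimately show ?thesis
    unfolding pgf_transform[OF s] by simp
qed

text \<open>Here \<open>t\<close> is the saddle point of \<open>x s + a / s\<close>.\<close>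

context
  fixes \<mu> x t a :: real
  assumes mu: "\<mu> \<ge> 88"
    and t_def: "t = pi\<^sup>2 / (3 * \<mu>)" and x_def: "x = 3 * \<mu>\<^sup>2 / (2 * pi\<^sup>2)" and a_def: "a = pi\<^sup>2 / 6"
begin

lemma saddle_params:
  shows "t > 0" "x > 0" "a > 0" "x * t = \<mu> / 2" "a / t = \<mu> / 2" "2 * sqrt (a * x) = \<mu>" "sqrt (a / x) = t"
    "1 / (2 * sqrt x) = sqrt a / \<mu>" "t \<le> 0.0374" "x \<ge> 1000"
proof -
  show pos: "t > 0" "x > 0" "a > 0" using mu by (auto simp: t_def x_def a_def)
  show "x * t = \<mu> / 2" "a / t = \<mu> / 2" using mu by (simp_all add: t_def x_def a_def field_simps power2_eq_square)
  have ax: "a * x = (\<mu> / 2)\<^sup>2" by (simp add: x_def a_def power_divide)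
  then show s: "2 * sqrt (a * x) = \<mu>" using mu by (simp only: real_sqrt_unique)
  have "a / x = t\<^sup>2" using mu by (simp add: t_def x_def a_def field_simps power2_eq_square)
  then show "sqrt (a / x) = t" using pos by simp
  have "sqrt a * sqrt x = \<mu> / 2" using s by (simp add: real_sqrt_mult)
  then show "1 / (2 * sqrt x) = sqrt a / \<mu>" using pos mu by (simp add: field_simps)
  have p2: "pi\<^sup>2 \<le> 9.87"
  proof -
    have "pi\<^sup>2 \<le> 3.1416\<^sup>2" using pi_approx by (intro power_mono) auto
    then show ?thesis by (simp add: power2_eq_square)
  qed
  have "t \<le> 9.87 / (3 * 88)" unfolding t_def using p2 mu by (intro frac_le) auto
  then show "t \<le> 0.0374" by simp
  have "88\<^sup>2 \<le> \<mu>\<^sup>2" using mu by (intro power_mono) auto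
  then have "3 * 88\<^sup>2 / (2 * 9.87) \<le> x" unfolding x_def using p2 by (intro frac_le) auto
  then show "x \<ge> 1000" by simp
qed

lemma Re_saddle:
  assumes "Re s = t"
  shows "norm (exp (of_real x * s + of_real a / s)) = exp (\<mu> / 2) * exp (a * t / (norm s)\<^sup>2)"
    and "Re (of_real (4 * pi\<^sup>2) / s) = 4 * pi\<^sup>2 * t / (norm s)\<^sup>2"
proof -
  have d: "Re (of_real c / s) = c * t / (norm s)\<^sup>2" for c
    unfolding cmod_power2 using assms by (simp add: Re_divide)
  show "Re (of_real (4 * pi\<^sup>2) / s) = 4 * pi\<^sup>2 * t / (norm s)\<^sup>2" by (rule d)
  have "Re (of_real x * s) = \<mu> / 2" using assms saddle_params(4) by simp
  then show "norm (exp (of_real x * s + of_real a / s)) = exp (\<mu> / 2) * exp (a * t / (norm s)\<^sup>2)"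
    unfolding norm_exp_eq_Re plus_complex.simps d by (simp only: exp_add)
qed

text \<open>Let \<rho> be the real part of the dual argument 4\<pi>^2/s. As a t/|s|^2 = \<rho>/24,
  the elementary exponential supplies exactly the factor exp (\<rho>/24) of
  \<open>eta_remainder_le\<close>. The exponent \<pi>^2/(6\<rho>) arising there is |s|^2/(24 t) =
  t/24 + (\<mu>/8)(Im s/\<pi>)^2: it grows to about \<mu>/8 at the ends of the segment, while sqrt
  (t/|s|) becomes small.\<close>

lemma norm_remainder_le:
  assumes s: "Re s = t" "\<bar>Im s\<bar> \<le> pi"
  shows "norm (csqrt s * exp (of_real x * s + of_real a / s) * (pgf (exp (- (of_real (4 * pi\<^sup>2) / s))) - 1)) \<le>
    sqrt (2 * pi) * exp (\<mu> / 2) * (1 + 1.005 * (sqrt (t / norm s) * exp (\<mu> / 8 * ((Im s)\<^sup>2 / pi\<^sup>2))))"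
proof -
  note p = saddle_params
  define N where "N = norm s"
  have N: "N > 0" "N \<ge> t" using s p(1) complex_Re_le_cmod[of s] by (auto simp: N_def)
  have N2: "N\<^sup>2 = t\<^sup>2 + (Im s)\<^sup>2" using s by (simp add: N_def cmod_power2)
  define \<rho> where "\<rho> = 4 * pi\<^sup>2 * t / N\<^sup>2"
  have \<rho>: "\<rho> > 0" using N p(1) by (simp add: \<rho>_def)
  have Re\<rho>: "Re (of_real (4 * pi\<^sup>2) / s) = \<rho>" using Re_saddle(2)[OF s(1)] by (simp add: \<rho>_def N_def)
  have "N \<le> \<bar>Re s\<bar> + \<bar>Im s\<bar>" unfolding N_def by (rule cmod_le)
  then have N4: "N \<le> 2 * pi" using s p(1,9) pi_gt3 by simp
  have "norm (csqrt s * exp (of_real x * s + of_real a / s) * (pgf (exp (- (of_real (4 * pi\<^sup>2) / s))) - 1)) \<le>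
     sqrt N * (exp (\<mu> / 2) * exp (\<rho> / 24)) * (exp (etaF \<rho>) - 1)"
  proof -
    have "a * t / N\<^sup>2 = \<rho> / 24" by (simp add: \<rho>_def a_def)
    then have "norm (exp (of_real x * s + of_real a / s)) = exp (\<mu> / 2) * exp (\<rho> / 24)"
      using Re_saddle(1)[OF s(1)] by (simp add: N_def)
    moreover have "norm (pgf (exp (- (of_real (4 * pi\<^sup>2) / s))) - 1) \<le> exp (etaF \<rho>) - 1"
      using norm_pgf_minus_1_le[of "of_real (4 * pi\<^sup>2) / s"] \<rho> unfolding Re\<rho> by blast
    ultimately show ?thesis unfolding norm_mult norm_csqrt N_def[symmetric] using N by (simp add: mult_left_mono)
  qed
  also have "\<dots> = exp (\<mu> / 2) * (sqrt N * (exp (\<rho> / 24) * (exp (etaF \<rho>) - 1)))" by (simp only: mult_ac)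
  also have "\<dots> \<le> exp (\<mu> / 2) * (sqrt N * (1 + 1.003 * (sqrt (\<rho> / (2 * pi)) * exp (pi\<^sup>2 / (6 * \<rho>)))))"
    using N by (intro mult_left_mono eta_remainder_le \<rho>) auto
  also have "\<dots> = exp (\<mu> / 2) * (sqrt N + 1.003 * ((sqrt N * sqrt (\<rho> / (2 * pi))) * exp (pi\<^sup>2 / (6 * \<rho>))))"
    by (simp add: algebra_simps)
  also have "sqrt N * sqrt (\<rho> / (2 * pi)) = sqrt (2 * pi) * sqrt (t / N)"
  proof -
    have "N * (\<rho> / (2 * pi)) = 2 * pi * (t / N)"
      using N by (simp add: \<rho>_def power2_eq_square field_simps)
    then show ?thesis by (simp only: real_sqrt_mult[symmetric])
  qed
  also have "pi\<^sup>2 / (6 * \<rho>) = t / 24 + \<mu> / 8 * ((Im s)\<^sup>2 / pi\<^sup>2)"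
  proof -
    have "pi\<^sup>2 / (6 * \<rho>) = N\<^sup>2 / (24 * t)" using N p(1) by (simp add: \<rho>_def field_simps)
    also have "\<dots> = t / 24 + (Im s)\<^sup>2 / (24 * t)" unfolding N2 using p(1) by (simp add: field_simps power2_eq_square)
    also have "(Im s)\<^sup>2 / (24 * t) = \<mu> / 8 * ((Im s)\<^sup>2 / pi\<^sup>2)" using mu by (simp add: t_def field_simps)
    finally show ?thesis .
  qed
  also have "exp (\<mu> / 2) * (sqrt N + 1.003 * (sqrt (2 * pi) * sqrt (t / N) * exp (t / 24 + \<mu> / 8 * ((Im s)\<^sup>2 / pi\<^sup>2)))) \<le>
     exp (\<mu> / 2) * (sqrt (2 * pi) + 1.005 * (sqrt (2 * pi) * sqrt (t / N) * exp (\<mu> / 8 * ((Im s)\<^sup>2 / pi\<^sup>2))))"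
  proof (intro mult_left_mono add_mono)
    show "sqrt N \<le> sqrt (2 * pi)" using N4 by simp
    define A where "A = sqrt (2 * pi) * sqrt (t / N) * exp (\<mu> / 8 * ((Im s)\<^sup>2 / pi\<^sup>2))"
    have A: "A \<ge> 0" using N p(1) by (simp add: A_def)
    \<comment> \<open>As t \<le> 0.0374, the factor exp (t/24) is paid for by raising 1.003 to
      1.005.\<close>
    have "exp (t / 24) \<le> 1 + t / 24 + (t / 24)\<^sup>2" using p(1,9) by (intro exp_bound) auto
    moreover have "(t / 24)\<^sup>2 \<le> 0.01 * (t / 24)" unfolding power2_eq_square using p(1,9) by (intro mult_right_mono) auto
    ultimately have "1.003 * exp (t / 24) \<le> 1.005" using p(9) by simp
    then have "(1.003 * exp (t / 24)) * A \<le> 1.005 * A" using A by (rule mult_right_mono)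
    then show "1.003 * (sqrt (2 * pi) * sqrt (t / N) * exp (t / 24 + \<mu> / 8 * ((Im s)\<^sup>2 / pi\<^sup>2))) \<le>
      1.005 * (sqrt (2 * pi) * sqrt (t / N) * exp (\<mu> / 8 * ((Im s)\<^sup>2 / pi\<^sup>2)))"
      by (simp add: A_def exp_add mult_ac)
  qed auto
  also have "\<dots> = sqrt (2 * pi) * exp (\<mu> / 2) * (1 + 1.005 * (sqrt (t / N) * exp (\<mu> / 8 * ((Im s)\<^sup>2 / pi\<^sup>2))))"
    by (simp add: algebra_simps)
  finally show ?thesis by (simp only: N_def)
qed

text \<open>The two ends contribute opposite constants, which add up to \<open>W\<close>. At the
  ends |s| \<ge> 3, so the integrand has barely more than its minimal size exp (\<mu>/2), and the
  denominator x \<ge> 1000 makes the error small.\<close>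

lemma saddle_integral_bound:
  defines "W \<equiv> \<i> * complex_of_real (sqrt pi * (sqrt a - sqrt a / \<mu>) * exp \<mu> / x)"
  shows "norm (saddle_prim a x (Complex t pi) - saddle_prim a x (Complex t (-pi)) - W) \<le> sqrt (2 * pi) * exp (\<mu> / 2)"
proof -
  note p = saddle_params
  define P where "P = sqrt a - sqrt a / \<mu>"
  define E where "E = exp (\<mu> / 2)"
  have E1: "E \<ge> 1" using mu by (simp add: E_def)
  define V where "V = complex_of_real (sqrt pi / 2 * P * exp \<mu> / x)"
  have half: "norm (saddle_prim a x s - of_real \<sigma> * (\<i> * V)) \<le> E / 2"
    if s: "Re s = t" "Im s = \<sigma> * pi" and \<sigma>: "\<sigma> = 1 \<or> \<sigma> = -1" for s \<sigma>
  proof -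
    define b where "b = norm (exp (of_real x * s + of_real a / s))"
    have Is: "\<bar>Im s\<bar> = pi" using s \<sigma> by auto
    have N: "norm s \<ge> 3" using abs_Im_le_cmod[of s] Is pi_gt3 by linarith
    have "norm s \<le> \<bar>Re s\<bar> + \<bar>Im s\<bar>" by (rule cmod_le)
    then have N4: "norm s \<le> 4" unfolding Is using s p(1,9) pi_approx by simp
    have "sqrt (norm s) \<le> sqrt (2\<^sup>2)" using N4 by (intro real_sqrt_le_mono) simp
    then have N2: "sqrt (norm s) \<le> 2" by simp
    have a2: "a \<le> 4"
    proof -
      have "pi * pi \<le> 4 * 4" using pi_less_4 by (intro mult_mono) auto
      then show ?thesis by (simp add: a_def power2_eq_square)
    qed
    have "a * t / (norm s)\<^sup>2 \<le> 4 * 0.0374 / 3\<^sup>2"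
      using N p(1,3,9) a2 by (intro frac_le mult_mono power_mono) auto
    also have "\<dots> \<le> 1 / 2" by (simp add: power2_eq_square)
    finally have "exp (a * t / (norm s)\<^sup>2) \<le> exp (1 / 2)" by (simp only: exp_le_cancel_iff)
    also have "exp (1 / 2 :: real) \<le> 1 + 1 / 2 + (1 / 2)\<^sup>2" by (intro exp_bound) auto
    also have "\<dots> \<le> 2" by (simp add: power2_eq_square)
    finally have "b \<le> E * 2"
      unfolding b_def Re_saddle(1)[OF s(1)] E_def by (intro mult_left_mono) auto
    have b0: "b \<ge> 0" by (simp add: b_def)
    have sa: "sqrt a \<le> 2" using real_sqrt_le_mono[OF a2] by simp
    have sp: "sqrt pi / 2 \<le> 1" using real_sqrt_le_mono[of pi 4] pi_less_4 by simp
    have sm: "0 \<le> sqrt a / \<mu>" "sqrt a / \<mu> \<le> 1" using sa p(3) mu by (auto simp: divide_le_eq)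
    have "0 \<le> sqrt a" using p(3) by simp
    then have Pa: "\<bar>P\<bar> \<le> 2" unfolding P_def using sa sm by linarith
    have "norm (saddle_prim a x s - of_real \<sigma> * (\<i> * V)) \<le>
      (sqrt (norm s) * b + \<bar>P\<bar> * (sqrt pi / 2 * b) + (sqrt a + sqrt a / \<mu>) * (sqrt pi / 2 * (exp (- \<mu>) + b))) / x"
      using saddle_prim_bound[of a x s \<sigma>] p s N pi_gt3 \<sigma>
      unfolding p(6,7,8) mult_minus_left minus_mult_left[symmetric] b_def V_def P_def by auto
    also have "\<dots> \<le> (2 * (E * 2) + 2 * (1 * (E * 2)) + (2 + 1) * (1 * (E + E * 2))) / 1000"
    proof (intro frac_le add_mono mult_mono)
      show "exp (- \<mu>) \<le> E" using E1 mu by (intro order.trans[OF _ E1]) auto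
    qed (use N2 Pa sp sa sm b0 \<open>b \<le> E * 2\<close> p E1 in auto)
    also have "\<dots> \<le> E / 2" using E1 by simp
    finally show ?thesis .
  qed
  have "norm (saddle_prim a x (Complex t pi) - of_real 1 * (\<i> * V)) \<le> E / 2"
    by (rule half) auto
  moreover have "norm (saddle_prim a x (Complex t (-pi)) - of_real (-1) * (\<i> * V)) \<le> E / 2"
    by (rule half) auto
  ultimately have "norm ((saddle_prim a x (Complex t pi) - of_real 1 * (\<i> * V)) - (saddle_prim a x (Complex t (-pi)) - of_real (-1) * (\<i> * V))) \<le> E / 2 + E / 2"
    by (rule norm_triangle_le_diff[OF add_mono])
  moreover have "(saddle_prim a x (Complex t pi) - of_real 1 * (\<i> * V)) - (saddle_prim a x (Complex t (-pi)) - of_real (-1) * (\<i> * V)) =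
     saddle_prim a x (Complex t pi) - saddle_prim a x (Complex t (-pi)) - W"
    by (simp add: V_def W_def P_def)
  ultimately have "norm (saddle_prim a x (Complex t pi) - saddle_prim a x (Complex t (-pi)) - W) \<le> E / 2 + E / 2"
    by (simp only:)
  also have "E / 2 + E / 2 \<le> sqrt (2 * pi) * E"
  proof -
    have "1 \<le> sqrt (2 * pi)" using pi_gt3 by simp
    then have "1 * E \<le> sqrt (2 * pi) * E" using E1 by (intro mult_right_mono) auto
    then show ?thesis by simp
  qed
  finally show ?thesis unfolding E_def .
qed

text \<open>The integrand scaled by sqrt (2\<pi>) is \<open>f\<close> + \<open>k\<close>:
  \<open>f\<close> is elementary and integrated exactly by \<open>saddle_prim\<close>, while
  \<open>k\<close> carries the factor P - 1 and is bounded in norm piece by piece. Division by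
  2\<pi> turns the lengths of the pieces into fractions of the segment.\<close>

lemma npart_estimate:
  assumes n: "real n - 1 / 24 = x"
  shows "\<bar>real (npart n) - sqrt a * (1 - 1 / \<mu>) * exp \<mu> / (2 * sqrt 2 * pi * x)\<bar>
     \<le> exp (\<mu> / 2) * (2 + 0.0318 * exp (\<mu> / 8) + 0.76 * exp (9 * \<mu> / 128))"
proof -
  note p = saddle_params
  define E where "E = exp (\<mu> / 2)"
  define Z where "Z y = Complex t y" for y
  define W where "W = \<i> * complex_of_real (sqrt pi * (sqrt a - sqrt a / \<mu>) * exp \<mu> / x)"
  \<comment> \<open>At |Im s| = 3\<pi>/4 the exponent (\<mu>/8)(Im s/\<pi>)^2 equals 9\<mu>/128.
    Beyond this point t/|s| \<le> 4\<pi>/(9\<mu>) < 0.126^2, a saving needed in front of exp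
    (5\<mu>/8); before it the trivial t/|s| \<le> 1 is affordable.\<close>
  define c where "c = 3 * pi / 4"
  have c: "0 < c" "c < pi" by (auto simp: c_def)
  define f where "f s = csqrt s * exp (of_real x * s + of_real a / s)" for s
  define k where "k s = of_real (sqrt (2 * pi)) * (pgf (exp (-s)) * exp (of_nat n * s)) - f s" for s
  have seg: "Re s = t \<and> u \<le> Im s \<and> Im s \<le> v" if "s \<in> closed_segment (Z u) (Z v)" "u \<le> v" for s u v
    using closed_segment_same_Re[OF that[unfolded Z_def]] by simp
  have kb: "norm (k s) \<le> sqrt (2 * pi) * E * (1 + 1.005 * (sqrt (t / norm s) * exp (\<mu> / 8 * ((Im s)\<^sup>2 / pi\<^sup>2))))"
    if s: "Re s = t" "\<bar>Im s\<bar> \<le> pi" for s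
  proof -
    have "k s = f s * (pgf (exp (- (of_real (4 * pi\<^sup>2) / s))) - 1)"
      unfolding k_def f_def using pgf_transform'[of s n] s p(1) by (simp add: n a_def algebra_simps)
    then show ?thesis using norm_remainder_le[OF s] by (simp add: f_def E_def)
  qed
  have hk: "k holomorphic_on {s. Re s > 0}"
    unfolding k_def f_def by (intro holomorphic_intros pgf_holomorphic) (auto dest: not_nonpos_Reals)
  have cont: "continuous_on (closed_segment (Z u) (Z v)) k" if "u \<le> v" for u v
    by (rule continuous_on_subset[OF holomorphic_on_imp_continuous_on[OF hk]]) (use seg that p(1) in auto)
  have If: "(f has_contour_integral (saddle_prim a x (Z pi) - saddle_prim a x (Z (-pi)))) (linepath (Z (-pi)) (Z pi))"
  proof -
    have "(f has_contour_integral (saddle_prim a x (pathfinish (linepath (Z (-pi)) (Z pi))) - saddle_prim a x (pathstart (linepath (Z (-pi)) (Z pi))))) (linepath (Z (-pi)) (Z pi))"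
    proof (rule contour_integral_primitive[of "{s. Re s > 0}"])
      show "(saddle_prim a x has_field_derivative f s) (at s within {s. Re s > 0})" if "s \<in> {s. Re s > 0}" for s
        unfolding f_def using saddle_prim_deriv[OF p(3,2), of s] that by (auto intro: has_field_derivative_at_within)
      show "path_image (linepath (Z (-pi)) (Z pi)) \<subseteq> {s. Re s > 0}" using seg[of _ "-pi" pi] p(1) by auto
    qed auto
    then show ?thesis by simp
  qed
  have Ip: "((\<lambda>s. pgf (exp (-s)) * exp (of_nat n * s)) has_contour_integral (2 * of_real pi * \<i> * of_nat (npart n))) (linepath (Z (-pi)) (Z pi))"
    unfolding Z_def by (rule coeff_has_contour_integral[OF pgf_sums p(1)])
  have Ik: "(k has_contour_integral (of_real (sqrt (2 * pi)) * (2 * of_real pi * \<i> * of_nat (npart n)) - (saddle_prim a x (Z pi) - saddle_prim a x (Z (-pi))))) (linepath (Z (-pi)) (Z pi))"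
    unfolding k_def by (intro has_contour_integral_diff has_contour_integral_lmul Ip If)
  let ?I = "\<lambda>u v. contour_integral (linepath (Z u) (Z v)) k"
  have int: "k contour_integrable_on linepath (Z u) (Z v)" if "u \<le> v" for u v
    using cont[OF that] by (rule contour_integrable_continuous_linepath)
  have Zs: "Z v \<in> closed_segment (Z u) (Z w)" if "u \<le> v" "v \<le> w" "u < w" for u v w
  proof -
    define r where "r = (v - u) / (w - u)"
    have "r * (w - u) = v - u" using that by (simp add: r_def)
    then have "v = (1 - r) * u + r * w" by (simp add: algebra_simps)
    moreover have "0 \<le> r" "r \<le> 1" using that by (auto simp: r_def)
    ultimately show ?thesis unfolding closed_segment_def Z_def
      by (auto intro!: exI[of _ r] simp: complex_eq_iff algebra_simps)
  qed
  have split: "?I (-pi) pi = ?I (-pi) (-c) + ?I (-c) c + ?I c pi"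
  proof -
    have "?I (-pi) pi = ?I (-pi) c + ?I c pi" using c by (intro contour_integral_split_linepath cont Zs) auto
    moreover have "?I (-pi) c = ?I (-pi) (-c) + ?I (-c) c" using c by (intro contour_integral_split_linepath cont Zs) auto
    ultimately show ?thesis by simp
  qed
  have nZ: "norm (Z v - Z u) = v - u" if "u \<le> v" for u v using that by (simp add: Z_def cmod_def)
  have outer: "norm (?I u v) \<le> sqrt (2 * pi) * E * (1 + 1.005 * (0.126 * exp (\<mu> / 8))) * (v - u)"
    if uv: "u \<le> v" "-pi \<le> u" "v \<le> pi" "\<And>y. u \<le> y \<Longrightarrow> y \<le> v \<Longrightarrow> \<bar>y\<bar> \<ge> c" for u v
    unfolding nZ[OF uv(1), symmetric]
  proof (rule contour_integral_bound_linepath[OF int[OF uv(1)]])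
    show "0 \<le> sqrt (2 * pi) * E * (1 + 1.005 * (0.126 * exp (\<mu> / 8)))" by (simp add: E_def)
    fix s assume "s \<in> closed_segment (Z u) (Z v)"
    then have s: "Re s = t" "u \<le> Im s" "Im s \<le> v" using seg uv(1) by auto
    have abs: "\<bar>Im s\<bar> \<le> pi" "\<bar>Im s\<bar> \<ge> c" using s uv by auto
    have ns: "norm s \<ge> c" using abs(2) abs_Im_le_cmod[of s] by linarith
    have "t / norm s \<le> t / c" using ns c p(1) by (intro frac_le) auto
    also have "t / c = 4 * pi / (9 * \<mu>)" using mu by (simp add: t_def c_def power2_eq_square)
    also have "\<dots> \<le> 4 * 3.1416 / (9 * 88)" using mu pi_approx by (intro frac_le) auto
    also have "\<dots> \<le> 0.126\<^sup>2" by (simp add: power2_eq_square)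
    finally have "sqrt (t / norm s) \<le> sqrt (0.126\<^sup>2)" by (rule real_sqrt_le_mono)
    then have 1: "sqrt (t / norm s) \<le> 0.126" by simp
    have "(Im s)\<^sup>2 \<le> pi\<^sup>2" using abs(1) by (metis abs_le_square_iff abs_of_pos pi_gt_zero)
    then have "\<mu> / 8 * ((Im s)\<^sup>2 / pi\<^sup>2) \<le> \<mu> / 8 * 1" using mu by (intro mult_left_mono) auto
    then have 2: "exp (\<mu> / 8 * ((Im s)\<^sup>2 / pi\<^sup>2)) \<le> exp (\<mu> / 8)" by simp
    have "norm (k s) \<le> sqrt (2 * pi) * E * (1 + 1.005 * (sqrt (t / norm s) * exp (\<mu> / 8 * ((Im s)\<^sup>2 / pi\<^sup>2))))"
      by (rule kb[OF s(1) abs(1)])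
    also have "\<dots> \<le> sqrt (2 * pi) * E * (1 + 1.005 * (0.126 * exp (\<mu> / 8)))"
      using p(1) by (intro mult_left_mono add_left_mono mult_mono 1 2) (auto simp: E_def)
    finally show "norm (k s) \<le> sqrt (2 * pi) * E * (1 + 1.005 * (0.126 * exp (\<mu> / 8)))" .
  qed
  have middle: "norm (?I (-c) c) \<le> sqrt (2 * pi) * E * (1 + 1.005 * (1 * exp (9 * \<mu> / 128))) * (c - - c)"
    unfolding nZ[of "-c" c, OF less_imp_le, OF less_trans[of _ 0], OF neg_less_0_iff_less[THEN iffD2, OF c(1)] c(1), symmetric]
  proof (rule contour_integral_bound_linepath[OF int])
    show "0 \<le> sqrt (2 * pi) * E * (1 + 1.005 * (1 * exp (9 * \<mu> / 128)))" by (simp add: E_def)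
    fix s assume "s \<in> closed_segment (Z (-c)) (Z c)"
    then have s: "Re s = t" "-c \<le> Im s" "Im s \<le> c" using seg[of s "-c" c] c by auto
    have abs: "\<bar>Im s\<bar> \<le> pi" "\<bar>Im s\<bar> \<le> \<bar>c\<bar>" using s c by auto
    have ns: "norm s \<ge> t" using complex_Re_le_cmod[of s] s by simp
    then have "t / norm s \<le> 1" using p(1) by (simp add: divide_le_eq)
    then have 1: "sqrt (t / norm s) \<le> 1" by simp
    have "(Im s)\<^sup>2 \<le> c\<^sup>2" using abs(2) by (simp only: abs_le_square_iff)
    then have "(Im s)\<^sup>2 / pi\<^sup>2 \<le> c\<^sup>2 / pi\<^sup>2" by (intro divide_right_mono) auto
    also have "c\<^sup>2 / pi\<^sup>2 = 9 / 16" by (simp add: c_def power2_eq_square)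
    finally have "\<mu> / 8 * ((Im s)\<^sup>2 / pi\<^sup>2) \<le> \<mu> / 8 * (9 / 16)" using mu by (intro mult_left_mono) auto
    then have 2: "exp (\<mu> / 8 * ((Im s)\<^sup>2 / pi\<^sup>2)) \<le> exp (9 * \<mu> / 128)" by simp
    have "norm (k s) \<le> sqrt (2 * pi) * E * (1 + 1.005 * (sqrt (t / norm s) * exp (\<mu> / 8 * ((Im s)\<^sup>2 / pi\<^sup>2))))"
      by (rule kb[OF s(1) abs(1)])
    also have "\<dots> \<le> sqrt (2 * pi) * E * (1 + 1.005 * (1 * exp (9 * \<mu> / 128)))"
      using p(1) by (intro mult_left_mono add_left_mono mult_mono 1 2) (auto simp: E_def)
    finally show "norm (k s) \<le> sqrt (2 * pi) * E * (1 + 1.005 * (1 * exp (9 * \<mu> / 128)))" .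
  qed (use c in auto)
  define A B where "A = exp (\<mu> / 8)" and "B = exp (9 * \<mu> / 128)"
  have "norm (?I (-pi) pi) \<le> norm (?I (-pi) (-c)) + norm (?I (-c) c) + norm (?I c pi)"
    unfolding split by (intro order.trans[OF norm_triangle_ineq] add_right_mono norm_triangle_ineq)
  also have "\<dots> \<le> sqrt (2 * pi) * E * (1 + 1.005 * (0.126 * A)) * (-c - (-pi)) + sqrt (2 * pi) * E * (1 + 1.005 * (1 * B)) * (c - - c)
       + sqrt (2 * pi) * E * (1 + 1.005 * (0.126 * A)) * (pi - c)"
    unfolding A_def B_def using c by (intro add_mono outer middle) auto
  \<comment> \<open>The outer pieces make up 1/4 of the segment and the middle one 3/4: 1.005 *
    0.126/4 = 0.0316575 and 1.005 * 3/4 = 0.75375.\<close>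
  also have "\<dots> = sqrt (2 * pi) * (2 * pi) * (E * (1 + 0.0316575 * A + 0.75375 * B))"
    by (simp add: c_def field_simps)
  finally have K: "norm (?I (-pi) pi) \<le> sqrt (2 * pi) * (2 * pi) * (E * (1 + 0.0316575 * A + 0.75375 * B))" .
  have S: "norm (saddle_prim a x (Z pi) - saddle_prim a x (Z (-pi)) - W) \<le> sqrt (2 * pi) * E"
    using saddle_integral_bound unfolding W_def Z_def E_def .
  have "of_real (sqrt (2 * pi)) * (2 * of_real pi * \<i> * of_nat (npart n)) - W =
     ?I (-pi) pi + (saddle_prim a x (Z pi) - saddle_prim a x (Z (-pi)) - W)"
    using contour_integral_unique[OF Ik] by simp
  then have "norm (of_real (sqrt (2 * pi)) * (2 * of_real pi * \<i> * of_nat (npart n)) - W) \<le>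
     sqrt (2 * pi) * (2 * pi) * (E * (1 + 0.0316575 * A + 0.75375 * B)) + sqrt (2 * pi) * E"
    by (simp only:) (rule norm_triangle_le[OF add_mono[OF K S]])
  \<comment> \<open>The error of the elementary part is inflated by 2\<pi> so that all terms share
    one factor; this turns the constant 1 into 2.\<close>
  also have "\<dots> \<le> sqrt (2 * pi) * (2 * pi) * (E * (1 + 0.0316575 * A + 0.75375 * B)) + sqrt (2 * pi) * ((2 * pi) * E)"
    using pi_gt3 by (intro add_mono mult_left_mono) (auto simp: E_def)
  also have "\<dots> = sqrt (2 * pi) * (2 * pi) * (E * (2 + 0.0316575 * A + 0.75375 * B))"
    by (simp add: algebra_simps)
  also have "\<dots> \<le> sqrt (2 * pi) * (2 * pi) * (E * (2 + 0.0318 * A + 0.76 * B))"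
    by (intro mult_left_mono add_mono mult_right_mono) (auto simp: E_def A_def B_def)
  finally have R: "norm (of_real (sqrt (2 * pi)) * (2 * of_real pi * \<i> * of_nat (npart n)) - W) \<le>
     sqrt (2 * pi) * (2 * pi) * (E * (2 + 0.0318 * A + 0.76 * B))" .
  have sq: "sqrt (2 * pi) = sqrt 2 * sqrt pi" by (rule real_sqrt_mult)
  have "of_real (sqrt (2 * pi)) * (2 * of_real pi * \<i> * of_nat (npart n)) - W = 
     \<i> * of_real (sqrt (2 * pi) * (2 * pi) * (real (npart n) - sqrt a * (1 - 1 / \<mu>) * exp \<mu> / (2 * sqrt 2 * pi * x)))"
  proof -
    have "sqrt pi * (sqrt a - sqrt a / \<mu>) * exp \<mu> / x = sqrt (2 * pi) * (2 * pi) * (sqrt a * (1 - 1 / \<mu>) * exp \<mu> / (2 * sqrt 2 * pi * x))"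
      unfolding sq using p(2) mu by (simp add: field_simps)
    then show ?thesis unfolding W_def by (simp only:) (simp add: algebra_simps)
  qed
  then have "norm (of_real (sqrt (2 * pi)) * (2 * of_real pi * \<i> * of_nat (npart n)) - W) = 
     sqrt (2 * pi) * (2 * pi) * \<bar>real (npart n) - sqrt a * (1 - 1 / \<mu>) * exp \<mu> / (2 * sqrt 2 * pi * x)\<bar>"
    by (simp only: norm_mult norm_ii norm_of_real abs_mult mult_1_left) simp
  then have "sqrt (2 * pi) * (2 * pi) * \<bar>real (npart n) - sqrt a * (1 - 1 / \<mu>) * exp \<mu> / (2 * sqrt 2 * pi * x)\<bar> \<le>
     sqrt (2 * pi) * (2 * pi) * (E * (2 + 0.0318 * A + 0.76 * B))" using R by simp
  then show ?thesis by (subst (asm) mult_le_cancel_left_pos) (auto simp: E_def A_def B_def)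
qed

text \<open>The bound for the product grows like exp (\<pi>^2/(24 t')), with a quarter of the
  exponent of P. The optimal abscissa is therefore t/2, where the product and exp (n t') contribute
  about \<mu>/4 each to the exponent. The theta factor adds 2 (1 + t')/t', which is of order
  \<mu>.\<close>

lemma crank_diff_estimate:
  assumes n: "real n - 1 / 24 = x"
  shows "norm (crank_diff n) \<le> exp (\<mu> / 2) * (2 * \<mu>)"
proof -
  note p = saddle_params
  define t' where "t' = t / 2"
  have t': "t' > 0" "t' \<le> 0.0187" using p by (auto simp: t'_def)
  define f where "f q = qpoch q q / (qpoch (-q) q)\<^sup>2" for q :: complex
  \<comment> \<open>Removing 2 at k = 1 turns the generating function into the pure product; the
    coefficient wanted is unaffected since n \<ge> 1000.\<close>
  define c where "c k = crank_diff k - (if k = 1 then 2 else 0)" for k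
  define r where "r = exp (- t')"
  have r: "0 < r" "r < 1" using t' by (auto simp: r_def)
  have sums: "(\<lambda>k. c k * q ^ k) sums f q" if "norm q < 1" for q
  proof -
    have "(\<lambda>k. if k = 1 then 2 * q ^ k else 0) sums (2 * q)"
      using sums_single[of 1 "\<lambda>k. 2 * q ^ k"] by simp
    from sums_diff[OF crank_diff_sums[OF that] this]
    have "(\<lambda>k. crank_diff k * q ^ k - (if k = 1 then 2 * q ^ k else 0)) sums f q"
      by (simp add: f_def)
    moreover have "crank_diff k * q ^ k - (if k = 1 then 2 * q ^ k else 0) = c k * q ^ k" for k
      by (simp add: c_def algebra_simps)
    ultimately show ?thesis by (simp only:)
  qed
  have "real n \<ge> 1000" using n p(10) by simp
  then have cn: "c n = crank_diff n" by (auto simp: c_def)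
  let ?g = "linepath (Complex t' (-pi)) (Complex t' pi)"
  have I: "((\<lambda>s. f (exp (-s)) * exp (of_nat n * s)) has_contour_integral (2 * of_real pi * \<i> * crank_diff n)) ?g"
    using coeff_has_contour_integral[OF sums t'(1), of n] by (simp add: cn)
  define M where "M = exp (etaF t' + etaF (4 * t') - 2 * etaF (2 * t'))"
  have fb: "norm (f q) \<le> (1 + r) / (1 - r) * M" if q: "norm q = r" for q
  proof -
    have q1: "norm q < 1" using q r by simp
    have "f q = (qpoch q q / qpoch (-q) q) * inverse (qpoch (-q) q)"
      by (simp add: f_def power2_eq_square field_simps)
    then have "norm (f q) = norm (qpoch q q / qpoch (-q) q) * norm (inverse (qpoch (-q) q))" by (simp only: norm_mult)
    also have "\<dots> \<le> (1 + r) / (1 - r) * ((qpoch (r\<^sup>2) (r\<^sup>2))\<^sup>2 / (qpoch r r * qpoch (r^4) (r^4)))"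
      using norm_gauss_le[OF q1] norm_inverse_qpoch_minus_le[OF q1] r unfolding q by (intro mult_mono) auto
    also have "(qpoch (r\<^sup>2) (r\<^sup>2))\<^sup>2 / (qpoch r r * qpoch (r^4) (r^4)) = M"
    proof -
      have iq: "qpoch (exp (-s)) (exp (-s)) = exp (- etaF s)" if "s > 0" for s
        using inverse_qpoch_exp[OF that] by (metis exp_minus inverse_inverse_eq)
      have r2: "r\<^sup>2 = exp (- (2 * t'))" "r ^ 4 = exp (- (4 * t'))" unfolding r_def exp_neg_power by (simp_all add: exp_minus)
      have "(exp (-y))\<^sup>2 / (exp (-x) * exp (-z)) = exp (x + z - 2 * y)" for x y z :: real
        by (simp add: power2_eq_square flip: exp_add exp_diff)
      then show ?thesis
        unfolding r2 unfolding r_def M_def using t' iq[of t'] iq[of "2 * t'"] iq[of "4 * t'"] by simp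
    qed
    finally show ?thesis .
  qed
  have Mb: "M \<le> exp (\<mu> / 4 + t' / 6)"
  proof -
    \<comment> \<open>In the law at t', 4t', 2t' the reciprocals combine with weight 1 + 1/4 - 2/2 =
      1/4, and all logarithms cancel.\<close>
    have e: "etaF t' + etaF (4 * t') - 2 * etaF (2 * t') = pi\<^sup>2 / (24 * t') - t' / 24
       + etaF (4 * pi\<^sup>2 / t') + etaF (pi\<^sup>2 / t') - 2 * etaF (2 * pi\<^sup>2 / t')"
    proof -
      have l: "ln (4 * t' / (2 * pi)) = ln (2 * t' / (2 * pi)) + ln 2" "ln (2 * t' / (2 * pi)) = ln (t' / (2 * pi)) + ln 2"
        using t' by (simp_all flip: ln_mult_pos)
      have "4 * pi\<^sup>2 / (4 * t') = pi\<^sup>2 / t'" "4 * pi\<^sup>2 / (2 * t') = 2 * pi\<^sup>2 / t'" by simp_all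
      then have "etaF (4 * t') = pi\<^sup>2 / (6 * (4 * t')) + (ln (t' / (2 * pi)) + 2 * ln 2) / 2 - 4 * t' / 24 + etaF (pi\<^sup>2 / t')"
        "etaF (2 * t') = pi\<^sup>2 / (6 * (2 * t')) + (ln (t' / (2 * pi)) + ln 2) / 2 - 2 * t' / 24 + etaF (2 * pi\<^sup>2 / t')"
        using etaF_transform[of "4 * t'"] etaF_transform[of "2 * t'"] t' l by simp_all
      then show ?thesis using etaF_transform[OF t'(1)] t' by (simp add: field_simps)
    qed
    \<comment> \<open>Together with -t'/24 these corrections amount to at most t'/6.\<close>
    have "etaF (4 * pi\<^sup>2 / t') \<le> t' / 24" "etaF (pi\<^sup>2 / t') \<le> t' / 6" "etaF (2 * pi\<^sup>2 / t') \<ge> 0"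
      using etaF_le_inverse[of "4 * pi\<^sup>2 / t'"] etaF_le_inverse[of "pi\<^sup>2 / t'"] etaF_nonneg[of "2 * pi\<^sup>2 / t'"] t' by simp_all
    moreover have "pi\<^sup>2 / (24 * t') = \<mu> / 4" using mu by (simp add: t'_def t_def)
    ultimately show ?thesis unfolding M_def e by simp
  qed
  have nt: "real n * t' = \<mu> / 4 + t' / 24"
  proof -
    have "real n = x + 1 / 24" using n by simp
    then show ?thesis using p(4) by (simp add: t'_def algebra_simps)
  qed
  have fr: "(1 + r) / (1 - r) \<le> 2 * (1 + t') / t'"
  proof -
    have "exp t' \<ge> 1 + t'" by (rule exp_ge_add_one_self)
    then have "r \<le> 1 / (1 + t')" using t' by (simp add: r_def exp_minus divide_simps)
    then have "t' / (1 + t') \<le> 1 - r" using t' by (simp add: field_simps)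
    then have "(1 + r) / (1 - r) \<le> 2 / (t' / (1 + t'))" using r t' by (intro frac_le) auto
    then show ?thesis by simp
  qed
  have "norm (2 * of_real pi * \<i> * crank_diff n) \<le> ((1 + r) / (1 - r) * M * exp (real n * t')) * norm (Complex t' pi - Complex t' (-pi))"
  proof (rule has_contour_integral_bound_linepath[OF I])
    show "0 \<le> (1 + r) / (1 - r) * M * exp (real n * t')" using r by (simp add: M_def)
    fix s assume "s \<in> closed_segment (Complex t' (-pi)) (Complex t' pi)"
    then have s: "Re s = t'" using closed_segment_same_Re[of s t' "-pi" pi] by simp
    have e: "norm (exp (of_nat n * s)) = exp (real n * t')" by (simp add: s)
    have "norm (f (exp (-s))) \<le> (1 + r) / (1 - r) * M" by (rule fb) (simp add: s r_def)
    then show "norm (f (exp (-s)) * exp (of_nat n * s)) \<le> (1 + r) / (1 - r) * M * exp (real n * t')"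
      unfolding norm_mult e by (rule mult_right_mono) simp
  qed
  moreover have "norm (Complex t' pi - Complex t' (-pi)) = 2 * pi" by (simp add: cmod_def real_sqrt_mult)
  moreover have "norm (2 * of_real pi * \<i> * crank_diff n) = 2 * pi * norm (crank_diff n)" by (simp add: norm_mult)
  ultimately have "2 * pi * norm (crank_diff n) \<le> 2 * pi * ((1 + r) / (1 - r) * M * exp (real n * t'))"
    by (simp only: mult.commute)
  then have "norm (crank_diff n) \<le> (1 + r) / (1 - r) * M * exp (real n * t')"
    by (subst (asm) mult_le_cancel_left_pos) auto
  also have "\<dots> \<le> (2 * (1 + t') / t') * exp (\<mu> / 4 + t' / 6) * exp (\<mu> / 4 + t' / 24)"
    unfolding nt using r t' by (intro mult_right_mono mult_mono fr Mb) (auto simp: M_def)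
  also have "\<dots> = exp (\<mu> / 2) * (2 * (1 + t') * exp (5 / 24 * t') / t')"
  proof -
    have "(\<mu> / 4 + t' / 6) + (\<mu> / 4 + t' / 24) = \<mu> / 2 + 5 / 24 * t'" by simp
    then have "exp (\<mu> / 4 + t' / 6) * exp (\<mu> / 4 + t' / 24) = exp (\<mu> / 2) * exp (5 / 24 * t')"
      by (simp only: exp_add[symmetric])
    then show ?thesis by (simp add: mult.assoc)
  qed
  also have "\<dots> \<le> exp (\<mu> / 2) * (2 * \<mu>)"
  proof (rule mult_left_mono)
    have "exp (5 / 24 * t') \<le> 1 + 5 / 24 * t' + (5 / 24 * t')\<^sup>2" using t' by (intro exp_bound) auto
    moreover have "(5 / 24 * t')\<^sup>2 \<le> 1 * (5 / 24 * t')" unfolding power2_eq_square using t' by (intro mult_right_mono) auto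
    ultimately have "exp (5 / 24 * t') \<le> 1.01" using t' by simp
    then have "2 * (1 + t') * exp (5 / 24 * t') \<le> 2 * (1 + 0.0187) * 1.01" using t' by (intro mult_mono) auto
    then have "2 * (1 + t') * exp (5 / 24 * t') \<le> 3" by simp
    moreover have "3 \<le> 2 * \<mu> * t'"
    proof -
      have "2 * \<mu> * t' = pi\<^sup>2 / 3" using mu by (simp add: t'_def t_def)
      moreover have "3 * 3 \<le> pi * pi" using pi_gt3 by (intro mult_mono) auto
      ultimately show ?thesis by (simp add: power2_eq_square)
    qed
    ultimately show "2 * (1 + t') * exp (5 / 24 * t') / t' \<le> 2 * \<mu>" using t' by (simp add: divide_le_eq)
  qed auto
  finally show ?thesis .
qed

text \<open>Everything is measured against exp (5\<mu>/8). The terms of size \<mu> exp (\<mu>/2),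
  including the crank difference, become 0.005 of it, and the middle of the segment enters with the
  factor 0.0086.\<close>

lemma error_le:
  "exp (\<mu> / 2) * (2 + 0.0318 * exp (\<mu> / 8) + 0.76 * exp (9 * \<mu> / 128)) + exp (\<mu> / 2) * (2 * \<mu>)
    \<le> pi\<^sup>2 / (6 * sqrt 3 * \<mu>\<^sup>2) * (1 - 1 / \<mu>) * exp \<mu> / \<mu> ^ 6"
proof -
  define u where "u = \<mu> / 88 - 1"
  have u: "u \<ge> 0" "\<mu> = 88 * (1 + u)" using mu by (auto simp: u_def)
  have e1: "exp 1 \<ge> (2.718 :: real)" using e_approx_32 by (simp add: abs_if split: if_splits)
  have en: "exp (real k) \<ge> 2.718 ^ k" for k
    using power_mono[OF e1, of k] by (simp flip: exp_of_nat_mult)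
  \<comment> \<open>88^8/exp 33 is about 16.8. With \<mu> = 88 (1 + u) the excess costs (1 + u)^8
    \<le> exp (8 u), well within exp (33 u).\<close>
  have X: "\<mu> ^ 8 \<le> 17 * exp (3 / 8 * \<mu>)"
  proof -
    have "\<mu> ^ 8 = 88 ^ 8 * (1 + u) ^ 8" unfolding u(2) by (rule power_mult_distrib)
    also have "(1 + u) ^ 8 \<le> exp u ^ 8" using u(1) by (intro power_mono exp_ge_add_one_self) auto
    also have "exp u ^ 8 = exp (8 * u)" using exp_of_nat_mult[of 8 u] by simp
    also have "88 ^ 8 * exp (8 * u) \<le> 17 * exp 33 * exp (33 * u)"
    proof (rule mult_mono)
      have "(88 :: real) ^ 8 \<le> 17 * 2.718 ^ 33" by (simp add: power_numeral_reduce)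
      then show "88 ^ 8 \<le> 17 * exp (33 :: real)" using en[of 33] by simp
    qed (use u in auto)
    also have "17 * exp 33 * exp (33 * u) = 17 * exp (3 / 8 * \<mu>)" unfolding u(2) by (simp add: algebra_simps flip: exp_add)
    finally show ?thesis by simp
  qed
  \<comment> \<open>The exponents differ by 7\<mu>/128, which is at least 7 * 88/128 =
    4.8125.\<close>
  have Y: "exp (9 * \<mu> / 128) \<le> 0.0086 * exp (\<mu> / 8)"
  proof -
    have "1 + 0.8125 + 0.8125\<^sup>2 / 2 \<le> exp (0.8125 :: real)" using exp_lower_Taylor_quadratic[of "0.8125"] by simp
    then have "2.1425 \<le> exp (0.8125 :: real)" by (simp add: power2_eq_square)
    then have "2.718 ^ 4 * 2.1425 \<le> exp (real 4) * exp (0.8125 :: real)" using en[of 4] by (intro mult_mono) auto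
    also have "\<dots> = exp (4.8125 :: real)" by (simp flip: exp_add)
    also have "\<dots> \<le> exp (7 * \<mu> / 128)" using mu by simp
    finally have "1 \<le> 0.0086 * exp (7 * \<mu> / 128)" by (simp add: power_numeral_reduce)
    then have "exp (9 * \<mu> / 128) * 1 \<le> exp (9 * \<mu> / 128) * (0.0086 * exp (7 * \<mu> / 128))" by (intro mult_left_mono) auto
    also have "\<dots> = 0.0086 * exp (\<mu> / 8)" by (simp flip: exp_add)
    finally show ?thesis by simp
  qed
  have T: "2 + 2 * \<mu> \<le> 0.005 * exp (\<mu> / 8)"
  proof -
    have "exp (\<mu> / 8) = exp 11 * exp (11 * u)" unfolding u(2) by (simp add: algebra_simps flip: exp_add)
    moreover have E: "59000 \<le> exp (11::real)"
    proof -
      have "(59000 :: real) \<le> 2.718 ^ 11" by (simp add: power_numeral_reduce)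
      then show ?thesis using en[of 11] by simp
    qed
    moreover have "1 + u \<le> exp (11 * u)" using exp_ge_add_one_self[of "11 * u"] u(1) by linarith
    then have "59000 * (1 + u) \<le> exp 11 * exp (11 * u)" using u(1) E by (intro mult_mono) auto
    ultimately have "59000 * (1 + u) \<le> exp (\<mu> / 8)" by (simp only:)
    then show ?thesis using u by simp
  qed
  have C: "0.93 \<le> pi\<^sup>2 / (6 * sqrt 3) * (1 - 1 / \<mu>)"
  proof -
    have "sqrt 3 \<le> sqrt (1.7321\<^sup>2)" by (intro real_sqrt_le_mono) (simp add: power2_eq_square)
    then have s3: "sqrt 3 \<le> 1.7321" by simp
    have "3.1415 * 3.1415 \<le> pi * pi" using pi_approx by (intro mult_mono) auto
    then have "3.1415 * 3.1415 / (6 * 1.7321) \<le> pi\<^sup>2 / (6 * sqrt 3)"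
      unfolding power2_eq_square using s3 by (intro frac_le) auto
    moreover have "1 - 1 / 88 \<le> 1 - 1 / \<mu>" using mu by (simp add: divide_simps)
    ultimately have "3.1415 * 3.1415 / (6 * 1.7321) * (1 - 1 / 88) \<le> pi\<^sup>2 / (6 * sqrt 3) * (1 - 1 / \<mu>)"
      by (intro mult_mono) auto
    then show ?thesis by simp
  qed
  define A where "A = exp (\<mu> / 8)"
  have A: "A > 0" by (simp add: A_def)
  have "exp (\<mu> / 2) * (2 + 0.0318 * exp (\<mu> / 8) + 0.76 * exp (9 * \<mu> / 128)) + exp (\<mu> / 2) * (2 * \<mu>)
     = exp (\<mu> / 2) * ((2 + 2 * \<mu>) + 0.0318 * A + 0.76 * exp (9 * \<mu> / 128))"
    by (simp add: A_def algebra_simps)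
  also have "\<dots> \<le> exp (\<mu> / 2) * (0.005 * A + 0.0318 * A + 0.76 * (0.0086 * A))"
    using T Y by (intro mult_left_mono add_mono) (auto simp: A_def)
  \<comment> \<open>0.005 + 0.0318 + 0.76 * 0.0086 < 0.0434, whereas 0.93/17 > 0.0547.\<close>
  also have "\<dots> \<le> exp (\<mu> / 2) * (0.93 / 17 * A)" using A by (intro mult_left_mono) auto
  also have "\<dots> = 0.93 * exp \<mu> / (17 * exp (3 / 8 * \<mu>))"
  proof -
    have "exp (\<mu> / 2) * A * exp (3 / 8 * \<mu>) = exp \<mu>" by (simp add: A_def flip: exp_add)
    then show ?thesis by (simp add: field_simps)
  qed
  also have "\<dots> \<le> pi\<^sup>2 / (6 * sqrt 3) * (1 - 1 / \<mu>) * exp \<mu> / \<mu> ^ 8"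
    using C X mu by (intro frac_le mult_right_mono) auto
  also have "\<dots> = pi\<^sup>2 / (6 * sqrt 3 * \<mu>\<^sup>2) * (1 - 1 / \<mu>) * exp \<mu> / \<mu> ^ 6"
    by (simp add: field_simps power_numeral_reduce)
  finally show ?thesis .
qed

end

theorem theorem3p1:
  fixes k n :: nat
  assumes "k = 0 \<or> k = 1"
    and "n > 0"
    and "mu n \<ge> 88"
  shows "G n * (1 - 1 / mu n ^ 6) \<le> real (crank_parity_count k n)
       \<and> real (crank_parity_count k n) \<le> G n * (1 + 1 / mu n ^ 6)"
proof -
  define m x where "m = mu n" and "x = real n - 1 / 24"
  have m: "m \<ge> 88" using assms(3) by (simp add: m_def)
  \<comment> \<open>Here n > 0 ensures that 24 n - 1 is nonnegative, so that squaring
    \<open>mu n\<close> removes the root.\<close>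
  have x: "x = 3 * m\<^sup>2 / (2 * pi\<^sup>2)"
    using assms(2) by (simp add: m_def mu_def x_def power_divide power_mult_distrib field_simps)
  define e where "e = exp (m / 2) * (2 + 0.0318 * exp (m / 8) + 0.76 * exp (9 * m / 128))"
  define d where "d = exp (m / 2) * (2 * m)"
  have main: "sqrt (pi\<^sup>2 / 6) * (1 - 1 / m) * exp m / (2 * sqrt 2 * pi * x) = 2 * G n"
  proof -
    have s6: "sqrt (pi\<^sup>2 / 6) = pi / (sqrt 2 * sqrt 3)"
      by (simp add: real_sqrt_divide flip: real_sqrt_mult)
    have "pi / (sqrt 2 * sqrt 3) * E / (2 * sqrt 2 * pi * (3 * m\<^sup>2 / (2 * pi\<^sup>2))) = 2 * (pi ^ 2 / (12 * sqrt 3 * m ^ 2) * E)" for E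
    proof -
      have "pi / (sqrt 2 * sqrt 3) * E / (2 * sqrt 2 * pi * (3 * m\<^sup>2 / (2 * pi\<^sup>2))) = pi\<^sup>2 * E / ((sqrt 2 * sqrt 2) * sqrt 3 * 3 * m\<^sup>2)"
        using m by (simp add: field_simps power2_eq_square)
      then show ?thesis using m by (simp add: field_simps)
    qed
    then show ?thesis unfolding s6 x G_def m_def[symmetric] by (simp only: mult.assoc)
  qed
  have p: "\<bar>real (npart n) - 2 * G n\<bar> \<le> e"
    using npart_estimate[OF m refl x refl, of n] unfolding main e_def by (simp add: x_def)
  have D: "norm (crank_diff n) \<le> d"
    using crank_diff_estimate[OF m refl x refl, of n] by (simp add: x_def d_def)
  have ed: "e + d \<le> 2 * G n / m ^ 6"
  proof -
    have "pi\<^sup>2 / (6 * sqrt 3 * m\<^sup>2) * (1 - 1 / m) * exp m = 2 * G n"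
      by (simp add: G_def m_def mult_ac)
    then show ?thesis using error_le[OF m refl refl refl] unfolding e_def d_def by simp
  qed
  define M where "M = real (crank_parity_count k n)"
  \<comment> \<open>Only the norm of the crank difference is known, which suffices because the two
    parities differ just in its sign.\<close>
  have "complex_of_real (2 * M - real (npart n)) = crank_diff n \<or> complex_of_real (2 * M - real (npart n)) = - crank_diff n"
    using assms(1) crank_parity_count_eq[of n] by (auto simp: M_def field_simps)
  then have "norm (complex_of_real (2 * M - real (npart n))) = norm (crank_diff n)" by (elim disjE) simp_all
  then have "\<bar>2 * M - real (npart n)\<bar> \<le> d" using D by (simp only: norm_of_real)
  then have "\<bar>2 * M - 2 * G n\<bar> \<le> 2 * G n / m ^ 6" using p ed by linarith
  moreover have "2 * G n / m ^ 6 = 2 * (G n / m ^ 6)" by simp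
  ultimately have "\<bar>M - G n\<bar> \<le> G n / m ^ 6" by linarith
  moreover have "G n * (1 - 1 / m ^ 6) = G n - G n / m ^ 6" "G n * (1 + 1 / m ^ 6) = G n + G n / m ^ 6"
    by (simp_all add: right_diff_distrib distrib_left)
  ultimately show ?thesis
    unfolding M_def[symmetric] m_def[symmetric] by (simp only: abs_diff_le_iff)
qed

end
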